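(* Suppose that for every conditional distribution $p_{X_{\{1\}}|X}$ (with $X_{\{1\}}$ on $\hat{\mathcal{X}}$) that achieves $R(D_{\{1\}})$, $X$ is not weakly independent of the induced $X_{\{1\}}$. Then $$D^*_{\{2\}}(D_{\{1\}},D_{\{1,2\}})=\min_{p_{X_{\{1\}}X_{\{2\}}|X},g_1,g_2}\mathbb{E}[d(X,g_1(X_{\{2\}}))],$$ where $X_{\{1\}}$ takes values in $\hat{\mathcal{X}}$, $X_{\{2\}}$ takes values in a finite set $\mathcal{X}_2$, $g_1:\mathcal{X}_2\to\hat{\mathcal{X}}$, $g_2:\hat{\mathcal{X}}\times\mathcal{X}_2\to\hat{\mathcal{X}}$, and the minimization is subject to $I(X_{\{1\}};X_{\{2\}})=0$, $I(X;X_{\{1\}})=R(D_{\{1\}})$, $I(X;X_{\{1\}},X_{\{2\}})=R(R(D_{\{1\}}),D_{\{1\}},D_{\{1,2\}})$, $\mathbb{E}[d(X,X_{\{1\}})]\le D_{\{1\}}$, and $\mathbb{E}[d(X,g_2(X_{\{1\}},X_{\{2\}}))]\le D_{\{1,2\}}$. Moreover, one can assume $|\mathcal{X}_2|\le|\hat{\mathcal{X}}|^4-|\hat{\mathcal{X}}|$.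
   Context: Let $\{X(t)\}_{t\ge1}$ be an i.i.d. process with marginal $p_X$ on a finite set $\mathcal{X}$, $X$ a random variable with distribution $p_X$, $\hat{\mathcal{X}}$ a finite reconstruction set, and $d:\mathcal{X}\times\hat{\mathcal{X}}\to[0,\infty)$ a distortion measure. A tuple $(R_1,R_2,D_{\{1\}},D_{\{2\}},D_{\{1,2\}})$ is achievable if for every $\epsilon>0$ and all sufficiently large $n$ there exist encoders $f_k^{(n)}:\mathcal{X}^n\to\mathcal{C}_k^{(n)}$, $k=1,2$, and decoders $g_{\mathcal{K}}^{(n)}:\prod_{k\in\mathcal{K}}\mathcal{C}_k^{(n)}\to\hat{\mathcal{X}}^n$, $\mathcal{K}\in\{\{1\},\{2\},\{1,2\}\}$, with $\frac1n\log|\mathcal{C}_k^{(n)}|\le R_k+\epsilon$ and $\frac1n\sum_{t=1}^n\mathbb{E}[d(X(t),\hat X_{\mathcal{K}}(t))]\le D_{\mathcal{K}}+\epsilon$, where $\hat X_{\mathcal{K}}^n=g^{(n)}_{\mathcal{K}}(f_k^{(n)}(X^n),k\in\mathcal{K})$. $\mathcal{RD}_{\text{MD}}$ is the set of achievable tuples. The scalable coding region $\mathcal{RD}_{\text{SC}}$ is the set of $(R_1,R_2,D_{\{1\}},D_{\{1,2\}})$ such that $(R_1,R_2,D_{\{1\}},\infty,D_{\{1,2\}})\in\mathcal{RD}_{\text{MD}}$ (i.e., no constraint on decoder $\{2\}$). Define $R(R_1,D_{\{1\}},D_{\{1,2\}})=\min\{R_1+R_2:(R_1,R_2,D_{\{1\}},D_{\{1,2\}})\in\mathcal{RD}_{\text{SC}}\}$,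 the rate-distortion function $R(D)=\min_{p_{\hat X|X}:\mathbb{E}[d(X,\hat X)]\le D}I(X;\hat X)$, and $D^*_{\{2\}}(D_{\{1\}},D_{\{1,2\}})=\min\{D_{\{2\}}: R_1=R(D_{\{1\}}),\ R_1+R_2=R(R_1,D_{\{1\}},D_{\{1,2\}}),\ (R_1,R_2,D_{\{1\}},D_{\{2\}},D_{\{1,2\}})\in\mathcal{RD}_{\text{MD}}\}$. For jointly distributed $U,V$ on finite sets, $U$ is weakly independent of $V$ if the rows of the stochastic matrix $[p_{U|V}(u|v)]$ (rows indexed by $v$) are linearly dependent.
   Formalization: The formal statement assumes that the reconstruction set has at least two elements (for one element the bound on |X_2| would be 0, which is impossible) and that D_{1} and D_{1,2} are attainable distortion levels, so that the minima are defined. *)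

theory Defs
  imports "HOL-Analysis.Analysis"
begin

text \<open>Finite source alphabet = finite type 'x, reconstruction alphabet = finite type 'y.
  The source marginal is p :: 'x => real, distortion d :: 'x => 'y => real.
  Information quantities use logarithms to base 2 (consistently with the rates).\<close>

definition is_pmf :: "('a::finite \<Rightarrow> real) \<Rightarrow> bool" where
  "is_pmf p \<longleftrightarrow> (\<forall>a. 0 \<le> p a) \<and> (\<Sum>a\<in>UNIV. p a) = 1"

definition mutual_info :: "('a \<Rightarrow> 'b \<Rightarrow> real) \<Rightarrow> 'a set \<Rightarrow> 'b set \<Rightarrow> real" where
  "mutual_info P A B =
     (\<Sum>a\<in>A. \<Sum>b\<in>B. if P a b > 0
        then P a b * log 2 (P a b / ((\<Sum>b'\<in>B. P a b') * (\<Sum>a'\<in>A. P a' b)))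
        else 0)"

text \<open>U (on A) is weakly independent of V (on B), for a joint pmf P on A x B:
  the rows of the stochastic matrix [p_{U|V}(u|v)] (rows indexed by v in the support
  of V) are linearly dependent (as a family).\<close>
definition weakly_indep :: "('a \<Rightarrow> 'b \<Rightarrow> real) \<Rightarrow> 'a set \<Rightarrow> 'b set \<Rightarrow> bool" where
  "weakly_indep P A B \<longleftrightarrow>
     (let PV = (\<lambda>v. \<Sum>u\<in>A. P u v); S = {v\<in>B. PV v > 0} in
      \<exists>c :: 'b \<Rightarrow> real. (\<exists>v\<in>S. c v \<noteq> 0) \<and>
         (\<forall>u\<in>A. (\<Sum>v\<in>S. c v * (P u v / PV v)) = 0))"

definition test_channel :: "('x::finite \<Rightarrow> 'y::finite \<Rightarrow> real) \<Rightarrow> bool" where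
  "test_channel c \<longleftrightarrow> (\<forall>x y. 0 \<le> c x y) \<and> (\<forall>x. (\<Sum>y\<in>UNIV. c x y) = 1)"

definition exp_dist ::
  "('x::finite \<Rightarrow> real) \<Rightarrow> ('x \<Rightarrow> 'y::finite \<Rightarrow> real) \<Rightarrow> ('x \<Rightarrow> 'y \<Rightarrow> real) \<Rightarrow> real" where
  "exp_dist p d c = (\<Sum>x\<in>UNIV. \<Sum>y\<in>UNIV. p x * c x y * d x y)"

definition rate_dist ::
  "('x::finite \<Rightarrow> real) \<Rightarrow> ('x \<Rightarrow> 'y::finite \<Rightarrow> real) \<Rightarrow> real \<Rightarrow> real" where
  "rate_dist p d D = Inf {mutual_info (\<lambda>x y. p x * c x y) UNIV UNIV | c.
      test_channel c \<and> exp_dist p d c \<le> D}"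

text \<open>Operational definitions. Source blocks of length n are lists of length n over 'x,
  with i.i.d. probability prod_list (map p xs). Codebook C_k = {..<M_k} (without loss of generality).\<close>
definition block_prob :: "('x \<Rightarrow> real) \<Rightarrow> 'x list \<Rightarrow> real" where
  "block_prob p xs = prod_list (map p xs)"

definition avg_dist ::
  "('x::finite \<Rightarrow> real) \<Rightarrow> ('x \<Rightarrow> 'y \<Rightarrow> real) \<Rightarrow> nat \<Rightarrow> ('x list \<Rightarrow> 'y list) \<Rightarrow> real" where
  "avg_dist p d n F = (\<Sum>xs\<in>{xs. length xs = n}.
       block_prob p xs * ((\<Sum>t<n. d (xs ! t) (F xs ! t)) / real n))"

text \<open>Achievability of (R1,R2,D{1},D{2},D{1,2}) for multiple descriptions;
  distortions are extended reals so that D = \<infinity> means "no constraint".\<close>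
definition achievable_MD ::
  "('x::finite \<Rightarrow> real) \<Rightarrow> ('x \<Rightarrow> 'y \<Rightarrow> real) \<Rightarrow> real \<Rightarrow> real \<Rightarrow> ereal \<Rightarrow> ereal \<Rightarrow> ereal \<Rightarrow> bool"
  where
  "achievable_MD p d R1 R2 D1 D2 D12 \<longleftrightarrow>
    (\<forall>\<epsilon>>0. \<exists>N. \<forall>n\<ge>N. \<exists>(M1::nat) (M2::nat) (f1::'x list \<Rightarrow> nat) (f2::'x list \<Rightarrow> nat)
        (g1::nat \<Rightarrow> 'y list) (g2::nat \<Rightarrow> 'y list) (g12::nat \<Rightarrow> nat \<Rightarrow> 'y list).
       (\<forall>xs. length xs = n \<longrightarrow> f1 xs < M1 \<and> f2 xs < M2) \<and>
       (\<forall>i. length (g1 i) = n) \<and> (\<forall>j. length (g2 j) = n) \<and> (\<forall>i j. length (g12 i j) = n) \<and>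
       log 2 (real M1) / real n \<le> R1 + \<epsilon> \<and>
       log 2 (real M2) / real n \<le> R2 + \<epsilon> \<and>
       ereal (avg_dist p d n (\<lambda>xs. g1 (f1 xs))) \<le> D1 + ereal \<epsilon> \<and>
       ereal (avg_dist p d n (\<lambda>xs. g2 (f2 xs))) \<le> D2 + ereal \<epsilon> \<and>
       ereal (avg_dist p d n (\<lambda>xs. g12 (f1 xs) (f2 xs))) \<le> D12 + ereal \<epsilon>)"

definition achievable_SC ::
  "('x::finite \<Rightarrow> real) \<Rightarrow> ('x \<Rightarrow> 'y \<Rightarrow> real) \<Rightarrow> real \<Rightarrow> real \<Rightarrow> real \<Rightarrow> real \<Rightarrow> bool" where
  "achievable_SC p d R1 R2 D1 D12 \<longleftrightarrow> achievable_MD p d R1 R2 (ereal D1) \<infinity> (ereal D12)"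

definition rate_SC ::
  "('x::finite \<Rightarrow> real) \<Rightarrow> ('x \<Rightarrow> 'y \<Rightarrow> real) \<Rightarrow> real \<Rightarrow> real \<Rightarrow> real \<Rightarrow> real" where
  "rate_SC p d R1 D1 D12 = Inf {R1 + R2 | R2. achievable_SC p d R1 R2 D1 D12}"

definition D2star_set ::
  "('x::finite \<Rightarrow> real) \<Rightarrow> ('x \<Rightarrow> 'y::finite \<Rightarrow> real) \<Rightarrow> real \<Rightarrow> real \<Rightarrow> real set" where
  "D2star_set p d D1 D12 = {D2. \<exists>R1 R2. R1 = rate_dist p d D1 \<and>
      R1 + R2 = rate_SC p d R1 D1 D12 \<and>
      achievable_MD p d R1 R2 (ereal D1) (ereal D2) (ereal D12)}"

text \<open>The single-letter characterization. The auxiliary alphabet of X{2} is {..<k};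
  q x y j = p_{X{1}X{2}|X}(y,j|x); the admissible sizes k are restricted by K.\<close>
definition single_letter_set ::
  "('x::finite \<Rightarrow> real) \<Rightarrow> ('x \<Rightarrow> 'y::finite \<Rightarrow> real) \<Rightarrow> real \<Rightarrow> real \<Rightarrow> (nat \<Rightarrow> bool) \<Rightarrow> real set"
  where
  "single_letter_set p d D1 D12 K =
    {(\<Sum>x\<in>UNIV. \<Sum>y\<in>UNIV. \<Sum>j<k. p x * q x y j * d x (g1 j)) | k q g1.
      K k \<and>
      (\<forall>x y j. 0 \<le> q x y j) \<and> (\<forall>x. (\<Sum>y\<in>UNIV. \<Sum>j<k. q x y j) = 1) \<and>
      (\<exists>g2 :: 'y \<Rightarrow> nat \<Rightarrow> 'y.
        mutual_info (\<lambda>y j. \<Sum>x\<in>UNIV. p x * q x y j) UNIV {..<k} = 0 \<and>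
        mutual_info (\<lambda>x y. \<Sum>j<k. p x * q x y j) UNIV UNIV = rate_dist p d D1 \<and>
        mutual_info (\<lambda>x (y, j). p x * q x y j) UNIV (UNIV \<times> {..<k})
          = rate_SC p d (rate_dist p d D1) D1 D12 \<and>
        (\<Sum>x\<in>UNIV. \<Sum>y\<in>UNIV. \<Sum>j<k. p x * q x y j * d x y) \<le> D1 \<and>
        (\<Sum>x\<in>UNIV. \<Sum>y\<in>UNIV. \<Sum>j<k. p x * q x y j * d x (g2 y j)) \<le> D12)}"

definition is_min_of :: "real set \<Rightarrow> real \<Rightarrow> bool" where
  "is_min_of S v \<longleftrightarrow> v \<in> S \<and> (\<forall>w\<in>S. v \<le> w)"

end

theory Submission
  imports Defs
begin

text \<open>Achievability is a two-stage random covering argument. Since \<open>X\<^sub>1\<close> and \<open>X\<^sub>2\<close> are independent, the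
  second codebook can be drawn from the marginal of \<open>X\<^sub>2\<close>, and it has to cover the pair
  \<open>(X, X\<^sub>1)\<close> at rate \<open>I(X X\<^sub>1; X\<^sub>2) = I(X; X\<^sub>1 X\<^sub>2) - I(X; X\<^sub>1)\<close>.

  For the converse, a code whose sum rate is that of scalable coding has nearly independent
  descriptions \<open>W\<^sub>1, W\<^sub>2\<close>. This does not make the reconstructions independent letter by letter, because
  \<open>W\<^sub>1\<close> need not be a memoryless codeword. So a fresh i.i.d. source block \<open>X'\<close> is drawn given \<open>W\<^sub>1\<close>:
  then \<open>I(X'; W\<^sub>2) \<le> I(W\<^sub>1; W\<^sub>2)\<close> splits over the letters, and optimality of \<open>W\<^sub>1\<close> at rate \<open>R(D\<^sub>1)\<close>
  makes \<open>X'\<close> conditionally independent of \<open>W\<^sub>2\<close> given the letter \<open>X\<^sub>1\<close>. In the single-letter limit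
  \<open>I(X'; X\<^sub>2) = I(X'; X\<^sub>2 | X\<^sub>1) = 0\<close>, and linear independence of the rows of \<open>p(x | x\<^sub>1)\<close> yields
  \<open>I(X\<^sub>1; X\<^sub>2) = 0\<close>. Finally the joint reconstruction is turned into a function of \<open>X\<^sub>1\<close> and of a refined
  \<open>X\<^sub>2\<close> by a functional representation, which also bounds the alphabet of \<open>X\<^sub>2\<close>.\<close>

section \<open>Entropy and mutual information on finite probability spaces\<close>

text \<open>The slack in the rates is n\<epsilon>, so I(W1;W2) may grow with n and is small only per
  letter. It bounds a sum of single-letter informations if the letters on one side are independent;
  reconstruction letters need not be, the letters of a resampled source block are. Since X' - W1 -
  W2 is a Markov chain, I(X'; X1 X2) stays within the first rate R(D1), which I(X'; X1) already
  exhausts; this forces I(X'; X2 | X1) = 0. The zeros become exact in a limit, which exists because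
  a uniform time index puts the laws of all block lengths on one finite set.
  \<open>rate_dist\<close> is a single-letter quantity, but \<open>rate_SC\<close> is operational:
  the lower bound on I(X; X1 X2 X12) is not read off a formula but comes from the coding theorem
  with a constant second description. The functional representation uses at most m^3 letters for m =
  \<open>CARD('y)\<close>, and m^3 \<le> m^4 - m for m \<ge> 2. Existence of the minimum is settled
  on the operational side, where the set of distortions is closed; the single-letter minima follow
  by comparison.\<close>

lemma mul_ln_ratio_ge:
  fixes a b :: real
  assumes "0 \<le> a" "0 \<le> b" "b = 0 \<Longrightarrow> a = 0"
  shows "a * ln (a / b) - a + b \<ge> 0"
proof (cases "a = 0")
  case False
  then have "a > 0" "b > 0" using assms by (auto simp: less_le)
  then have "ln (b / a) \<le> b / a - 1" by (intro ln_le_minus_one) auto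
  then have "a * ln (b / a) \<le> a * (b / a - 1)" using \<open>a > 0\<close> by (intro mult_left_mono) auto
  then show ?thesis using \<open>a > 0\<close> \<open>b > 0\<close> by (simp add: ln_div algebra_simps)
qed (use assms in auto)

lemma mul_ln_ratio_eq_0_imp:
  fixes a b :: real
  assumes "0 \<le> a" "0 \<le> b" "b = 0 \<Longrightarrow> a = 0" "a * ln (a / b) - a + b = 0"
  shows "a = b"
proof (cases "a = 0")
  case False
  then have "a > 0" "b > 0" using assms by (auto simp: less_le)
  have "a * ln (b / a) = a * (b / a - 1)" using \<open>a > 0\<close> \<open>b > 0\<close> assms(4)
    by (simp add: ln_div algebra_simps)
  then have "ln (b / a) = b / a - 1" using \<open>a > 0\<close> by simp
  then have "b / a = 1" using \<open>a > 0\<close> \<open>b > 0\<close> by (intro ln_eq_minus_one) auto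
  then show ?thesis using \<open>a > 0\<close> by simp
qed (use assms in auto)

text \<open>Termwise from ln z \<le> z - 1 at z = b/a; the linear terms add up to
  \<open>sum b S - sum a S\<close>, which is not positive. Since ln z = z - 1 only at z = 1, a sum
  that is not positive forces equality in every term.\<close>

lemma gibbs:
  fixes a b :: "'s \<Rightarrow> real"
  assumes "finite S" "\<And>s. s \<in> S \<Longrightarrow> 0 \<le> a s" "\<And>s. s \<in> S \<Longrightarrow> 0 \<le> b s"
    "\<And>s. s \<in> S \<Longrightarrow> b s = 0 \<Longrightarrow> a s = 0" "sum b S \<le> sum a S"
  shows "0 \<le> (\<Sum>s\<in>S. a s * log 2 (a s / b s))"
    and "(\<Sum>s\<in>S. a s * log 2 (a s / b s)) \<le> 0 \<Longrightarrow> s \<in> S \<Longrightarrow> a s = b s"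
proof -
  let ?K = "\<lambda>s. a s * ln (a s / b s) - a s + b s"
  have nn: "0 \<le> ?K s" if "s \<in> S" for s
    by (rule mul_ln_ratio_ge) (use assms that in auto)
  have eq: "(\<Sum>s\<in>S. a s * log 2 (a s / b s)) = (\<Sum>s\<in>S. a s * ln (a s / b s)) / ln 2"
    by (simp add: log_def sum_divide_distrib)
  have sK: "sum ?K S = (\<Sum>s\<in>S. a s * ln (a s / b s)) - sum a S + sum b S"
    by (simp add: sum.distrib sum_subtractf)
  have "0 \<le> sum ?K S" using nn by (intro sum_nonneg) auto
  then show "0 \<le> (\<Sum>s\<in>S. a s * log 2 (a s / b s))"
    unfolding eq using sK assms(5) by (intro divide_nonneg_nonneg) auto
  assume "(\<Sum>s\<in>S. a s * log 2 (a s / b s)) \<le> 0" "s \<in> S"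
  then have "(\<Sum>s\<in>S. a s * ln (a s / b s)) \<le> 0" unfolding eq
    by (simp add: divide_le_0_iff)
  then have "sum ?K S \<le> 0" using sK assms(5) by linarith
  then have "sum ?K S = 0" using \<open>0 \<le> sum ?K S\<close> by linarith
  then have "?K s = 0" using nn \<open>s \<in> S\<close> assms(1) by (simp add: sum_nonneg_eq_0_iff)
  then show "a s = b s" by (rule mul_ln_ratio_eq_0_imp[rotated -1]) (use assms \<open>s \<in> S\<close> in auto)
qed

locale fin_prob =
  fixes \<Omega> :: "'w set" and P :: "'w \<Rightarrow> real"
  assumes fin: "finite \<Omega>" and nonneg: "\<And>w. w \<in> \<Omega> \<Longrightarrow> 0 \<le> P w" and sum1: "sum P \<Omega> = 1"
begin

definition prb :: "('w \<Rightarrow> 'a) \<Rightarrow> 'a \<Rightarrow> real" where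
  "prb f v = (\<Sum>w | w \<in> \<Omega> \<and> f w = v. P w)"

text \<open>Averaged over the sample space instead of over values, so that no alphabet has to be
  fixed; points of weight zero contribute nothing. \<open>ent_sum\<close> recovers the usual
  formula.\<close>

definition ent :: "('w \<Rightarrow> 'a) \<Rightarrow> real" where
  "ent f = - (\<Sum>w\<in>\<Omega>. P w * log 2 (prb f (f w)))"

definition mi :: "('w \<Rightarrow> 'a) \<Rightarrow> ('w \<Rightarrow> 'b) \<Rightarrow> real" where
  "mi f g = ent f + ent g - ent (\<lambda>w. (f w, g w))"

definition cmi :: "('w \<Rightarrow> 'a) \<Rightarrow> ('w \<Rightarrow> 'b) \<Rightarrow> ('w \<Rightarrow> 'c) \<Rightarrow> real" where
  "cmi f g h = ent (\<lambda>w. (f w, h w)) + ent (\<lambda>w. (g w, h w)) - ent (\<lambda>w. (f w, g w, h w)) - ent h"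

lemma prb_nonneg: "0 \<le> prb f v"
  unfolding prb_def by (intro sum_nonneg) (auto simp: nonneg)

lemma prb_ge: "w \<in> \<Omega> \<Longrightarrow> P w \<le> prb f (f w)"
  unfolding prb_def using fin nonneg by (intro member_le_sum) auto

lemma prb_mono:
  assumes "\<And>w'. w' \<in> \<Omega> \<Longrightarrow> f w' = u \<Longrightarrow> g w' = v"
  shows "prb f u \<le> prb g v"
  unfolding prb_def by (rule sum_mono2) (use fin nonneg in \<open>auto intro: assms\<close>)

lemma prb_cong:
  assumes "\<And>w'. w' \<in> \<Omega> \<Longrightarrow> f w' = u \<longleftrightarrow> g w' = v"
  shows "prb f u = prb g v"
proof -
  have "{w \<in> \<Omega>. f w = u} = {w \<in> \<Omega>. g w = v}" using assms by blast
  then show ?thesis unfolding prb_def by simp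
qed

lemma prb_alt: "prb f v = (\<Sum>w\<in>\<Omega>. if f w = v then P w else 0)"
  unfolding prb_def using fin by (simp add: sum.If_cases Int_def)

lemma sum_prb:
  assumes "finite A" "f ` \<Omega> \<subseteq> A"
  shows "(\<Sum>v\<in>A. prb f v * F v) = (\<Sum>w\<in>\<Omega>. P w * F (f w))"
proof -
  have "(\<Sum>w\<in>\<Omega>. P w * F (f w)) = (\<Sum>v\<in>A. \<Sum>w | w \<in> \<Omega> \<and> f w = v. P w * F (f w))"
    using fin assms by (intro sum.group[symmetric]) auto
  also have "\<dots> = (\<Sum>v\<in>A. prb f v * F v)"
    unfolding prb_def sum_distrib_right by (intro sum.cong) auto
  finally show ?thesis by simp
qed

lemma sum_prb_1: "finite A \<Longrightarrow> f ` \<Omega> \<subseteq> A \<Longrightarrow> (\<Sum>v\<in>A. prb f v) = 1"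
  using sum_prb[of A f "\<lambda>_. 1"] sum1 by simp

lemma prb_marginal:
  assumes "finite B" "g ` \<Omega> \<subseteq> B"
  shows "(\<Sum>v\<in>B. prb (\<lambda>w. (f w, g w)) (u, v)) = prb f u"
proof -
  have "(\<Sum>v\<in>B. prb (\<lambda>w. (f w, g w)) (u, v)) = (\<Sum>v\<in>B. \<Sum>w | w \<in> {w\<in>\<Omega>. f w = u} \<and> g w = v. P w)"
    unfolding prb_def by (intro sum.cong) auto
  also have "\<dots> = sum P {w\<in>\<Omega>. f w = u}"
    using fin assms by (intro sum.group) auto
  finally show ?thesis by (simp add: prb_def)
qed

lemma prb_marginal':
  assumes "finite A" "f ` \<Omega> \<subseteq> A"
  shows "(\<Sum>u\<in>A. prb (\<lambda>w. (f w, g w)) (u, v)) = prb g v"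
proof -
  have "prb (\<lambda>w. (f w, g w)) (u, v) = prb (\<lambda>w. (g w, f w)) (v, u)" for u
    by (rule prb_cong) auto
  then show ?thesis using prb_marginal[of A f g v] assms by simp
qed

text \<open>Entropy sees a random variable only through its level sets; this takes the place of
  explicit bijections between tuples that are nested or ordered differently.\<close>

lemma ent_cong:
  assumes "\<And>w w'. w \<in> \<Omega> \<Longrightarrow> w' \<in> \<Omega> \<Longrightarrow> f w = f w' \<longleftrightarrow> g w = g w'"
  shows "ent f = ent g"
  unfolding ent_def
  by (intro arg_cong[where f = uminus] sum.cong refl arg_cong2[where f = "(*)"]
       arg_cong[where f = "log 2"] prb_cong) (rule assms)

lemma ent_mono:
  assumes "\<And>w w'. w \<in> \<Omega> \<Longrightarrow> w' \<in> \<Omega> \<Longrightarrow> g w = g w' \<Longrightarrow> f w = f w'"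
  shows "ent f \<le> ent g"
proof -
  have "P w * log 2 (prb g (g w)) \<le> P w * log 2 (prb f (f w))" if "w \<in> \<Omega>" for w
  proof (cases "P w = 0")
    case False
    then have "0 < P w" using nonneg[OF that] by simp
    then have "0 < prb g (g w)" using prb_ge[OF that, of g] by linarith
    moreover have "prb g (g w) \<le> prb f (f w)"
      by (rule prb_mono) (rule assms[OF _ that])
    ultimately show ?thesis using \<open>0 < P w\<close> by (intro mult_left_mono) auto
  qed auto
  then show ?thesis unfolding ent_def by (simp add: sum_mono)
qed

lemma ent_sum:
  assumes "finite A" "f ` \<Omega> \<subseteq> A"
  shows "ent f = - (\<Sum>v\<in>A. prb f v * log 2 (prb f v))"
  unfolding ent_def using sum_prb[OF assms, of "\<lambda>v. log 2 (prb f v)"] by simp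

lemma ent_const: "ent (\<lambda>_. c) = 0"
  using ent_sum[of "{c}" "\<lambda>_. c"] sum1 by (auto simp: prb_def)

text \<open>Exhibits the combination of entropies as a relative entropy: of the joint law to the law
  with the same marginals of (f, h) and (g, h) under which f and g are conditionally independent
  given h. In this form \<open>gibbs\<close> applies.\<close>

lemma cmi_eq_sum:
  assumes "finite A" "f ` \<Omega> \<subseteq> A" "finite B" "g ` \<Omega> \<subseteq> B" "finite C" "h ` \<Omega> \<subseteq> C"
  shows "cmi f g h = (\<Sum>(u, v, z)\<in>A \<times> B \<times> C. prb (\<lambda>w. (f w, g w, h w)) (u, v, z) *
    log 2 (prb (\<lambda>w. (f w, g w, h w)) (u, v, z) /
      (prb (\<lambda>w. (f w, h w)) (u, z) * prb (\<lambda>w. (g w, h w)) (v, z) / prb h z)))"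
    (is "_ = ?R")
proof -
  let ?F = "\<lambda>(u, v, z). log 2 (prb (\<lambda>w. (f w, g w, h w)) (u, v, z) /
      (prb (\<lambda>w. (f w, h w)) (u, z) * prb (\<lambda>w. (g w, h w)) (v, z) / prb h z))"
  have "?R = (\<Sum>s\<in>A \<times> B \<times> C. prb (\<lambda>w. (f w, g w, h w)) s * ?F s)"
    by (intro sum.cong) auto
  also have "\<dots> = (\<Sum>w\<in>\<Omega>. P w * ?F (f w, g w, h w))"
    using assms by (intro sum_prb) auto
  also have "\<dots> = (\<Sum>w\<in>\<Omega>. P w * log 2 (prb (\<lambda>w. (f w, g w, h w)) (f w, g w, h w)) +
      P w * log 2 (prb h (h w)) - P w * log 2 (prb (\<lambda>w. (f w, h w)) (f w, h w))
      - P w * log 2 (prb (\<lambda>w. (g w, h w)) (g w, h w)))"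
  proof (intro sum.cong refl)
    fix w assume w: "w \<in> \<Omega>"
    show "P w * ?F (f w, g w, h w) = P w * log 2 (prb (\<lambda>w. (f w, g w, h w)) (f w, g w, h w)) +
      P w * log 2 (prb h (h w)) - P w * log 2 (prb (\<lambda>w. (f w, h w)) (f w, h w))
      - P w * log 2 (prb (\<lambda>w. (g w, h w)) (g w, h w))"
    proof (cases "P w = 0")
      case False
      then have "0 < P w" using nonneg[OF w] by simp
      then have pos': "0 < prb k (k w)" for k :: "'w \<Rightarrow> 'a \<times> 'b \<times> 'c"
        using prb_ge[OF w, of k] by linarith
      have pos1: "0 < prb k (k w)" for k :: "'w \<Rightarrow> 'a \<times> 'c"
        using prb_ge[OF w, of k] \<open>0 < P w\<close> by linarith
      have pos2: "0 < prb k (k w)" for k :: "'w \<Rightarrow> 'b \<times> 'c"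
        using prb_ge[OF w, of k] \<open>0 < P w\<close> by linarith
      have pos3: "0 < prb h (h w)"
        using prb_ge[OF w, of h] \<open>0 < P w\<close> by linarith
      show ?thesis
        using pos'[of "\<lambda>w. (f w, g w, h w)"] pos1[of "\<lambda>w. (f w, h w)"] pos2[of "\<lambda>w. (g w, h w)"] pos3
        by (simp add: log_divide log_mult algebra_simps)
    qed auto
  qed
  also have "\<dots> = cmi f g h"
    unfolding cmi_def ent_def by (simp add: sum.distrib sum_subtractf)
  finally show ?thesis by simp
qed

lemma cmi_nonneg: "0 \<le> cmi f g h"
  and cmi_zero_imp: "cmi f g h \<le> 0 \<Longrightarrow>
    prb (\<lambda>w. (f w, g w, h w)) (u, v, z) =
    prb (\<lambda>w. (f w, h w)) (u, z) * prb (\<lambda>w. (g w, h w)) (v, z) / prb h z"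
proof -
  \<comment> \<open>The point (u, v, z) is added to the ranges, so that the factorization is
    obtained also where some value is never taken.\<close>
  define A where "A = insert u (f ` \<Omega>)"
  define B where "B = insert v (g ` \<Omega>)"
  define C where "C = insert z (h ` \<Omega>)"
  have AB: "finite A" "f ` \<Omega> \<subseteq> A" "finite B" "g ` \<Omega> \<subseteq> B" "finite C" "h ` \<Omega> \<subseteq> C"
    "(u,v,z) \<in> A \<times> B \<times> C"
    using fin by (auto simp: A_def B_def C_def)
  let ?a = "\<lambda>(u,v,z). prb (\<lambda>w. (f w, g w, h w)) (u, v, z)"
  let ?b = "\<lambda>(u,v,z). prb (\<lambda>w. (f w, h w)) (u, z) * prb (\<lambda>w. (g w, h w)) (v, z) / prb h z"
  have eq: "cmi f g h = (\<Sum>s\<in>A \<times> B \<times> C. ?a s * log 2 (?a s / ?b s))"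
    unfolding cmi_eq_sum[OF AB(1-6)] by (intro sum.cong) auto
  have suma: "sum ?a (A \<times> B \<times> C) = 1"
    using sum_prb_1[of "A \<times> B \<times> C" "\<lambda>w. (f w, g w, h w)"] AB by (auto simp: case_prod_beta)
  have "sum ?b (A \<times> B \<times> C) = (\<Sum>u\<in>A. \<Sum>v\<in>B. \<Sum>z\<in>C. prb (\<lambda>w. (f w, h w)) (u, z) * prb (\<lambda>w. (g w, h w)) (v, z) / prb h z)"
    by (simp add: sum.cartesian_product case_prod_beta)
  also have "\<dots> = (\<Sum>z\<in>C. \<Sum>u\<in>A. \<Sum>v\<in>B. prb (\<lambda>w. (f w, h w)) (u, z) * prb (\<lambda>w. (g w, h w)) (v, z) / prb h z)"
    by (subst sum.swap[of _ C B], subst sum.swap[of _ C A]) simp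
  also have "\<dots> = (\<Sum>z\<in>C. (\<Sum>u\<in>A. prb (\<lambda>w. (f w, h w)) (u, z)) * (\<Sum>v\<in>B. prb (\<lambda>w. (g w, h w)) (v, z)) / prb h z)"
    by (simp add: sum_product sum_divide_distrib)
  also have "\<dots> = (\<Sum>z\<in>C. prb h z)"
    using AB by (intro sum.cong refl) (simp add: prb_marginal')
  also have "\<dots> = 1" using AB sum_prb_1 by auto
  finally have sumb: "sum ?b (A \<times> B \<times> C) = 1" .
  have zero: "?a s = 0" if "?b s = 0" for s
  proof -
    obtain u v z where s: "s = (u,v,z)" by (cases s)
    have "prb (\<lambda>w. (f w, g w, h w)) (u, v, z) \<le> prb (\<lambda>w. (f w, h w)) (u, z)"
      "prb (\<lambda>w. (f w, g w, h w)) (u, v, z) \<le> prb (\<lambda>w. (g w, h w)) (v, z)"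
      "prb (\<lambda>w. (f w, g w, h w)) (u, v, z) \<le> prb h z"
      by (rule prb_mono; simp)+
    with that show ?thesis unfolding s
      using prb_nonneg[of "\<lambda>w. (f w, g w, h w)" "(u,v,z)"] by (auto simp: field_simps)
  qed
  have nn: "0 \<le> ?a s" "0 \<le> ?b s" for s
    by (auto simp: case_prod_beta intro!: divide_nonneg_nonneg mult_nonneg_nonneg prb_nonneg)
  show "0 \<le> cmi f g h" unfolding eq
    by (rule gibbs(1)) (use AB in \<open>simp_all only: nn zero suma sumb finite_cartesian_product order_refl\<close>)
  assume "cmi f g h \<le> 0"
  then have le: "(\<Sum>s\<in>A \<times> B \<times> C. ?a s * log 2 (?a s / ?b s)) \<le> 0" unfolding eq .
  have "?a (u,v,z) = ?b (u,v,z)"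
    by (rule gibbs(2)[OF _ _ _ _ _ le]) (use AB in \<open>simp_all only: nn zero suma sumb finite_cartesian_product order_refl\<close>)
  then show "prb (\<lambda>w. (f w, g w, h w)) (u, v, z) =
    prb (\<lambda>w. (f w, h w)) (u, z) * prb (\<lambda>w. (g w, h w)) (v, z) / prb h z" by simp
qed

lemma mi_eq_cmi: "mi f g = cmi f g (\<lambda>_. ())"
proof -
  have "ent (\<lambda>w. (f w, ())) = ent f" "ent (\<lambda>w. (g w, ())) = ent g"
    "ent (\<lambda>w. (f w, g w, ())) = ent (\<lambda>w. (f w, g w))"
    by (rule ent_cong; simp)+
  then show ?thesis by (simp add: mi_def cmi_def ent_const)
qed

lemma mi_nonneg: "0 \<le> mi f g"
  unfolding mi_eq_cmi by (rule cmi_nonneg)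

lemma mi_zero_imp:
  assumes "mi f g \<le> 0"
  shows "prb (\<lambda>w. (f w, g w)) (u, v) = prb f u * prb g v"
proof -
  have "prb (\<lambda>w. (f w, g w, ())) (u, v, ()) = prb (\<lambda>w. (f w, g w)) (u, v)"
    "prb (\<lambda>w. (f w, ())) (u, ()) = prb f u" "prb (\<lambda>w. (g w, ())) (v, ()) = prb g v"
    by (rule prb_cong; simp)+
  moreover have "prb (\<lambda>_. ()) () = 1" by (simp add: prb_def sum1)
  ultimately show ?thesis using cmi_zero_imp[of f g "\<lambda>_. ()" u v "()"] assms
    unfolding mi_eq_cmi by simp
qed

lemma mi_cong:
  assumes "\<And>w w'. w \<in> \<Omega> \<Longrightarrow> w' \<in> \<Omega> \<Longrightarrow> f w = f w' \<longleftrightarrow> f' w = f' w'"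
    "\<And>w w'. w \<in> \<Omega> \<Longrightarrow> w' \<in> \<Omega> \<Longrightarrow> g w = g w' \<longleftrightarrow> g' w = g' w'"
  shows "mi f g = mi f' g'"
proof -
  have "ent f = ent f'" by (rule ent_cong) (rule assms(1))
  moreover have "ent g = ent g'" by (rule ent_cong) (rule assms(2))
  moreover have "ent (\<lambda>w. (f w, g w)) = ent (\<lambda>w. (f' w, g' w))"
    unfolding ent_def
    by (intro arg_cong[where f = uminus] sum.cong refl arg_cong2[where f = "(*)"]
         arg_cong[where f = "log 2"] prb_cong) (simp add: assms)
  ultimately show ?thesis by (simp add: mi_def)
qed

lemma mi_chain: "mi f (\<lambda>w. (g w, h w)) = mi f h + cmi f g h"
  unfolding mi_def cmi_def by simp

text \<open>Data processing: \<open>g\<close> is determined by \<open>h\<close>, so adjoining it to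
  \<open>h\<close> leaves the level sets unchanged, and the chain rule splits off a nonnegative
  remainder.\<close>

lemma mi_mono:
  assumes "\<And>w w'. w \<in> \<Omega> \<Longrightarrow> w' \<in> \<Omega> \<Longrightarrow> h w = h w' \<Longrightarrow> g w = g w'"
  shows "mi f g \<le> mi f h"
proof -
  have "mi f h = mi f (\<lambda>w. (h w, g w))" by (rule mi_cong) (auto dest: assms)
  also have "\<dots> = mi f g + cmi f h g" by (rule mi_chain)
  finally show ?thesis using cmi_nonneg[of f h g] by simp
qed

lemma cmi_mono:
  assumes "\<And>w w'. w \<in> \<Omega> \<Longrightarrow> w' \<in> \<Omega> \<Longrightarrow> k w = k w' \<Longrightarrow> g w = g w'"
  shows "cmi f g h \<le> cmi f k h"
proof -
  have "mi f (\<lambda>w. (g w, h w)) \<le> mi f (\<lambda>w. (k w, h w))"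
    by (rule mi_mono) (auto dest: assms)
  then show ?thesis by (simp add: mi_chain)
qed

lemma mi_commute: "mi f g = mi g f"
proof -
  have "ent (\<lambda>w. (f w, g w)) = ent (\<lambda>w. (g w, f w))" by (rule ent_cong) auto
  then show ?thesis by (simp add: mi_def)
qed

lemma cmi_commute: "cmi f g h = cmi g f h"
proof -
  have "ent (\<lambda>w. (f w, g w, h w)) = ent (\<lambda>w. (g w, f w, h w))" by (rule ent_cong) auto
  then show ?thesis by (simp add: cmi_def)
qed

lemma mi_prod_zero:
  assumes "\<And>w. w \<in> \<Omega> \<Longrightarrow> prb (\<lambda>w. (f w, g w)) (f w, g w) = prb f (f w) * prb g (g w)"
  shows "mi f g = 0"
proof -
  have "(\<Sum>w\<in>\<Omega>. P w * log 2 (prb (\<lambda>w. (f w, g w)) (f w, g w))) =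
    (\<Sum>w\<in>\<Omega>. P w * log 2 (prb f (f w)) + P w * log 2 (prb g (g w)))"
  proof (intro sum.cong refl)
    fix w assume w: "w \<in> \<Omega>"
    show "P w * log 2 (prb (\<lambda>w. (f w, g w)) (f w, g w)) = P w * log 2 (prb f (f w)) + P w * log 2 (prb g (g w))"
    proof (cases "P w = 0")
      case False
      then have "0 < P w" using nonneg[OF w] by simp
      then have "0 < prb f (f w)" "0 < prb g (g w)"
        using prb_ge[OF w, of f] prb_ge[OF w, of g] by linarith+
      then show ?thesis using assms[OF w] by (simp add: log_mult algebra_simps)
    qed auto
  qed
  then show ?thesis unfolding mi_def ent_def by (simp add: sum.distrib)
qed

text \<open>The relative entropy to the uniform law on M values is log M minus the entropy.\<close>

lemma ent_le_log_card:
  assumes "f ` \<Omega> \<subseteq> {..<M::nat}"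
  shows "ent f \<le> log 2 (real M)"
proof -
  have M: "M > 0" using assms sum1 by (cases M) auto
  have s: "(\<Sum>v<M. prb f v) = 1" using assms by (intro sum_prb_1) auto
  have "0 \<le> (\<Sum>v<M. prb f v * log 2 (prb f v / (1 / real M)))"
    by (rule gibbs(1)) (use M s in \<open>auto simp: prb_nonneg\<close>)
  also have "\<dots> = (\<Sum>v<M. prb f v * log 2 (prb f v) + prb f v * log 2 (real M))"
  proof (intro sum.cong refl)
    fix v
    show "prb f v * log 2 (prb f v / (1 / real M)) = prb f v * log 2 (prb f v) + prb f v * log 2 (real M)"
      using M prb_nonneg[of f v] by (cases "prb f v = 0") (auto simp: log_mult algebra_simps)
  qed
  also have "\<dots> = - ent f + log 2 (real M)"
    using ent_sum[of "{..<M}" f] assms s by (simp add: sum.distrib sum_distrib_right[symmetric])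
  finally show ?thesis by simp
qed

text \<open>Bridge from the double sum used in the theorem to entropies, where the chain rule and
  data processing are available. \<open>A\<close> and \<open>B\<close> may exceed the ranges, the
  extra values having weight zero.\<close>

lemma mutual_info_eq_mi:
  assumes "finite A" "f ` \<Omega> \<subseteq> A" "finite B" "g ` \<Omega> \<subseteq> B"
    and Q: "\<And>u v. u \<in> A \<Longrightarrow> v \<in> B \<Longrightarrow> Q u v = prb (\<lambda>w. (f w, g w)) (u, v)"
  shows "mutual_info Q A B = mi f g"
proof -
  let ?J = "\<lambda>w. (f w, g w)"
  let ?F = "\<lambda>(u,v). log 2 (prb ?J (u,v) / (prb f u * prb g v))"
  have "mutual_info Q A B = (\<Sum>u\<in>A. \<Sum>v\<in>B. prb ?J (u,v) * ?F (u,v))"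
    unfolding mutual_info_def
  proof (intro sum.cong refl)
    fix u v assume uv: "u \<in> A" "v \<in> B"
    have m1: "(\<Sum>b'\<in>B. Q u b') = prb f u"
      unfolding prb_marginal[OF assms(3,4), of f u, symmetric] using uv
      by (intro sum.cong refl Q) auto
    have m2: "(\<Sum>a'\<in>A. Q a' v) = prb g v"
      unfolding prb_marginal'[OF assms(1,2), of g v, symmetric] using uv
      by (intro sum.cong refl Q) auto
    show "(if 0 < Q u v then Q u v * log 2 (Q u v / ((\<Sum>b'\<in>B. Q u b') * (\<Sum>a'\<in>A. Q a' v))) else 0)
       = prb ?J (u,v) * ?F (u,v)"
      unfolding m1 m2 Q[OF uv] using prb_nonneg[of ?J "(u,v)"] by auto
  qed
  also have "\<dots> = (\<Sum>s\<in>A \<times> B. prb ?J s * ?F s)"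
    by (simp add: sum.cartesian_product case_prod_beta)
  also have "\<dots> = (\<Sum>w\<in>\<Omega>. P w * ?F (f w, g w))"
    using assms by (intro sum_prb) auto
  also have "\<dots> = (\<Sum>w\<in>\<Omega>. P w * log 2 (prb ?J (f w, g w)) -  P w * log 2 (prb f (f w))
      - P w * log 2 (prb g (g w)))"
  proof (intro sum.cong refl)
    fix w assume w: "w \<in> \<Omega>"
    show "P w * ?F (f w, g w) = P w * log 2 (prb ?J (f w, g w)) -  P w * log 2 (prb f (f w))
      - P w * log 2 (prb g (g w))"
    proof (cases "P w = 0")
      case False
      then have "0 < P w" using nonneg[OF w] by simp
      then have "0 < prb f (f w)" "0 < prb g (g w)" "0 < prb ?J (f w, g w)"
        using prb_ge[OF w, of f] prb_ge[OF w, of g] prb_ge[OF w, of ?J] by linarith+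
      then show ?thesis by (simp add: log_mult log_divide algebra_simps)
    qed auto
  qed
  also have "\<dots> = mi f g"
    unfolding mi_def ent_def by (simp add: sum_subtractf)
  finally show ?thesis .
qed

lemma cmi_zero_if:
  assumes "\<And>w. w \<in> \<Omega> \<Longrightarrow> prb (\<lambda>w. (f w, g w, h w)) (f w, g w, h w) * prb h (h w) =
    prb (\<lambda>w. (f w, h w)) (f w, h w) * prb (\<lambda>w. (g w, h w)) (g w, h w)"
  shows "cmi f g h = 0"
proof -
  have "(\<Sum>w\<in>\<Omega>. P w * log 2 (prb (\<lambda>w. (f w, g w, h w)) (f w, g w, h w)) + P w * log 2 (prb h (h w))) =
    (\<Sum>w\<in>\<Omega>. P w * log 2 (prb (\<lambda>w. (f w, h w)) (f w, h w)) + P w * log 2 (prb (\<lambda>w. (g w, h w)) (g w, h w)))"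
  proof (intro sum.cong refl)
    fix w assume w: "w \<in> \<Omega>"
    show "P w * log 2 (prb (\<lambda>w. (f w, g w, h w)) (f w, g w, h w)) + P w * log 2 (prb h (h w)) =
      P w * log 2 (prb (\<lambda>w. (f w, h w)) (f w, h w)) + P w * log 2 (prb (\<lambda>w. (g w, h w)) (g w, h w))"
    proof (cases "P w = 0")
      case False
      then have "0 < P w" using nonneg[OF w] by simp
      then have pos: "0 < prb (\<lambda>w. (f w, g w, h w)) (f w, g w, h w)" "0 < prb h (h w)"
        "0 < prb (\<lambda>w. (f w, h w)) (f w, h w)" "0 < prb (\<lambda>w. (g w, h w)) (g w, h w)"
        using prb_ge[OF w, of "\<lambda>w. (f w, g w, h w)"] prb_ge[OF w, of h]
          prb_ge[OF w, of "\<lambda>w. (f w, h w)"] prb_ge[OF w, of "\<lambda>w. (g w, h w)"] by linarith+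
      then show ?thesis using arg_cong[OF assms[OF w], of "log 2"]
        by (simp only: log_mult_pos ring_distribs(1)[symmetric])
    qed simp
  qed
  then show ?thesis unfolding cmi_def ent_def by (simp add: sum.distrib)
qed

lemma mi_le_ent: "mi f g \<le> ent g"
proof -
  have "ent f \<le> ent (\<lambda>w. (f w, g w))" by (rule ent_mono) auto
  then show ?thesis by (simp add: mi_def)
qed

text \<open>Conditional entropy is subadditive: the next letter loses exactly its conditional mutual
  information with the earlier letters given \<open>g\<close>.\<close>

lemma ent_blocks_le:
  "ent (\<lambda>w. (map (\<lambda>t. h t w) [0..<n], g w)) - ent g \<le> (\<Sum>t<n. ent (\<lambda>w. (h t w, g w)) - ent g)"
proof (induction n)
  case 0
  have "ent (\<lambda>w. (map (\<lambda>t. h t w) [0..<0], g w)) = ent g" by (rule ent_cong) auto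
  then show ?case by simp
next
  case (Suc n)
  have "ent (\<lambda>w. (map (\<lambda>t. h t w) [0..<Suc n], g w)) =
    ent (\<lambda>w. (h n w, map (\<lambda>t. h t w) [0..<n], g w))" by (rule ent_cong) auto
  with Suc cmi_nonneg[of "h n" "\<lambda>w. map (\<lambda>t. h t w) [0..<n]" g] show ?case
    by (simp add: cmi_def)
qed

text \<open>For independent letters H(U) splits exactly, while H(U | g) is at most the sum of the
  letterwise conditional entropies; so the difference is superadditive.\<close>

lemma sum_mi_le_mi_block:
  assumes len: "\<And>w. w \<in> \<Omega> \<Longrightarrow> length (U w) = n" and ind: "ent U = (\<Sum>t<n. ent (\<lambda>w. U w ! t))"
  shows "(\<Sum>t<n. mi (\<lambda>w. U w ! t) g) \<le> mi U g"
proof -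
  have "ent (\<lambda>w. (map (\<lambda>t. U w ! t) [0..<n], g w)) = ent (\<lambda>w. (U w, g w))"
    by (rule ent_cong) (simp add: map_nth len[symmetric], metis len map_nth)
  then have "ent (\<lambda>w. (U w, g w)) - ent g \<le> (\<Sum>t<n. ent (\<lambda>w. (U w ! t, g w)) - ent g)"
    using ent_blocks_le[of "\<lambda>t w. U w ! t" n g] by simp
  then show ?thesis using ind by (simp add: mi_def sum.distrib sum_subtractf)
qed

end

section \<open>Push-forward of finite laws and removal of null points\<close>

lemma fin_prob_image:
  assumes "fin_prob \<Omega> P" "finite \<Omega>'" "Z ` \<Omega> \<subseteq> \<Omega>'"
  shows "fin_prob \<Omega>' (fin_prob.prb \<Omega> P Z)"
proof -
  interpret fin_prob \<Omega> P by fact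
  show ?thesis
    using assms(2,3) by unfold_locales (auto simp: prb_nonneg sum_prb_1)
qed

lemma prb_image:
  assumes "fin_prob \<Omega> P" "finite \<Omega>'" "Z ` \<Omega> \<subseteq> \<Omega>'"
  shows "fin_prob.prb \<Omega>' (fin_prob.prb \<Omega> P Z) f v = fin_prob.prb \<Omega> P (\<lambda>w. f (Z w)) v"
proof -
  interpret fin_prob \<Omega> P by fact
  interpret I: fin_prob \<Omega>' "prb Z" by (rule fin_prob_image[OF assms])
  have "I.prb f v = (\<Sum>z\<in>\<Omega>'. prb Z z * (if f z = v then 1 else 0))"
    unfolding I.prb_alt by (intro sum.cong) auto
  also have "\<dots> = (\<Sum>w\<in>\<Omega>. P w * (if f (Z w) = v then 1 else 0))"
    using assms by (intro sum_prb) auto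
  also have "\<dots> = prb (\<lambda>w. f (Z w)) v" unfolding prb_alt by (intro sum.cong) auto
  finally show ?thesis .
qed

lemma ent_image:
  assumes "fin_prob \<Omega> P" "finite \<Omega>'" "Z ` \<Omega> \<subseteq> \<Omega>'"
  shows "fin_prob.ent \<Omega>' (fin_prob.prb \<Omega> P Z) f = fin_prob.ent \<Omega> P (\<lambda>w. f (Z w))"
proof -
  interpret fin_prob \<Omega> P by fact
  interpret I: fin_prob \<Omega>' "prb Z" by (rule fin_prob_image[OF assms])
  have "I.ent f = - (\<Sum>z\<in>\<Omega>'. prb Z z * log 2 (prb (\<lambda>w. f (Z w)) (f z)))"
    unfolding I.ent_def by (simp add: prb_image[OF assms])
  also have "\<dots> = ent (\<lambda>w. f (Z w))" unfolding ent_def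
    using sum_prb[OF assms(2,3), of "\<lambda>z. log 2 (prb (\<lambda>w. f (Z w)) (f z))"] by simp
  finally show ?thesis .
qed

lemma mi_image:
  assumes "fin_prob \<Omega> P" "finite \<Omega>'" "Z ` \<Omega> \<subseteq> \<Omega>'"
  shows "fin_prob.mi \<Omega>' (fin_prob.prb \<Omega> P Z) f g = fin_prob.mi \<Omega> P (\<lambda>w. f (Z w)) (\<lambda>w. g (Z w))"
  by (simp add: fin_prob.mi_def fin_prob_image[OF assms] assms(1) ent_image[OF assms])

text \<open>Lets a variable be replaced by an index that is injective only on a part of the space
  carrying all the mass.\<close>

lemma fin_prob_restrict:
  assumes "fin_prob \<Omega> P" "\<Omega>' \<subseteq> \<Omega>" "\<forall>w\<in>\<Omega> - \<Omega>'. P w = 0"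
  shows "fin_prob \<Omega>' P"
proof -
  interpret fin_prob \<Omega> P by fact
  have "sum P \<Omega>' = sum P \<Omega>" using assms fin by (intro sum.mono_neutral_left) auto
  then show ?thesis
    using assms(2) fin nonneg sum1 by unfold_locales (auto intro: finite_subset)
qed

lemma sum_restrict:
  fixes P :: "'w \<Rightarrow> real"
  assumes "fin_prob \<Omega> P" "\<Omega>' \<subseteq> \<Omega>" "\<forall>w\<in>\<Omega> - \<Omega>'. P w = 0"
  shows "(\<Sum>w\<in>\<Omega>'. P w * F w) = (\<Sum>w\<in>\<Omega>. P w * F w)"
  using assms fin_prob.fin[OF assms(1)] by (intro sum.mono_neutral_left) auto

lemma prb_restrict:
  assumes "fin_prob \<Omega> P" "\<Omega>' \<subseteq> \<Omega>" "\<forall>w\<in>\<Omega> - \<Omega>'. P w = 0"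
  shows "fin_prob.prb \<Omega>' P f v = fin_prob.prb \<Omega> P f v"
  unfolding fin_prob.prb_def[OF assms(1)] fin_prob.prb_def[OF fin_prob_restrict[OF assms]]
  using assms fin_prob.fin[OF assms(1)] by (intro sum.mono_neutral_left) auto

lemma mi_restrict:
  assumes "fin_prob \<Omega> P" "\<Omega>' \<subseteq> \<Omega>" "\<forall>w\<in>\<Omega> - \<Omega>'. P w = 0"
  shows "fin_prob.mi \<Omega>' P f g = fin_prob.mi \<Omega> P f g"
  unfolding fin_prob.mi_def[OF assms(1)] fin_prob.mi_def[OF fin_prob_restrict[OF assms]]
    fin_prob.ent_def[OF assms(1)] fin_prob.ent_def[OF fin_prob_restrict[OF assms]]
    prb_restrict[OF assms] sum_restrict[OF assms] ..

section \<open>Covering by codebooks\<close>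

definition nlists :: "nat \<Rightarrow> 'a set \<Rightarrow> 'a list set" where
  "nlists n A = {xs. set xs \<subseteq> A \<and> length xs = n}"

lemma finite_nlists: "finite A \<Longrightarrow> finite (nlists n A)"
  unfolding nlists_def by (rule finite_lists_length_eq)

lemma nlists_0: "nlists 0 A = {[]}"
  by (auto simp: nlists_def)

lemma nlists_UNIV: "nlists n UNIV = {xs. length xs = n}"
  by (simp add: nlists_def)

lemma sum_nlists_Suc:
  "(\<Sum>zs\<in>nlists (Suc n) A. F zs) = (\<Sum>z\<in>A. \<Sum>zs\<in>nlists n A. F (z # zs))"
proof -
  have "nlists (Suc n) A = (\<lambda>(z, zs). z # zs) ` (A \<times> nlists n A)"
    by (force simp: nlists_def length_Suc_conv image_iff)
  moreover have "inj_on (\<lambda>(z, zs). z # zs) (A \<times> nlists n A)" by (auto simp: inj_on_def)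
  ultimately have "(\<Sum>zs\<in>nlists (Suc n) A. F zs) = (\<Sum>s\<in>A \<times> nlists n A. F (fst s # snd s))"
    by (simp only: sum.reindex) (simp add: case_prod_beta)
  then show ?thesis by (simp add: sum.cartesian_product')
qed

lemma sum_nlists_times:
  "(\<Sum>zs\<in>nlists n (A \<times> B). F zs) = (\<Sum>xs\<in>nlists n A. \<Sum>ys\<in>nlists n B. F (zip xs ys))"
proof (induction n arbitrary: F)
  case (Suc n)
  have "(\<Sum>zs\<in>nlists (Suc n) (A \<times> B). F zs) =
    (\<Sum>a\<in>A. \<Sum>b\<in>B. \<Sum>xs\<in>nlists n A. \<Sum>ys\<in>nlists n B. F ((a, b) # zip xs ys))"
    unfolding sum_nlists_Suc by (simp add: sum.cartesian_product' Suc.IH)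
  also have "\<dots> = (\<Sum>a\<in>A. \<Sum>xs\<in>nlists n A. \<Sum>b\<in>B. \<Sum>ys\<in>nlists n B. F (zip (a # xs) (b # ys)))"
    by (subst sum.swap) simp
  finally show ?case by (simp add: sum_nlists_Suc)
qed (simp add: nlists_0)

abbreviation wprod :: "('a \<Rightarrow> real) \<Rightarrow> 'a list \<Rightarrow> real" where
  "wprod W zs \<equiv> prod_list (map W zs)"

lemma wprod_nonneg: "(\<And>z. z \<in> set zs \<Longrightarrow> 0 \<le> W z) \<Longrightarrow> 0 \<le> wprod W zs"
  by (induction zs) auto

lemma sum_wprod: "(\<Sum>zs\<in>nlists n A. wprod W zs) = (\<Sum>z\<in>A. W z) ^ n"
  by (induction n) (simp_all add: nlists_0 sum_nlists_Suc sum_distrib_left[symmetric] sum_distrib_right[symmetric])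

lemma sum_wprod_zip:
  "length xs = n \<Longrightarrow>
    (\<Sum>ys\<in>nlists n B. wprod W (zip xs ys)) = wprod (\<lambda>x. \<Sum>b\<in>B. W (x, b)) xs"
proof (induction xs arbitrary: n)
  case (Cons x xs)
  then obtain m where "n = Suc m" "length xs = m" by auto
  with Cons.IH show ?case
    by (simp add: sum_nlists_Suc sum_distrib_left[symmetric] sum_distrib_right[symmetric])
qed (simp add: nlists_0)

lemma sum_wprod_sum_list:
  assumes "(\<Sum>z\<in>A. W z) = 1"
  shows "(\<Sum>zs\<in>nlists n A. wprod W zs * sum_list (map f zs)) = real n * (\<Sum>z\<in>A. W z * f z)"
proof (induction n)
  case (Suc n)
  have "(\<Sum>zs\<in>nlists (Suc n) A. wprod W zs * sum_list (map f zs)) =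
    (\<Sum>z\<in>A. \<Sum>zs\<in>nlists n A. (W z * f z) * wprod W zs + W z * (wprod W zs * sum_list (map f zs)))"
    by (simp add: sum_nlists_Suc algebra_simps)
  also have "\<dots> = (\<Sum>z\<in>A. W z * f z) * (\<Sum>zs\<in>nlists n A. wprod W zs) +
     (\<Sum>z\<in>A. W z) * (\<Sum>zs\<in>nlists n A. wprod W zs * sum_list (map f zs))"
    by (simp add: sum.distrib sum_distrib_left[symmetric] sum_distrib_right[symmetric])
  also have "\<dots> = real (Suc n) * (\<Sum>z\<in>A. W z * f z)"
    using Suc assms by (simp add: sum_wprod algebra_simps)
  finally show ?case .
qed (simp add: nlists_0)

lemma sum_wprod_nth:
  assumes "(\<Sum>z\<in>A. W z) = 1" "t < n"
  shows "(\<Sum>zs\<in>nlists n A. wprod W zs * F (zs ! t)) = (\<Sum>z\<in>A. W z * F z)"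
  using assms(2)
proof (induction n arbitrary: t)
  case (Suc n)
  show ?case
  proof (cases t)
    case 0
    have "(\<Sum>zs\<in>nlists (Suc n) A. wprod W zs * F (zs ! t)) = (\<Sum>z\<in>A. \<Sum>zs\<in>nlists n A. (W z * F z) * wprod W zs)"
      by (simp add: sum_nlists_Suc 0 ac_simps)
    then show ?thesis by (simp add: sum_distrib_left[symmetric] sum_wprod assms(1))
  next
    case (Suc s)
    have "(\<Sum>zs\<in>nlists (Suc n) A. wprod W zs * F (zs ! t)) =
      (\<Sum>z\<in>A. \<Sum>zs\<in>nlists n A. W z * (wprod W zs * F (zs ! s)))"
      by (simp add: sum_nlists_Suc Suc ac_simps)
    then show ?thesis using Suc.IH[of s] Suc.prems Suc
      by (simp add: sum_distrib_left[symmetric] sum_distrib_right[symmetric] assms(1))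
  qed
qed simp

text \<open>The mixed term contains the mean of \<open>f\<close> as a factor and vanishes, so
  variances add along the word.\<close>

lemma sum_wprod_sum_list_square:
  assumes "(\<Sum>z\<in>A. W z) = 1" "(\<Sum>z\<in>A. W z * f z) = 0"
  shows "(\<Sum>zs\<in>nlists n A. wprod W zs * (sum_list (map f zs))\<^sup>2) = real n * (\<Sum>z\<in>A. W z * (f z)\<^sup>2)"
proof (induction n)
  case (Suc n)
  have "(\<Sum>zs\<in>nlists (Suc n) A. wprod W zs * (sum_list (map f zs))\<^sup>2) =
    (\<Sum>z\<in>A. \<Sum>zs\<in>nlists n A. (W z * (f z)\<^sup>2) * wprod W zs +
      (2 * (W z * f z)) * (wprod W zs * sum_list (map f zs)) +
      W z * (wprod W zs * (sum_list (map f zs))\<^sup>2))"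
    by (simp add: sum_nlists_Suc algebra_simps power2_eq_square)
  also have "\<dots> = (\<Sum>z\<in>A. W z * (f z)\<^sup>2) * (\<Sum>zs\<in>nlists n A. wprod W zs) +
     (\<Sum>z\<in>A. 2 * (W z * f z)) * (\<Sum>zs\<in>nlists n A. wprod W zs * sum_list (map f zs)) +
     (\<Sum>z\<in>A. W z) * (\<Sum>zs\<in>nlists n A. wprod W zs * (sum_list (map f zs))\<^sup>2)"
    by (simp only: sum.distrib sum_distrib_left[symmetric] sum_distrib_right[symmetric])
  also have "\<dots> = real (Suc n) * (\<Sum>z\<in>A. W z * (f z)\<^sup>2)"
    using Suc assms by (simp add: sum_wprod sum_wprod_sum_list[OF assms(1)] distrib_right)
  finally show ?case .
qed (simp add: nlists_0)

text \<open>Chebyshev's inequality, kept one-sided: only an excess of information density or of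
  distortion harms a code.\<close>

lemma weak_law:
  fixes W :: "'a \<Rightarrow> real"
  assumes A: "finite A" and W: "\<And>z. z \<in> A \<Longrightarrow> 0 \<le> W z" and W1: "(\<Sum>z\<in>A. W z) = 1"
    and pos: "0 < \<epsilon>" "0 < \<delta>"
  shows "\<forall>\<^sub>F n in sequentially.
    (\<Sum>zs\<in>nlists n A. if sum_list (map f zs) \<le> real n * ((\<Sum>z\<in>A. W z * f z) + \<epsilon>) then 0
       else wprod W zs) \<le> \<delta>"
proof -
  define \<mu> where "\<mu> = (\<Sum>z\<in>A. W z * f z)"
  define m where "m z = f z - \<mu>" for z
  define \<sigma> where "\<sigma> = (\<Sum>z\<in>A. W z * (m z)\<^sup>2)"
  have m0: "(\<Sum>z\<in>A. W z * m z) = 0"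
    using W1 by (simp add: m_def right_diff_distrib sum_subtractf sum_distrib_right[symmetric] \<mu>_def)
  have sm: "sum_list (map m zs) = sum_list (map f zs) - real (length zs) * \<mu>" for zs
    by (induction zs) (auto simp: m_def algebra_simps)
  have "\<sigma> \<ge> 0" unfolding \<sigma>_def using W by (intro sum_nonneg) auto
  \<comment> \<open>The variance bound on the failure probability is \<sigma> / (n \<epsilon>^2),
    which is at most \<delta> from this n on.\<close>
  have key: "(\<Sum>zs\<in>nlists n A. if sum_list (map f zs) \<le> real n * (\<mu> + \<epsilon>) then 0
       else wprod W zs) \<le> \<delta>" if n: "real n \<ge> \<sigma> / (\<epsilon>\<^sup>2 * \<delta>)" "n > 0" for n
  proof -
    have "(\<Sum>zs\<in>nlists n A. if sum_list (map f zs) \<le> real n * (\<mu> + \<epsilon>) then 0 else wprod W zs)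
      \<le> (\<Sum>zs\<in>nlists n A. wprod W zs * (sum_list (map m zs))\<^sup>2 / (real n * \<epsilon>)\<^sup>2)"
    proof (intro sum_mono)
      fix zs assume zs: "zs \<in> nlists n A"
      then have w0: "0 \<le> wprod W zs" by (intro wprod_nonneg W) (auto simp: nlists_def)
      show "(if sum_list (map f zs) \<le> real n * (\<mu> + \<epsilon>) then 0 else wprod W zs)
        \<le> wprod W zs * (sum_list (map m zs))\<^sup>2 / (real n * \<epsilon>)\<^sup>2"
      proof (cases "sum_list (map f zs) \<le> real n * (\<mu> + \<epsilon>)")
        case False
        then have "sum_list (map m zs) \<ge> real n * \<epsilon>"
          using zs by (simp add: sm nlists_def algebra_simps)
        then have "(real n * \<epsilon>)\<^sup>2 \<le> (sum_list (map m zs))\<^sup>2" using pos by (intro power_mono) auto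
        then have "wprod W zs * (real n * \<epsilon>)\<^sup>2 \<le> wprod W zs * (sum_list (map m zs))\<^sup>2"
          using w0 by (intro mult_left_mono) auto
        then show ?thesis using False n pos by (simp add: pos_le_divide_eq)
      qed (use w0 in simp)
    qed
    also have "\<dots> = real n * \<sigma> / (real n * \<epsilon>)\<^sup>2"
      unfolding sum_divide_distrib[symmetric] sum_wprod_sum_list_square[OF W1 m0] \<sigma>_def ..
    also have "\<dots> = \<sigma> / (\<epsilon>\<^sup>2 * \<delta>) * \<delta> / real n"
      using n pos by (simp add: power2_eq_square field_simps)
    also have "\<dots> \<le> real n * \<delta> / real n"
      using n pos by (intro divide_right_mono mult_right_mono) auto
    also have "\<dots> = \<delta>" using n by simp
    finally show ?thesis .
  qed
  have "\<forall>\<^sub>F n in sequentially. real n \<ge> \<sigma> / (\<epsilon>\<^sup>2 * \<delta>)"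
    using filterlim_real_sequentially unfolding filterlim_at_top by blast
  with eventually_gt_at_top[of 0] show ?thesis
    by eventually_elim (use key \<mu>_def in auto)
qed

text \<open>The derandomized covering argument: a codebook is built one codeword at a time, each new
  codeword doing at least as well as a random one.\<close>

lemma greedy_cover:
  fixes w :: "'u \<Rightarrow> real" and PV :: "'v \<Rightarrow> real"
  assumes "finite U" "finite V" "\<And>u. u \<in> U \<Longrightarrow> 0 \<le> w u" "\<And>v. v \<in> V \<Longrightarrow> 0 \<le> PV v"
    "(\<Sum>v\<in>V. PV v) = 1"
  shows "\<exists>vs. length vs = M \<and> set vs \<subseteq> V \<and>
    (\<Sum>u\<in>U. if \<exists>v\<in>set vs. G u v then 0 else w u)
      \<le> (\<Sum>u\<in>U. w u * (\<Sum>v\<in>V. if G u v then 0 else PV v) ^ M)"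
  using assms(3)
proof (induction M arbitrary: w)
  case 0
  show ?case by (rule exI[of _ "[]"]) simp
next
  case (Suc M)
  define s where "s u = (\<Sum>v\<in>V. if G u v then 0 else PV v)" for u
  \<comment> \<open>What the induction hypothesis guarantees for the remaining \<open>M\<close>
    codewords once v has been chosen. Its \<open>PV\<close>-average equals the bound claimed for
    \<open>Suc M\<close>, so some v does at least as well.\<close>
  define h where "h v = (\<Sum>u\<in>U. (if G u v then 0 else w u) * s u ^ M)" for v
  define R where "R = (\<Sum>u\<in>U. w u * s u ^ Suc M)"
  have "(\<Sum>v\<in>V. PV v * h v) = (\<Sum>v\<in>V. \<Sum>u\<in>U. w u * s u ^ M * (if G u v then 0 else PV v))"
    unfolding h_def sum_distrib_left by (intro sum.cong) auto
  also have "\<dots> = (\<Sum>u\<in>U. \<Sum>v\<in>V. w u * s u ^ M * (if G u v then 0 else PV v))"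
    by (rule sum.swap)
  also have "\<dots> = R"
    unfolding R_def by (simp only: sum_distrib_left[symmetric] s_def[symmetric]) (simp add: ac_simps)
  finally have avg: "(\<Sum>v\<in>V. PV v * h v) = R" .
  have "\<exists>v\<in>V. h v \<le> R"
  proof (rule ccontr)
    assume "\<not> ?thesis"
    then have lt: "\<And>v. v \<in> V \<Longrightarrow> R < h v" by auto
    \<comment> \<open>A point of positive weight makes the comparison of the two averages
      strict.\<close>
    obtain v0 where v0: "v0 \<in> V" "0 < PV v0"
      using assms(4,5) by (metis sum.neutral zero_neq_one less_eq_real_def)
    have "(\<Sum>v\<in>V. PV v * R) < (\<Sum>v\<in>V. PV v * h v)"
    proof (rule sum_strict_mono_ex1)
      show "\<forall>v\<in>V. PV v * R \<le> PV v * h v"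
        using lt assms(4) by (auto intro!: mult_left_mono simp: less_imp_le)
      show "\<exists>v\<in>V. PV v * R < PV v * h v" using v0 lt by (intro bexI[of _ v0] mult_strict_left_mono) auto
    qed fact
    then show False using avg assms(5) by (simp add: sum_distrib_right[symmetric])
  qed
  then obtain v where v: "v \<in> V" "h v \<le> R" by blast
  have nn: "0 \<le> (if G u v then 0 else w u)" if "u \<in> U" for u
    using Suc.prems[OF that] by simp
  have "\<exists>vs. length vs = M \<and> set vs \<subseteq> V \<and>
    (\<Sum>u\<in>U. if \<exists>v\<in>set vs. G u v then 0 else (if G u v then 0 else w u)) \<le> h v"
    unfolding h_def s_def by (rule Suc.IH) (rule nn)
  then obtain vs where vs: "length vs = M" "set vs \<subseteq> V"
    "(\<Sum>u\<in>U. if \<exists>v\<in>set vs. G u v then 0 else (if G u v then 0 else w u)) \<le> h v"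
    by blast
  have "(\<Sum>u\<in>U. if \<exists>v'\<in>set (v # vs). G u v' then 0 else w u) =
    (\<Sum>u\<in>U. if \<exists>v\<in>set vs. G u v then 0 else (if G u v then 0 else w u))"
    by (intro sum.cong) auto
  then show ?case using v vs unfolding R_def s_def
    by (intro exI[of _ "v # vs"]) auto
qed

text \<open>(1 - s/L)^M \<le> exp (-sM/L), and by convexity in s this lies below the chord between
  the values 1 at s = 0 and exp (-M/L) at s = 1. In the application s is the conditional probability
  of a good pair, L bounds the likelihood ratio and M counts codewords.\<close>

lemma power_le_linear_exp:
  fixes a s K :: real
  assumes "0 \<le> a" "a \<le> 1 - s / L" "0 < L" "0 \<le> s" "s \<le> 1"
  shows "a ^ M \<le> 1 - s + exp (- real M / L)"
proof -
  have "a \<le> exp (- (s / L))" using assms exp_ge_add_one_self[of "- (s / L)"] by linarith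
  then have "a ^ M \<le> exp (- (s / L)) ^ M" using assms by (intro power_mono) auto
  also have "\<dots> = exp ((1 - s) *\<^sub>R 0 + s *\<^sub>R (- real M / L))"
    by (simp add: exp_of_nat_mult[symmetric])
  also have "\<dots> \<le> (1 - s) * exp 0 + s * exp (- real M / L)"
    by (rule convex_onD[OF exp_convex]) (use assms in auto)
  also have "\<dots> \<le> 1 - s + 1 * exp (- real M / L)"
    using assms by (intro add_mono mult_right_mono) auto
  finally show ?thesis by simp
qed

text \<open>If a partner drawn from J given u is good with probability s, then one drawn from
  \<open>PV\<close> is good with probability at least s/L, because J \<le> L w \<open>PV\<close> on
  good pairs. The failure probability of M independent draws is then estimated by
  \<open>power_le_linear_exp\<close>. The total weight is only required to be at most 1, since a
  second stage starts from the part of the source that the first stage has covered.\<close>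

lemma covering:
  fixes w :: "'u \<Rightarrow> real" and PV :: "'v \<Rightarrow> real" and J :: "'u \<Rightarrow> 'v \<Rightarrow> real"
  assumes fin: "finite U" "finite V" and PV: "\<And>v. v \<in> V \<Longrightarrow> 0 \<le> PV v" "(\<Sum>v\<in>V. PV v) = 1"
    and J: "\<And>u v. u \<in> U \<Longrightarrow> v \<in> V \<Longrightarrow> 0 \<le> J u v" "\<And>u. u \<in> U \<Longrightarrow> (\<Sum>v\<in>V. J u v) = w u"
    and w: "(\<Sum>u\<in>U. w u) \<le> 1" and L: "0 < L"
    and G: "\<And>u v. u \<in> U \<Longrightarrow> v \<in> V \<Longrightarrow> G u v \<Longrightarrow> J u v \<le> L * w u * PV v"
  shows "\<exists>vs. length vs = M \<and> set vs \<subseteq> V \<and>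
    (\<Sum>u\<in>U. if \<exists>v\<in>set vs. G u v then 0 else w u)
      \<le> (\<Sum>u\<in>U. \<Sum>v\<in>V. if G u v then 0 else J u v) + exp (- real M / L)"
proof -
  have w0: "0 \<le> w u" if "u \<in> U" for u
    unfolding J(2)[OF that, symmetric] using J(1) that by (intro sum_nonneg) auto
  define a where "a u = (\<Sum>v\<in>V. if G u v then 0 else PV v)" for u
  define b where "b u = (\<Sum>v\<in>V. if G u v then 0 else J u v)" for u
  have split: "(\<Sum>v\<in>V. f v) = (\<Sum>v\<in>V. if G u v then f v else 0) + (\<Sum>v\<in>V. if G u v then 0 else f v)"
    for f :: "'v \<Rightarrow> real" and u
    unfolding sum.distrib[symmetric] by (intro sum.cong) auto
  have step: "w u * a u ^ M \<le> b u + w u * exp (- real M / L)" if u: "u \<in> U" for u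
  proof (cases "w u = 0")
    case True
    then show ?thesis using J(1) u by (auto simp: b_def intro!: sum_nonneg)
  next
    case False
    then have wp: "0 < w u" using w0[OF u] by simp
    define s where "s = (\<Sum>v\<in>V. if G u v then J u v else 0) / w u"
    have "w u * s = (\<Sum>v\<in>V. if G u v then J u v else 0)" using wp by (simp add: s_def)
    then have bs: "b u = w u * (1 - s)"
      using split[of "J u" u] J(2)[OF u] by (simp add: b_def right_diff_distrib)
    have "0 \<le> s" unfolding s_def using wp J(1) u by (intro divide_nonneg_nonneg sum_nonneg) auto
    have "0 \<le> b u" using J(1) u by (auto simp: b_def intro!: sum_nonneg)
    then have "s \<le> 1" using bs wp by (simp add: zero_le_mult_iff)
    have "(\<Sum>v\<in>V. if G u v then J u v else 0) \<le> (\<Sum>v\<in>V. L * w u * (if G u v then PV v else 0))"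
      using G u by (intro sum_mono) auto
    also have "\<dots> = L * w u * (1 - a u)"
      using split[of PV u] PV(2) by (simp add: sum_distrib_left[symmetric] a_def)
    finally have "s \<le> L * (1 - a u)" unfolding s_def using wp by (simp add: divide_le_eq ac_simps)
    then have "a u \<le> 1 - s / L" using L by (simp add: field_simps)
    moreover have "0 \<le> a u" using PV by (auto simp: a_def intro!: sum_nonneg)
    ultimately have "a u ^ M \<le> 1 - s + exp (- real M / L)"
      using \<open>0 \<le> s\<close> \<open>s \<le> 1\<close> L by (intro power_le_linear_exp) auto
    then have "w u * a u ^ M \<le> w u * (1 - s + exp (- real M / L))"
      using wp by (intro mult_left_mono) auto
    then show ?thesis using bs by (simp add: algebra_simps)
  qed
  have "\<exists>vs. length vs = M \<and> set vs \<subseteq> V \<and>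
    (\<Sum>u\<in>U. if \<exists>v\<in>set vs. G u v then 0 else w u) \<le> (\<Sum>u\<in>U. w u * a u ^ M)"
    unfolding a_def using fin by (rule greedy_cover) (use w0 PV in auto)
  then obtain vs where vs: "length vs = M" "set vs \<subseteq> V"
    "(\<Sum>u\<in>U. if \<exists>v\<in>set vs. G u v then 0 else w u) \<le> (\<Sum>u\<in>U. w u * a u ^ M)"
    by blast
  have "(\<Sum>u\<in>U. w u * a u ^ M) \<le> (\<Sum>u\<in>U. b u + w u * exp (- real M / L))"
    by (intro sum_mono step)
  also have "\<dots> \<le> (\<Sum>u\<in>U. b u) + 1 * exp (- real M / L)"
    unfolding sum.distrib sum_distrib_right[symmetric]
    using w by (intro add_left_mono mult_right_mono) auto
  finally show ?thesis using vs unfolding b_def by (intro exI[of _ vs]) auto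
qed

text \<open>The first codeword must not only be jointly typical with u, it must also leave the
  second stage a conditional failure probability of at most \<delta>. By Markov's inequality this
  extra demand costs a \<delta>-th of the total second-stage failure, which explains \<delta>^2 in
  the hypothesis. The three \<delta> in the bound are first-stage atypicality, this Markov loss and
  second-stage atypicality.\<close>

lemma two_stage_covering:
  fixes J :: "'u \<Rightarrow> 'v \<Rightarrow> 't \<Rightarrow> real" and M1 M2 :: nat
  assumes fin: "finite U" "finite V" "finite T"
    and PV: "\<And>v. v \<in> V \<Longrightarrow> 0 \<le> PV v" "(\<Sum>v\<in>V. PV v) = 1"
    and PT: "\<And>t. t \<in> T \<Longrightarrow> 0 \<le> PT t" "(\<Sum>t\<in>T. PT t) = 1"
    and J: "\<And>u v t. u \<in> U \<Longrightarrow> v \<in> V \<Longrightarrow> t \<in> T \<Longrightarrow> 0 \<le> J u v t"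
    and J1: "\<And>u v. u \<in> U \<Longrightarrow> v \<in> V \<Longrightarrow> (\<Sum>t\<in>T. J u v t) = J1 u v"
    and w: "\<And>u. u \<in> U \<Longrightarrow> (\<Sum>v\<in>V. J1 u v) = w u" "(\<Sum>u\<in>U. w u) = 1"
    and L: "0 < L1" "0 < L2"
    and H1: "\<And>u v. u \<in> U \<Longrightarrow> v \<in> V \<Longrightarrow> H1 u v \<Longrightarrow> J1 u v \<le> L1 * w u * PV v"
    and H2: "\<And>u v t. u \<in> U \<Longrightarrow> v \<in> V \<Longrightarrow> t \<in> T \<Longrightarrow> H2 u v t \<Longrightarrow> J u v t \<le> L2 * J1 u v * PT t"
    and \<delta>: "0 < \<delta>"
    and bad1: "(\<Sum>u\<in>U. \<Sum>v\<in>V. if H1 u v then 0 else J1 u v) \<le> \<delta>"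
    and bad2: "(\<Sum>u\<in>U. \<Sum>v\<in>V. \<Sum>t\<in>T. if H2 u v t then 0 else J u v t) \<le> \<delta>\<^sup>2"
    and M: "0 < M1" "0 < M2"
  shows "\<exists>vs ts f1 f2. length vs = M1 \<and> length ts = M2 \<and> set vs \<subseteq> V \<and> set ts \<subseteq> T \<and>
    (\<forall>u. f1 u < M1 \<and> f2 u < M2) \<and>
    (\<Sum>u\<in>U. if H1 u (vs ! f1 u) \<and> H2 u (vs ! f1 u) (ts ! f2 u) then 0 else w u)
      \<le> 3 * \<delta> + exp (- real M1 / L1) + exp (- real M2 / L2)"
proof -
  have J10: "0 \<le> J1 u v" if "u \<in> U" "v \<in> V" for u v
    unfolding J1[OF that, symmetric] using J that by (intro sum_nonneg) auto
  have w0: "0 \<le> w u" if "u \<in> U" for u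
    unfolding w(1)[OF that, symmetric] using J10 that by (intro sum_nonneg) auto
  define b where "b u v = (\<Sum>t\<in>T. if H2 u v t then 0 else J u v t)" for u v
  have b0: "0 \<le> b u v" if "u \<in> U" "v \<in> V" for u v
    unfolding b_def using J that by (intro sum_nonneg) auto
  \<comment> \<open>Positivity of \<open>J1\<close> allows conditioning on the chosen pair (u, v) in
    the second stage.\<close>
  define G1 where "G1 u v \<longleftrightarrow> H1 u v \<and> b u v \<le> \<delta> * J1 u v \<and> 0 < J1 u v" for u v
  have "\<exists>vs. length vs = M1 \<and> set vs \<subseteq> V \<and>
    (\<Sum>u\<in>U. if \<exists>v\<in>set vs. G1 u v then 0 else w u)
      \<le> (\<Sum>u\<in>U. \<Sum>v\<in>V. if G1 u v then 0 else J1 u v) + exp (- real M1 / L1)"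
    by (rule covering[where PV = PV]) (use fin PV J10 w L H1 in \<open>auto simp: G1_def\<close>)
  then obtain vs where vs: "length vs = M1" "set vs \<subseteq> V"
    "(\<Sum>u\<in>U. if \<exists>v\<in>set vs. G1 u v then 0 else w u)
      \<le> (\<Sum>u\<in>U. \<Sum>v\<in>V. if G1 u v then 0 else J1 u v) + exp (- real M1 / L1)"
    by blast
  have "(\<Sum>u\<in>U. \<Sum>v\<in>V. if G1 u v then 0 else J1 u v) \<le>
     (\<Sum>u\<in>U. \<Sum>v\<in>V. (if H1 u v then 0 else J1 u v) + b u v / \<delta>)"
  proof (intro sum_mono)
    fix u v assume uv: "u \<in> U" "v \<in> V"
    show "(if G1 u v then 0 else J1 u v) \<le> (if H1 u v then 0 else J1 u v) + b u v / \<delta>"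
      using b0[OF uv] J10[OF uv] \<delta> by (auto simp: G1_def field_simps)
  qed
  also have "\<dots> = (\<Sum>u\<in>U. \<Sum>v\<in>V. if H1 u v then 0 else J1 u v) + (\<Sum>u\<in>U. \<Sum>v\<in>V. b u v) / \<delta>"
    by (simp add: sum.distrib sum_divide_distrib)
  also have "\<dots> \<le> \<delta> + \<delta>\<^sup>2 / \<delta>"
    using bad1 bad2 \<delta> unfolding b_def by (intro add_mono divide_right_mono) auto
  finally have fail1: "(\<Sum>u\<in>U. if \<exists>v\<in>set vs. G1 u v then 0 else w u)
      \<le> 2 * \<delta> + exp (- real M1 / L1)"
    using vs(3) \<delta> by (simp add: power2_eq_square)
  define U' where "U' = {u\<in>U. \<exists>v\<in>set vs. G1 u v}"
  \<comment> \<open>Index 0 is the fallback when no codeword fits; it is a legal index because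
    \<open>M1\<close> is positive.\<close>
  define f1 where "f1 u = (if \<exists>i<M1. G1 u (vs ! i) then SOME i. i < M1 \<and> G1 u (vs ! i) else 0)" for u
  have f1: "f1 u < M1" for u
    unfolding f1_def using M by (auto intro: someI2_ex)
  have f1G: "G1 u (vs ! f1 u)" if "u \<in> U'" for u
  proof -
    have "\<exists>i<M1. G1 u (vs ! i)" using that vs(1) by (auto simp: U'_def in_set_conv_nth)
    then show ?thesis unfolding f1_def by (auto intro: someI2_ex)
  qed
  have vV: "vs ! f1 u \<in> V" for u using vs f1[of u] by auto
  \<comment> \<open>The conditional law of t given (u, v) at the chosen v, weighted by w u: v is now
    a function of u, so the pair carries the whole weight of u instead of \<open>J1\<close>.\<close>
  define J' where "J' u t = w u * J u (vs ! f1 u) t / J1 u (vs ! f1 u)" for u t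
  have U': "finite U'" "U' \<subseteq> U" using fin by (auto simp: U'_def)
  have "\<exists>ts. length ts = M2 \<and> set ts \<subseteq> T \<and>
    (\<Sum>u\<in>U'. if \<exists>t\<in>set ts. H2 u (vs ! f1 u) t then 0 else w u)
      \<le> (\<Sum>u\<in>U'. \<Sum>t\<in>T. if H2 u (vs ! f1 u) t then 0 else J' u t) + exp (- real M2 / L2)"
  proof (rule covering[where PV = PT])
    show "0 \<le> J' u t" if "u \<in> U'" "t \<in> T" for u t
      using that U' vV w0 J J10 by (auto simp: J'_def intro!: divide_nonneg_nonneg mult_nonneg_nonneg)
    show "(\<Sum>t\<in>T. J' u t) = w u" if "u \<in> U'" for u
    proof -
      have "(\<Sum>t\<in>T. J' u t) = w u * (\<Sum>t\<in>T. J u (vs ! f1 u) t) / J1 u (vs ! f1 u)"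
        by (simp add: J'_def sum_distrib_left sum_divide_distrib)
      also have "\<dots> = w u" using J1[of u "vs ! f1 u"] that U' vV f1G[OF that] by (auto simp: G1_def)
      finally show ?thesis .
    qed
    show "sum w U' \<le> 1" unfolding w(2)[symmetric] using U' fin w0 by (intro sum_mono2) auto
    show "J' u t \<le> L2 * w u * PT t" if "u \<in> U'" "t \<in> T" "H2 u (vs ! f1 u) t" for u t
    proof -
      have pos: "0 < J1 u (vs ! f1 u)" using f1G[OF that(1)] by (simp add: G1_def)
      have "J u (vs ! f1 u) t \<le> L2 * J1 u (vs ! f1 u) * PT t" using that U' vV by (intro H2) auto
      then have "w u * J u (vs ! f1 u) t \<le> w u * (L2 * J1 u (vs ! f1 u) * PT t)"
        using w0 that U' by (intro mult_left_mono) auto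
      then show ?thesis using pos by (simp add: J'_def divide_le_eq ac_simps)
    qed
  qed (use U' fin PT L in auto)
  then obtain ts where ts: "length ts = M2" "set ts \<subseteq> T"
    "(\<Sum>u\<in>U'. if \<exists>t\<in>set ts. H2 u (vs ! f1 u) t then 0 else w u)
      \<le> (\<Sum>u\<in>U'. \<Sum>t\<in>T. if H2 u (vs ! f1 u) t then 0 else J' u t) + exp (- real M2 / L2)"
    by blast
  have "(\<Sum>u\<in>U'. \<Sum>t\<in>T. if H2 u (vs ! f1 u) t then 0 else J' u t) \<le> (\<Sum>u\<in>U'. w u * \<delta>)"
  proof (intro sum_mono)
    fix u assume u: "u \<in> U'"
    have pos: "0 < J1 u (vs ! f1 u)" and le: "b u (vs ! f1 u) \<le> \<delta> * J1 u (vs ! f1 u)"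
      using f1G[OF u] by (auto simp: G1_def)
    have "(\<Sum>t\<in>T. if H2 u (vs ! f1 u) t then 0 else J' u t) = w u * b u (vs ! f1 u) / J1 u (vs ! f1 u)"
      unfolding b_def sum_distrib_left sum_divide_distrib by (intro sum.cong) (auto simp: J'_def)
    also have "\<dots> \<le> w u * (\<delta> * J1 u (vs ! f1 u)) / J1 u (vs ! f1 u)"
      using pos le w0 u U' by (intro divide_right_mono mult_left_mono) auto
    finally show "(\<Sum>t\<in>T. if H2 u (vs ! f1 u) t then 0 else J' u t) \<le> w u * \<delta>" using pos by simp
  qed
  also have "\<dots> \<le> 1 * \<delta>"
    unfolding sum_distrib_right[symmetric] w(2)[symmetric] using U' fin w0 \<delta>
    by (intro mult_right_mono sum_mono2) auto
  finally have fail2: "(\<Sum>u\<in>U'. if \<exists>t\<in>set ts. H2 u (vs ! f1 u) t then 0 else w u)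
      \<le> \<delta> + exp (- real M2 / L2)"
    using ts(3) by linarith
  define f2 where "f2 u = (if \<exists>i<M2. H2 u (vs ! f1 u) (ts ! i)
    then SOME i. i < M2 \<and> H2 u (vs ! f1 u) (ts ! i) else 0)" for u
  have f2: "f2 u < M2" for u
    unfolding f2_def using M by (auto intro: someI2_ex)
  have f2H: "H2 u (vs ! f1 u) (ts ! f2 u)" if "\<exists>t\<in>set ts. H2 u (vs ! f1 u) t" for u
  proof -
    have "\<exists>i<M2. H2 u (vs ! f1 u) (ts ! i)" using that ts(1) by (auto simp: in_set_conv_nth)
    then show ?thesis unfolding f2_def by (auto intro: someI2_ex)
  qed
  have "(\<Sum>u\<in>U. if H1 u (vs ! f1 u) \<and> H2 u (vs ! f1 u) (ts ! f2 u) then 0 else w u) \<le>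
    (\<Sum>u\<in>U. (if \<exists>v\<in>set vs. G1 u v then 0 else w u) +
       (if u \<in> U' then (if \<exists>t\<in>set ts. H2 u (vs ! f1 u) t then 0 else w u) else 0))"
  proof (intro sum_mono)
    fix u assume u: "u \<in> U"
    show "(if H1 u (vs ! f1 u) \<and> H2 u (vs ! f1 u) (ts ! f2 u) then 0 else w u) \<le>
      (if \<exists>v\<in>set vs. G1 u v then 0 else w u) +
       (if u \<in> U' then (if \<exists>t\<in>set ts. H2 u (vs ! f1 u) t then 0 else w u) else 0)"
    proof (cases "u \<in> U'")
      case True
      then have "H1 u (vs ! f1 u)" using f1G by (auto simp: G1_def)
      then show ?thesis using True f2H[of u] w0[OF u] by (auto simp: U'_def)
    next
      case False
      then show ?thesis using u w0[OF u] by (auto simp: U'_def)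
    qed
  qed
  also have "\<dots> = (\<Sum>u\<in>U. if \<exists>v\<in>set vs. G1 u v then 0 else w u) +
       (\<Sum>u\<in>U'. if \<exists>t\<in>set ts. H2 u (vs ! f1 u) t then 0 else w u)"
    using fin U' by (simp add: sum.distrib sum.If_cases Int_absorb1 Int_def[symmetric] Collect_mem_eq)
  also have "\<dots> \<le> 3 * \<delta> + exp (- real M1 / L1) + exp (- real M2 / L2)"
    using fail1 fail2 by linarith
  finally show ?thesis using vs ts f1 f2 by blast
qed

section \<open>Achievability\<close>

text \<open>The logarithmic likelihood ratio of the joint law to the product of its marginals. Its
  mean is the mutual information, and its sum along a pair of words is what the weak law
  controls.\<close>

definition info_density :: "('a \<Rightarrow> 'b \<Rightarrow> real) \<Rightarrow> 'a set \<Rightarrow> 'b set \<Rightarrow> 'a \<times> 'b \<Rightarrow> real" where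
  "info_density P A B = (\<lambda>(a, b). if P a b > 0
     then log 2 (P a b / ((\<Sum>b'\<in>B. P a b') * (\<Sum>a'\<in>A. P a' b))) else 0)"

lemma sum_info_density:
  assumes "\<And>a b. a \<in> A \<Longrightarrow> b \<in> B \<Longrightarrow> 0 \<le> P a b"
  shows "(\<Sum>z\<in>A \<times> B. (case z of (a, b) \<Rightarrow> P a b) * info_density P A B z) = mutual_info P A B"
  unfolding mutual_info_def sum.cartesian_product' info_density_def
  using assms by (intro sum.cong refl) auto

lemma le_info_density:
  assumes "finite A" "finite B" "\<And>a b. a \<in> A \<Longrightarrow> b \<in> B \<Longrightarrow> 0 \<le> P a b" "a \<in> A" "b \<in> B"
  shows "P a b \<le> 2 powr info_density P A B (a, b) * (\<Sum>b'\<in>B. P a b') * (\<Sum>a'\<in>A. P a' b)"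
proof (cases "P a b > 0")
  case True
  have "P a b \<le> (\<Sum>b'\<in>B. P a b')" "P a b \<le> (\<Sum>a'\<in>A. P a' b)"
    using assms member_le_sum[of b B "P a"] member_le_sum[of a A "\<lambda>a. P a b"] by auto
  then have "0 < (\<Sum>b'\<in>B. P a b')" "0 < (\<Sum>a'\<in>A. P a' b)" using True by linarith+
  then show ?thesis using True by (simp add: info_density_def)
next
  case False
  then have "P a b = 0" using assms(3)[OF assms(4,5)] by simp
  moreover have "0 \<le> (\<Sum>b'\<in>B. P a b')" "0 \<le> (\<Sum>a'\<in>A. P a' b)"
    using assms by (auto intro!: sum_nonneg)
  ultimately show ?thesis by (simp add: info_density_def)
qed

text \<open>The one-letter bounds multiply and the exponents add. Where the summed density is at
  most n(I + \<epsilon>/2), this is the hypothesis of \<open>covering\<close> with L = 2 powr (n(I +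
  \<epsilon>/2)).\<close>

lemma wprod_le_info_density:
  assumes "finite A" "finite B" and P: "\<And>a b. a \<in> A \<Longrightarrow> b \<in> B \<Longrightarrow> 0 \<le> P a b"
    and "us \<in> nlists n A" "vs \<in> nlists n B"
  shows "wprod (\<lambda>(a, b). P a b) (zip us vs) \<le>
    2 powr sum_list (map (info_density P A B) (zip us vs)) *
      wprod (\<lambda>a. \<Sum>b\<in>B. P a b) us * wprod (\<lambda>b. \<Sum>a\<in>A. P a b) vs"
  using assms(4,5)
proof (induction us arbitrary: n vs)
  case (Cons u us)
  then obtain m v vs' where m: "n = Suc m" "vs = v # vs'" "u \<in> A" "v \<in> B"
    "us \<in> nlists m A" "vs' \<in> nlists m B"
    by (cases vs) (auto simp: nlists_def)
  let ?PA = "\<lambda>a. \<Sum>b\<in>B. P a b" and ?PB = "\<lambda>b. \<Sum>a\<in>A. P a b"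
  have nn: "0 \<le> ?PA a" if "a \<in> A" for a using that P by (intro sum_nonneg) auto
  have nn': "0 \<le> ?PB b" if "b \<in> B" for b using that P by (intro sum_nonneg) auto
  have "P u v * wprod (\<lambda>(a, b). P a b) (zip us vs') \<le>
     (2 powr info_density P A B (u, v) * ?PA u * ?PB v) *
     (2 powr sum_list (map (info_density P A B) (zip us vs')) * wprod ?PA us * wprod ?PB vs')"
  proof (rule mult_mono)
    show "P u v \<le> 2 powr info_density P A B (u, v) * ?PA u * ?PB v"
      using le_info_density[of A B P u v] assms m by blast
    show "0 \<le> wprod (\<lambda>(a, b). P a b) (zip us vs')"
    proof (rule wprod_nonneg)
      fix z assume "z \<in> set (zip us vs')"
      then obtain a b where z: "z = (a, b)" "a \<in> set us" "b \<in> set vs'"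
        by (metis in_set_zipE prod.exhaust)
      then have "a \<in> A" "b \<in> B" using m(5,6) by (auto simp: nlists_def)
      then show "0 \<le> (case z of (a, b) \<Rightarrow> P a b)" using P z(1) by simp
    qed
    show "0 \<le> 2 powr info_density P A B (u, v) * ?PA u * ?PB v"
      using nn nn' m by (intro mult_nonneg_nonneg) auto
  qed (use Cons.IH m in blast)
  then show ?case using m by (simp add: powr_add ac_simps)
qed (auto simp: nlists_def)

lemma sum_list_zip_nth:
  "length us = n \<Longrightarrow> length vs = n \<Longrightarrow> sum_list (map f (zip us vs)) = (\<Sum>t<n. f (us ! t, vs ! t))"
  for f :: "'a \<times> 'b \<Rightarrow> real"
  by (simp add: sum_list_sum_nth atLeast0LessThan)

text \<open>Blocks satisfying \<open>C\<close> contribute at most E on average, the others at most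
  the maximal distortion times their probability.\<close>

lemma avg_dist_le:
  fixes p :: "'x::finite \<Rightarrow> real"
  assumes p: "is_pmf p" and d: "\<And>x y. 0 \<le> d x y" "\<And>x y. d x y \<le> dm" and n: "0 < n"
    and good: "\<And>xs. length xs = n \<Longrightarrow> C xs \<Longrightarrow> (\<Sum>t<n. d (xs ! t) (F xs ! t)) \<le> real n * E"
    and E: "0 \<le> E"
    and bad: "(\<Sum>xs\<in>nlists n UNIV. if C xs then 0 else wprod p xs) \<le> \<beta>"
  shows "avg_dist p d n F \<le> E + dm * \<beta>"
proof -
  have dm: "0 \<le> dm" using d order_trans by blast
  have p0: "0 \<le> wprod p xs" for xs using p by (intro wprod_nonneg) (auto simp: is_pmf_def)
  have "avg_dist p d n F \<le> (\<Sum>xs\<in>nlists n UNIV. wprod p xs * E + dm * (if C xs then 0 else wprod p xs))"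
    unfolding avg_dist_def nlists_UNIV block_prob_def
  proof (intro sum_mono)
    fix xs :: "'x list" assume "xs \<in> {xs. length xs = n}"
    then have l: "length xs = n" by simp
    let ?S = "\<Sum>t<n. d (xs ! t) (F xs ! t)"
    have "?S / real n \<le> (if C xs then E else dm)"
    proof (cases "C xs")
      case True
      then show ?thesis using good[OF l] n by (simp add: divide_le_eq ac_simps)
    next
      case False
      have "?S \<le> (\<Sum>t<n. dm)" by (intro sum_mono d)
      then show ?thesis using n False by (simp add: divide_le_eq ac_simps)
    qed
    then have "wprod p xs * (?S / real n) \<le> wprod p xs * (if C xs then E else dm)"
      using p0 by (intro mult_left_mono) auto
    also have "\<dots> \<le> wprod p xs * E + dm * (if C xs then 0 else wprod p xs)"
      using p0[of xs] E by (auto simp: ac_simps)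
    finally show "wprod p xs * (?S / real n) \<le> wprod p xs * E + dm * (if C xs then 0 else wprod p xs)" .
  qed
  also have "\<dots> = E + dm * (\<Sum>xs\<in>nlists n UNIV. if C xs then 0 else wprod p xs)"
    using p by (simp add: sum.distrib sum_distrib_right[symmetric] sum_distrib_left[symmetric] sum_wprod is_pmf_def)
  also have "\<dots> \<le> E + dm * \<beta>" using bad dm by (intro add_left_mono mult_left_mono) auto
  finally show ?thesis .
qed

text \<open>The codebook has exponent I + \<epsilon> and the likelihood ratio exponent I +
  \<epsilon>/2, so the quotient M/L is at least half of 2 powr (n\<epsilon>/2). The inequality exp z
  \<ge> 1 + z bounds that below by n\<epsilon> ln 2 / 4, which already yields geometric
  decay.\<close>

lemma codebook_size:
  fixes I \<epsilon> :: real
  assumes "0 \<le> I" "0 < \<epsilon>" "0 < n"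
  defines "M \<equiv> nat \<lfloor>2 powr (real n * (I + \<epsilon>))\<rfloor>"
  shows "0 < M" "log 2 (real M) / real n \<le> I + \<epsilon>"
    "exp (- real M / 2 powr (real n * (I + \<epsilon> / 2))) \<le> exp (- (\<epsilon> * ln 2 / 4)) ^ n"
proof -
  let ?X = "2 powr (real n * (I + \<epsilon>))" and ?L = "2 powr (real n * (I + \<epsilon> / 2))"
  have X: "1 \<le> ?X" using assms by (intro ge_one_powr_ge_zero) auto
  then have "1 \<le> \<lfloor>?X\<rfloor>" by (simp add: le_floor_iff)
  then show M: "0 < M" by (simp add: M_def)
  have M1: "real M \<le> ?X" unfolding M_def using X by simp
  have "log 2 (real M) \<le> log 2 ?X" using M M1 X by (subst log_le_cancel_iff) auto
  then show "log 2 (real M) / real n \<le> I + \<epsilon>" using assms by (simp add: divide_le_eq ac_simps)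
  have rM: "real M = real_of_int \<lfloor>?X\<rfloor>" unfolding M_def using X by simp
  have "?X < real M + 1" unfolding rM by linarith
  moreover have "1 \<le> real M" using M by linarith
  \<comment> \<open>Rounding down loses less than 1, which is at most M itself.\<close>
  ultimately have "?X / 2 \<le> real M" by linarith
  then have "(?X / 2) / ?L \<le> real M / ?L"
    by (intro divide_right_mono) auto
  moreover have "(?X / 2) / ?L = 2 powr (real n * (\<epsilon> / 2)) / 2"
    by (simp add: powr_diff[symmetric] algebra_simps)
  moreover have "2 powr (real n * (\<epsilon> / 2)) \<ge> 1 + real n * (\<epsilon> / 2) * ln 2"
    using exp_ge_add_one_self[of "real n * (\<epsilon> / 2) * ln 2"] by (simp add: powr_def)
  moreover have "real n * (\<epsilon> / 2) * ln 2 = 2 * (real n * (\<epsilon> * ln 2 / 4))" by simp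
  ultimately have "real M / ?L \<ge> real n * (\<epsilon> * ln 2 / 4)" by linarith
  then show "exp (- real M / 2 powr (real n * (I + \<epsilon> / 2))) \<le> exp (- (\<epsilon> * ln 2 / 4)) ^ n"
    by (simp add: exp_of_nat_mult[symmetric])
qed

lemma le_double_sum:
  fixes d :: "'x::finite \<Rightarrow> 'y::finite \<Rightarrow> real"
  assumes d: "\<And>x y. 0 \<le> d x y"
  shows "d x y \<le> (\<Sum>x\<in>UNIV. \<Sum>y\<in>UNIV. d x y)"
proof -
  have "d x y \<le> (\<Sum>y\<in>UNIV. d x y)" using d by (intro member_le_sum) auto
  also have "\<dots> \<le> (\<Sum>x\<in>UNIV. \<Sum>y\<in>UNIV. d x y)"
    using d by (intro member_le_sum[of x UNIV "\<lambda>x. \<Sum>y\<in>UNIV. d x y"]) (auto intro!: sum_nonneg)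
  finally show ?thesis .
qed

text \<open>The condition on a single block length inside \<open>achievable_MD\<close>, with the
  slack moved into the five parameters so that codes can be compared by monotonicity.\<close>

definition md_code ::
  "('x::finite \<Rightarrow> real) \<Rightarrow> ('x \<Rightarrow> 'y \<Rightarrow> real) \<Rightarrow> nat \<Rightarrow> real \<Rightarrow> real \<Rightarrow> ereal \<Rightarrow> ereal \<Rightarrow> ereal \<Rightarrow> bool"
  where
  "md_code p d n R1 R2 D1 D2 D12 \<longleftrightarrow>
    (\<exists>(M1::nat) (M2::nat) (f1::'x list \<Rightarrow> nat) (f2::'x list \<Rightarrow> nat)
        (g1::nat \<Rightarrow> 'y list) (g2::nat \<Rightarrow> 'y list) (g12::nat \<Rightarrow> nat \<Rightarrow> 'y list).
       (\<forall>xs. length xs = n \<longrightarrow> f1 xs < M1 \<and> f2 xs < M2) \<and>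
       (\<forall>i. length (g1 i) = n) \<and> (\<forall>j. length (g2 j) = n) \<and> (\<forall>i j. length (g12 i j) = n) \<and>
       log 2 (real M1) / real n \<le> R1 \<and>
       log 2 (real M2) / real n \<le> R2 \<and>
       ereal (avg_dist p d n (\<lambda>xs. g1 (f1 xs))) \<le> D1 \<and>
       ereal (avg_dist p d n (\<lambda>xs. g2 (f2 xs))) \<le> D2 \<and>
       ereal (avg_dist p d n (\<lambda>xs. g12 (f1 xs) (f2 xs))) \<le> D12)"

lemma md_codeE:
  assumes "md_code p d n R1 R2 D1 D2 D12"
  obtains M1 M2 :: nat and f1 f2 g1 g2 g12 where
    "\<And>xs. length xs = n \<Longrightarrow> f1 xs < M1" "\<And>xs. length xs = n \<Longrightarrow> f2 xs < M2"
    "\<And>i. length (g1 i) = n" "\<And>j. length (g2 j) = n" "\<And>i j. length (g12 i j) = n"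
    "log 2 (real M1) / real n \<le> R1" "log 2 (real M2) / real n \<le> R2"
    "ereal (avg_dist p d n (\<lambda>xs. g1 (f1 xs))) \<le> D1"
    "ereal (avg_dist p d n (\<lambda>xs. g2 (f2 xs))) \<le> D2"
    "ereal (avg_dist p d n (\<lambda>xs. g12 (f1 xs) (f2 xs))) \<le> D12"
  using assms unfolding md_code_def by blast

lemma md_codeI:
  assumes "\<And>xs. length xs = n \<Longrightarrow> f1 xs < M1" "\<And>xs. length xs = n \<Longrightarrow> f2 xs < M2"
    "\<And>i. length (g1 i) = n" "\<And>j. length (g2 j) = n" "\<And>i j. length (g12 i j) = n"
    "log 2 (real M1) / real n \<le> R1" "log 2 (real M2) / real n \<le> R2"
    "ereal (avg_dist p d n (\<lambda>xs. g1 (f1 xs))) \<le> D1"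
    "ereal (avg_dist p d n (\<lambda>xs. g2 (f2 xs))) \<le> D2"
    "ereal (avg_dist p d n (\<lambda>xs. g12 (f1 xs) (f2 xs))) \<le> D12"
  shows "md_code p d n R1 R2 D1 D2 D12"
  unfolding md_code_def using assms by blast

lemma achievable_MD_eq:
  "achievable_MD p d R1 R2 D1 D2 D12 \<longleftrightarrow>
    (\<forall>\<epsilon>>0. \<exists>N. \<forall>n\<ge>N. md_code p d n (R1 + \<epsilon>) (R2 + \<epsilon>) (D1 + ereal \<epsilon>) (D2 + ereal \<epsilon>) (D12 + ereal \<epsilon>))"
  unfolding achievable_MD_def md_code_def ..

text \<open>Stated for an arbitrary channel: the second codebook is drawn from the marginal of j and
  has to cover the pair (x, y), hence its rate is the information between that pair and j.\<close>

lemma achievable_MD_random_coding: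
  fixes p :: "'x::finite \<Rightarrow> real" and d :: "'x \<Rightarrow> 'y::finite \<Rightarrow> real"
    and q :: "'x \<Rightarrow> 'y \<Rightarrow> nat \<Rightarrow> real"
  assumes p: "is_pmf p" and d: "\<And>x y. 0 \<le> d x y"
    and q: "\<And>x y j. 0 \<le> q x y j" "\<And>x. (\<Sum>y\<in>UNIV. \<Sum>j<k. q x y j) = 1"
    and I1: "I1 = mutual_info (\<lambda>x y. \<Sum>j<k. p x * q x y j) UNIV UNIV" "0 \<le> I1"
    and I2: "I2 = mutual_info (\<lambda>(x, y) j. p x * q x y j) (UNIV \<times> UNIV) {..<k}" "0 \<le> I2"
    and E1: "E1 = (\<Sum>x\<in>UNIV. \<Sum>y\<in>UNIV. \<Sum>j<k. p x * q x y j * d x y)"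
    and E2: "E2 = (\<Sum>x\<in>UNIV. \<Sum>y\<in>UNIV. \<Sum>j<k. p x * q x y j * d x (g1 j))"
    and E12: "E12 = (\<Sum>x\<in>UNIV. \<Sum>y\<in>UNIV. \<Sum>j<k. p x * q x y j * d x (g2 y j))"
  shows "achievable_MD p d I1 I2 (ereal E1) (ereal E2) (ereal E12)"
  unfolding achievable_MD_eq
proof (intro allI impI)
  fix \<epsilon> :: real assume \<epsilon>: "0 < \<epsilon>"
  define P1 where "P1 = (\<lambda>x y. \<Sum>j<k. p x * q x y j)"
  define P2 where "P2 = (\<lambda>(x, y) j. p x * q x y j)"
  define W1 where "W1 = (\<lambda>(x, y). P1 x y)"
  define W2 where "W2 = (\<lambda>(u, j). P2 u j)"
  define A where "A = (UNIV :: ('x \<times> 'y) set) \<times> {..<k}"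
  define i1 where "i1 = info_density P1 UNIV UNIV"
  define i2 where "i2 = info_density P2 UNIV {..<k}"
  define e1 where "e1 = (\<lambda>(x, y). d x y)"
  define e2 where "e2 = (\<lambda>((x, y :: 'y), j). d x (g1 j))"
  define e12 where "e12 = (\<lambda>((x, y), j). d x (g2 y j))"
  have p0: "0 \<le> p x" and psum: "(\<Sum>x\<in>UNIV. p x) = 1" for x using p by (auto simp: is_pmf_def)
  have P20: "0 \<le> P2 u j" for u j using p0 q by (auto simp: P2_def case_prod_beta)
  have W20: "0 \<le> W2 z" for z using P20 by (auto simp: W2_def case_prod_beta)
  have P10: "0 \<le> P1 x y" for x y using p0 q by (auto simp: P1_def intro!: sum_nonneg)
  have W10: "0 \<le> W1 z" for z using P10 by (auto simp: W1_def case_prod_beta)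
  have P1p: "(\<Sum>y\<in>UNIV. P1 x y) = p x" for x
    unfolding P1_def sum_distrib_left[symmetric] q(2) by simp
  have W1P: "W1 = (\<lambda>u. \<Sum>j<k. W2 (u, j))" by (auto simp: W1_def W2_def P1_def P2_def)
  have W1s: "(\<Sum>z\<in>UNIV. W1 z) = 1"
    unfolding UNIV_Times_UNIV[symmetric] sum.cartesian_product' W1_def using P1p psum by simp
  have W2s: "(\<Sum>z\<in>A. W2 z) = 1"
    unfolding A_def sum.cartesian_product' using W1s by (simp add: W1P)
  \<comment> \<open>The summand 1 makes \<open>dm\<close> positive, so that it can be divided
    by.\<close>
  define dm where "dm = (\<Sum>x\<in>UNIV. \<Sum>y\<in>UNIV. d x y) + 1"
  have dm: "d x y \<le> dm" for x y using le_double_sum[of d x y] d by (simp add: dm_def)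
  have dm0: "0 < dm" unfolding dm_def using d by (intro add_nonneg_pos sum_nonneg) auto
  \<comment> \<open>The total failure probability will be 5\<delta>: three from
    \<open>two_stage_covering\<close> and one for each exponential term. At distortion at most
    \<open>dm\<close> this costs \<epsilon>/2, the other half of \<epsilon> being the typicality
    margin.\<close>
  define \<delta> where "\<delta> = \<epsilon> / (10 * dm)"
  have \<delta>: "0 < \<delta>" "dm * (5 * \<delta>) = \<epsilon> / 2" using \<epsilon> dm0 by (auto simp: \<delta>_def)
  have mean_i1: "(\<Sum>z\<in>UNIV. W1 z * i1 z) = I1"
    using sum_info_density[of UNIV UNIV P1] P10 unfolding I1 W1_def i1_def P1_def by simp
  have mean_e1: "(\<Sum>z\<in>UNIV. W1 z * e1 z) = E1"
    unfolding UNIV_Times_UNIV[symmetric] sum.cartesian_product' E1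
    by (simp add: W1_def e1_def P1_def sum_distrib_right)
  have mean_i2: "(\<Sum>z\<in>A. W2 z * i2 z) = I2"
    using sum_info_density[of UNIV "{..<k}" P2] P20 unfolding I2 W2_def i2_def P2_def A_def by simp
  have mean_e2: "(\<Sum>z\<in>A. W2 z * e2 z) = E2"
    unfolding A_def UNIV_Times_UNIV[symmetric] sum.cartesian_product' E2
    by (simp add: W2_def e2_def P2_def)
  have mean_e12: "(\<Sum>z\<in>A. W2 z * e12 z) = E12"
    unfolding A_def UNIV_Times_UNIV[symmetric] sum.cartesian_product' E12
    by (simp add: W2_def e12_def P2_def)
  have E0: "0 \<le> E1" "0 \<le> E2" "0 \<le> E12"
    unfolding E1 E2 E12 using d p0 q by (auto intro!: sum_nonneg mult_nonneg_nonneg)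
  \<comment> \<open>\<open>H1\<close> below consists of two conditions and \<open>H2\<close> of
    three; their totals must stay within the \<delta> and \<delta>^2 allowed by
    \<open>two_stage_covering\<close>, hence the shares \<delta>/2 and \<delta>^2/3.\<close>
  have wl1: "\<forall>\<^sub>F n in sequentially. (\<Sum>zs\<in>nlists n UNIV.
      if sum_list (map f zs) \<le> real n * ((\<Sum>z\<in>UNIV. W1 z * f z) + \<epsilon> / 2) then 0 else wprod W1 zs) \<le> \<delta> / 2" for f
    using W10 W1s \<epsilon> \<delta> by (intro weak_law) auto
  have wl2: "\<forall>\<^sub>F n in sequentially. (\<Sum>zs\<in>nlists n A.
      if sum_list (map f zs) \<le> real n * ((\<Sum>z\<in>A. W2 z * f z) + \<epsilon> / 2) then 0 else wprod W2 zs) \<le> \<delta>\<^sup>2 / 3" for f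
    using W20 W2s \<epsilon> \<delta> by (intro weak_law) (auto simp: A_def)
  have "(\<lambda>n. exp (- (\<epsilon> * ln 2 / 4)) ^ n) \<longlonglongrightarrow> 0"
    using \<epsilon> by (intro LIMSEQ_power_zero) auto
  then have wl3: "\<forall>\<^sub>F n in sequentially. exp (- (\<epsilon> * ln 2 / 4)) ^ n < \<delta>"
    using \<delta> by (auto intro: order_tendstoD)
  have "\<forall>\<^sub>F n in sequentially. md_code p d n (I1 + \<epsilon>) (I2 + \<epsilon>)
      (ereal E1 + ereal \<epsilon>) (ereal E2 + ereal \<epsilon>) (ereal E12 + ereal \<epsilon>)"
    using wl1[of i1, unfolded mean_i1] wl1[of e1, unfolded mean_e1] wl2[of i2, unfolded mean_i2]
      wl2[of e2, unfolded mean_e2] wl2[of e12, unfolded mean_e12] wl3 eventually_gt_at_top[of 0]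
  proof eventually_elim
    case (elim n)
    define M1 where "M1 = nat \<lfloor>2 powr (real n * (I1 + \<epsilon>))\<rfloor>"
    define M2 where "M2 = nat \<lfloor>2 powr (real n * (I2 + \<epsilon>))\<rfloor>"
    define L1 where "L1 = 2 powr (real n * (I1 + \<epsilon> / 2))"
    define L2 where "L2 = 2 powr (real n * (I2 + \<epsilon> / 2))"
    define H1 where "H1 u v \<longleftrightarrow> sum_list (map i1 (zip u v)) \<le> real n * (I1 + \<epsilon> / 2) \<and>
      sum_list (map e1 (zip u v)) \<le> real n * (E1 + \<epsilon> / 2)" for u v
    define H2 where "H2 u v t \<longleftrightarrow> sum_list (map i2 (zip (zip u v) t)) \<le> real n * (I2 + \<epsilon> / 2) \<and>
      sum_list (map e2 (zip (zip u v) t)) \<le> real n * (E2 + \<epsilon> / 2) \<and>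
      sum_list (map e12 (zip (zip u v) t)) \<le> real n * (E12 + \<epsilon> / 2)" for u v t
    define J where "J u v t = wprod W2 (zip (zip u v) t)" for u v t
    define PY where "PY = (\<lambda>y. \<Sum>x\<in>UNIV. P1 x y)"
    define PT where "PT = (\<lambda>j. \<Sum>u\<in>UNIV. P2 u j)"
    have PYs: "(\<Sum>y\<in>UNIV. PY y) = 1"
      unfolding PY_def by (subst sum.swap) (simp add: P1p psum)
    have PTs: "(\<Sum>j<k. PT j) = 1"
      unfolding PT_def by (subst sum.swap) (use W2s in \<open>simp add: A_def sum.cartesian_product' W2_def\<close>)
    have zipU: "zip u v \<in> nlists n UNIV" if "u \<in> nlists n UNIV" "v \<in> nlists n UNIV"
      for u :: "'x list" and v :: "'y list" using that by (auto simp: nlists_def)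
    have lim: "2 powr s \<le> 2 powr r" if "s \<le> r" for s r :: real using that by simp
    have "\<exists>vs ts f1 f2. length vs = M1 \<and> length ts = M2 \<and> set vs \<subseteq> nlists n UNIV \<and> set ts \<subseteq> nlists n {..<k} \<and>
      (\<forall>u. f1 u < M1 \<and> f2 u < M2) \<and>
      (\<Sum>u\<in>nlists n UNIV. if H1 u (vs ! f1 u) \<and> H2 u (vs ! f1 u) (ts ! f2 u) then 0 else wprod p u)
        \<le> 3 * \<delta> + exp (- real M1 / L1) + exp (- real M2 / L2)"
    proof (rule two_stage_covering)
      show "finite (nlists n (UNIV :: 'x set))" "finite (nlists n (UNIV :: 'y set))" "finite (nlists n {..<k})"
        by (auto intro: finite_nlists)
      show "0 \<le> wprod PY v" for v using P10 by (intro wprod_nonneg) (auto simp: PY_def intro!: sum_nonneg)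
      show "0 \<le> wprod PT t" for t using P20 by (intro wprod_nonneg) (auto simp: PT_def intro!: sum_nonneg)
      show "(\<Sum>v\<in>nlists n UNIV. wprod PY v) = 1" by (simp add: sum_wprod PYs)
      show "(\<Sum>t\<in>nlists n {..<k}. wprod PT t) = 1" by (simp add: sum_wprod PTs)
      show "(\<Sum>u\<in>nlists n UNIV. wprod p u) = 1" by (simp add: sum_wprod psum)
      show "0 \<le> J u v t" for u v t unfolding J_def using W20 by (intro wprod_nonneg) auto
      show "(\<Sum>t\<in>nlists n {..<k}. J u v t) = wprod W1 (zip u v)" if "u \<in> nlists n UNIV" "v \<in> nlists n UNIV" for u v
        unfolding J_def W1P using that by (intro sum_wprod_zip) (auto simp: nlists_def)
      show "(\<Sum>v\<in>nlists n UNIV. wprod W1 (zip u v)) = wprod p u" if "u \<in> nlists n UNIV" for u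
      proof -
        have "(\<Sum>v\<in>nlists n UNIV. wprod W1 (zip u v)) = wprod (\<lambda>x. \<Sum>y\<in>UNIV. W1 (x, y)) u"
          using that by (intro sum_wprod_zip) (auto simp: nlists_def)
        then show ?thesis by (simp add: W1_def P1p)
      qed
      show "0 < L1" "0 < L2" by (auto simp: L1_def L2_def)
      show "wprod W1 (zip u v) \<le> L1 * wprod p u * wprod PY v"
        if "u \<in> nlists n UNIV" "v \<in> nlists n UNIV" "H1 u v" for u v
      proof -
        have "wprod W1 (zip u v) \<le> 2 powr sum_list (map i1 (zip u v)) * wprod p u * wprod PY v"
          using wprod_le_info_density[of UNIV UNIV P1 u n v] that P10
          by (simp add: W1_def i1_def P1p PY_def)
        also have "\<dots> \<le> L1 * wprod p u * wprod PY v"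
          unfolding L1_def using that p0 P10
          by (intro mult_right_mono lim wprod_nonneg) (auto simp: H1_def PY_def intro!: sum_nonneg)
        finally show ?thesis .
      qed
      show "J u v t \<le> L2 * wprod W1 (zip u v) * wprod PT t"
        if "u \<in> nlists n UNIV" "v \<in> nlists n UNIV" "t \<in> nlists n {..<k}" "H2 u v t" for u v t
      proof -
        have "J u v t \<le> 2 powr sum_list (map i2 (zip (zip u v) t)) * wprod W1 (zip u v) * wprod PT t"
          using wprod_le_info_density[of UNIV "{..<k}" P2 "zip u v" n t] that P20 zipU
          unfolding J_def W1P by (simp add: W2_def i2_def PT_def)
        also have "\<dots> \<le> L2 * wprod W1 (zip u v) * wprod PT t"
          unfolding L2_def using that W10 P20
          by (intro mult_right_mono lim wprod_nonneg) (auto simp: H2_def PT_def intro!: sum_nonneg)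
        finally show ?thesis .
      qed
      show "0 < \<delta>" by fact
      show "0 < M1" "0 < M2"
        unfolding M1_def M2_def
        by (rule codebook_size(1)[OF I1(2) \<epsilon> elim(7)] codebook_size(1)[OF I2(2) \<epsilon> elim(7)])+
      have "(\<Sum>u\<in>nlists n UNIV. \<Sum>v\<in>nlists n UNIV. if H1 u v then 0 else wprod W1 (zip u v)) =
        (\<Sum>zs\<in>nlists n UNIV. if sum_list (map i1 zs) \<le> real n * (I1 + \<epsilon> / 2) \<and>
          sum_list (map e1 zs) \<le> real n * (E1 + \<epsilon> / 2) then 0 else wprod W1 zs)"
        unfolding UNIV_Times_UNIV[symmetric] sum_nlists_times H1_def ..
      also have "\<dots> \<le> (\<Sum>zs\<in>nlists n UNIV. (if sum_list (map i1 zs) \<le> real n * (I1 + \<epsilon> / 2) then 0 else wprod W1 zs)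
          + (if sum_list (map e1 zs) \<le> real n * (E1 + \<epsilon> / 2) then 0 else wprod W1 zs))"
        using W10 by (intro sum_mono) (auto intro: wprod_nonneg)
      also have "\<dots> \<le> \<delta>" using elim by (simp add: sum.distrib)
      finally show "(\<Sum>u\<in>nlists n UNIV. \<Sum>v\<in>nlists n UNIV. if H1 u v then 0 else wprod W1 (zip u v)) \<le> \<delta>" .
      have "(\<Sum>u\<in>nlists n UNIV. \<Sum>v\<in>nlists n UNIV. \<Sum>t\<in>nlists n {..<k}. if H2 u v t then 0 else J u v t) =
        (\<Sum>zs\<in>nlists n A. if sum_list (map i2 zs) \<le> real n * (I2 + \<epsilon> / 2) \<and>
          sum_list (map e2 zs) \<le> real n * (E2 + \<epsilon> / 2) \<and>
          sum_list (map e12 zs) \<le> real n * (E12 + \<epsilon> / 2) then 0 else wprod W2 zs)"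
        unfolding A_def UNIV_Times_UNIV[symmetric] sum_nlists_times H2_def J_def ..
      also have "\<dots> \<le> (\<Sum>zs\<in>nlists n A. (if sum_list (map i2 zs) \<le> real n * (I2 + \<epsilon> / 2) then 0 else wprod W2 zs)
          + (if sum_list (map e2 zs) \<le> real n * (E2 + \<epsilon> / 2) then 0 else wprod W2 zs)
          + (if sum_list (map e12 zs) \<le> real n * (E12 + \<epsilon> / 2) then 0 else wprod W2 zs))"
        using W20 by (intro sum_mono) (auto intro: wprod_nonneg)
      also have "\<dots> \<le> \<delta>\<^sup>2" using elim by (simp add: sum.distrib)
      finally show "(\<Sum>u\<in>nlists n UNIV. \<Sum>v\<in>nlists n UNIV. \<Sum>t\<in>nlists n {..<k}. if H2 u v t then 0 else J u v t) \<le> \<delta>\<^sup>2" .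
    qed
    then obtain vs ts f1 f2 where vs: "length vs = M1" "set vs \<subseteq> nlists n UNIV"
      and ts: "length ts = M2" "set ts \<subseteq> nlists n {..<k}"
      and f: "\<And>u. f1 u < M1" "\<And>u. f2 u < M2"
      and bad: "(\<Sum>u\<in>nlists n UNIV. if H1 u (vs ! f1 u) \<and> H2 u (vs ! f1 u) (ts ! f2 u) then 0 else wprod p u)
        \<le> 3 * \<delta> + exp (- real M1 / L1) + exp (- real M2 / L2)"
      by blast
    have "exp (- real M1 / L1) \<le> \<delta>" "exp (- real M2 / L2) \<le> \<delta>"
      using codebook_size(3)[of I1 \<epsilon> n] codebook_size(3)[of I2 \<epsilon> n] I1 I2 \<epsilon> elim
      unfolding M1_def L1_def M2_def L2_def by linarith+
    then have bad': "(\<Sum>u\<in>nlists n UNIV. if H1 u (vs ! f1 u) \<and> H2 u (vs ! f1 u) (ts ! f2 u) then 0 else wprod p u)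
        \<le> 5 * \<delta>" using bad by linarith
    \<comment> \<open>The decoders are total functions on \<open>nat\<close>, so indices outside the
      codebook also receive a word of length n.\<close>
    define c1 where "c1 i = (if i < M1 then vs ! i else replicate n undefined)" for i
    define c2 where "c2 j = (if j < M2 then ts ! j else replicate n 0)" for j
    have lc: "length (c1 i) = n" "length (c2 j) = n" for i j
    proof -
      have "v \<in> set vs \<Longrightarrow> length v = n" "t \<in> set ts \<Longrightarrow> length t = n" for v t
        using vs(2) ts(2) by (auto simp: nlists_def)
      then show "length (c1 i) = n" "length (c2 j) = n"
        using vs(1) ts(1) unfolding c1_def c2_def by auto
    qed
    have cf: "c1 (f1 u) = vs ! f1 u" "c2 (f2 u) = ts ! f2 u" for u using f by (auto simp: c1_def c2_def)
    have s1: "sum_list (map e1 (zip u v)) = (\<Sum>t<n. d (u ! t) (v ! t))"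
      if "length u = n" "length v = n" for u v
      using that by (simp add: sum_list_zip_nth e1_def)
    have s2: "sum_list (map e2 (zip (zip u v) t)) = (\<Sum>s<n. d (u ! s) (map g1 t ! s))"
      "sum_list (map e12 (zip (zip u v) t)) = (\<Sum>s<n. d (u ! s) (map (\<lambda>(y, j). g2 y j) (zip v t) ! s))"
      if "length u = n" "length v = n" "length t = n" for u v t
      using that by (simp_all add: sum_list_zip_nth[where n = n] e2_def e12_def)
    let ?C = "\<lambda>u. H1 u (vs ! f1 u) \<and> H2 u (vs ! f1 u) (ts ! f2 u)"
    have a1: "avg_dist p d n (\<lambda>xs. c1 (f1 xs)) \<le> (E1 + \<epsilon> / 2) + dm * (5 * \<delta>)"
    proof (rule avg_dist_le[OF p d dm elim(7) _ _ bad'])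
      fix xs :: "'x list" assume l: "length xs = n" and C: "?C xs"
      show "(\<Sum>t<n. d (xs ! t) ((c1 (f1 xs)) ! t)) \<le> real n * (E1 + \<epsilon> / 2)"
        using C unfolding cf[symmetric] H1_def H2_def by (simp only: s1[OF l lc(1)])
    qed (use E0 \<epsilon> in simp)
    have a2: "avg_dist p d n (\<lambda>xs. map g1 (c2 (f2 xs))) \<le> (E2 + \<epsilon> / 2) + dm * (5 * \<delta>)"
    proof (rule avg_dist_le[OF p d dm elim(7) _ _ bad'])
      fix xs :: "'x list" assume l: "length xs = n" and C: "?C xs"
      show "(\<Sum>t<n. d (xs ! t) ((map g1 (c2 (f2 xs))) ! t)) \<le> real n * (E2 + \<epsilon> / 2)"
        using C unfolding cf[symmetric] H1_def H2_def by (simp only: s2(1)[OF l lc])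
    qed (use E0 \<epsilon> in simp)
    have a12: "avg_dist p d n (\<lambda>xs. map (\<lambda>(y, j). g2 y j) (zip (c1 (f1 xs)) (c2 (f2 xs)))) \<le> (E12 + \<epsilon> / 2) + dm * (5 * \<delta>)"
    proof (rule avg_dist_le[OF p d dm elim(7) _ _ bad'])
      fix xs :: "'x list" assume l: "length xs = n" and C: "?C xs"
      show "(\<Sum>t<n. d (xs ! t) ((map (\<lambda>(y, j). g2 y j) (zip (c1 (f1 xs)) (c2 (f2 xs)))) ! t)) \<le> real n * (E12 + \<epsilon> / 2)"
        using C unfolding cf[symmetric] H1_def H2_def by (simp only: s2(2)[OF l lc])
    qed (use E0 \<epsilon> in simp)
    have r: "log 2 (real M1) / real n \<le> I1 + \<epsilon>" "log 2 (real M2) / real n \<le> I2 + \<epsilon>"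

      unfolding M1_def M2_def
      by (rule codebook_size(2)[OF I1(2) \<epsilon> elim(7)] codebook_size(2)[OF I2(2) \<epsilon> elim(7)])+
    show ?case
      by (rule md_codeI[where ?f1.0 = f1 and ?f2.0 = f2 and ?g1.0 = c1 and ?g2.0 = "\<lambda>j. map g1 (c2 j)"
            and ?g12.0 = "\<lambda>i j. map (\<lambda>(y, j). g2 y j) (zip (c1 i) (c2 j))"
            and ?M1.0 = M1 and ?M2.0 = M2])
        (use f lc r a1 a2 a12 \<delta>(2) in auto)
  qed
  then show "\<exists>N. \<forall>n\<ge>N. md_code p d n (I1 + \<epsilon>) (I2 + \<epsilon>)
      (ereal E1 + ereal \<epsilon>) (ereal E2 + ereal \<epsilon>) (ereal E12 + ereal \<epsilon>)"
    unfolding eventually_sequentially .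
qed

section \<open>Random functions and the functional representation\<close>

text \<open>Greedy peeling: choose a function through positive entries of all rows and subtract its
  least entry along it. All rows lose the same mass and at least one positive entry disappears, so
  the number of functions is at most the number of nonzero entries. The common row sum s is left
  free because it shrinks in the induction.\<close>

lemma function_coupling:
  fixes r :: "'y::finite \<Rightarrow> 'b::finite \<Rightarrow> real"
  assumes "\<And>y b. 0 \<le> r y b" "\<And>y. (\<Sum>b\<in>UNIV. r y b) = s"
  shows "\<exists>l :: ('y \<Rightarrow> 'b) \<Rightarrow> real. (\<forall>\<phi>. 0 \<le> l \<phi>) \<and> (\<forall>y b. (\<Sum>\<phi> | \<phi> y = b. l \<phi>) = r y b) \<and>
    card {\<phi>. l \<phi> \<noteq> 0} \<le> card {(y, b). r y b \<noteq> 0}"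
  using assms
proof (induction "card {(y, b). r y b \<noteq> 0}" arbitrary: r s rule: less_induct)
  case less
  show ?case
  proof (cases "s = 0")
    case True
    then have "r y b = 0" for y b
      using less.prems by (simp add: sum_nonneg_eq_0_iff)
    then show ?thesis by (intro exI[of _ "\<lambda>_. 0"]) auto
  next
    case False
    have "\<exists>b. 0 < r y b" for y
    proof (rule ccontr)
      assume "\<nexists>b. 0 < r y b"
      then have "r y b = 0" for b using less.prems(1)[of y b] by (simp add: not_less order_antisym)
      then show False using less.prems(2)[of y] False by simp
    qed
    then obtain \<phi>0 where \<phi>0: "\<And>y. 0 < r y (\<phi>0 y)" by metis
    define \<mu> where "\<mu> = Min (range (\<lambda>y. r y (\<phi>0 y)))"
    have "\<mu> \<in> range (\<lambda>y. r y (\<phi>0 y))" unfolding \<mu>_def by (intro Min_in) auto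
    then obtain y0 where y0: "\<mu> = r y0 (\<phi>0 y0)" by auto
    have \<mu>le: "\<mu> \<le> r y (\<phi>0 y)" for y unfolding \<mu>_def by (intro Min_le) auto
    have \<mu>: "0 < \<mu>" using \<phi>0 y0 by simp
    define r' where "r' y b = r y b - (if b = \<phi>0 y then \<mu> else 0)" for y b
    have r': "0 \<le> r' y b" "(\<Sum>b\<in>UNIV. r' y b) = s - \<mu>" for y b
      using less.prems \<mu>le[of y] by (auto simp: r'_def sum_subtractf)
    have sub: "{(y, b). r' y b \<noteq> 0} \<subset> {(y, b). r y b \<noteq> 0}"
    proof
      show "{(y, b). r' y b \<noteq> 0} \<subseteq> {(y, b). r y b \<noteq> 0}"
        using \<phi>0 by (auto simp: r'_def split: if_splits) (metis less_irrefl)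
      have "(y0, \<phi>0 y0) \<notin> {(y, b). r' y b \<noteq> 0}" "(y0, \<phi>0 y0) \<in> {(y, b). r y b \<noteq> 0}"
        using y0 \<mu> by (auto simp: r'_def)
      then show "{(y, b). r' y b \<noteq> 0} \<noteq> {(y, b). r y b \<noteq> 0}" by blast
    qed
    then have lt: "card {(y, b). r' y b \<noteq> 0} < card {(y, b). r y b \<noteq> 0}"
      by (intro psubset_card_mono) auto
    obtain l where l: "\<And>\<phi>. 0 \<le> l \<phi>" "\<And>y b. (\<Sum>\<phi> | \<phi> y = b. l \<phi>) = r' y b"
      "card {\<phi>. l \<phi> \<noteq> 0} \<le> card {(y, b). r' y b \<noteq> 0}"
      using less.hyps[OF lt r'] by blast
    define l' where "l' \<phi> = l \<phi> + (if \<phi> = \<phi>0 then \<mu> else 0)" for \<phi>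
    have "(\<Sum>\<phi> | \<phi> y = b. l' \<phi>) = r y b" for y b
    proof -
      have "(\<Sum>\<phi> | \<phi> y = b. l' \<phi>) = r' y b + (\<Sum>\<phi> | \<phi> y = b. if \<phi> = \<phi>0 then \<mu> else 0)"
        by (simp add: l'_def sum.distrib l(2))
      also have "\<dots> = r y b" by (auto simp: r'_def)
      finally show ?thesis .
    qed
    moreover have "card {\<phi>. l' \<phi> \<noteq> 0} \<le> card (insert \<phi>0 {\<phi>. l \<phi> \<noteq> 0})"
      by (intro card_mono) (auto simp: l'_def)
    then have "card {\<phi>. l' \<phi> \<noteq> 0} \<le> card {(y, b). r y b \<noteq> 0}"
      using l(3) lt card_insert_le_m1[of "Suc (card {\<phi>. l \<phi> \<noteq> 0})" "{\<phi>. l \<phi> \<noteq> 0}" \<phi>0] by simp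
    moreover have "0 \<le> l' \<phi>" for \<phi> using l(1) \<mu> by (simp add: l'_def)
    ultimately show ?thesis by blast
  qed
qed

text \<open>The construction below needs at most m^3 letters. From m \<ge> 2 follow m \<le> m^3 and
  2 m^3 \<le> m^4; at m = 1 the right-hand side would be 0.\<close>

lemma le_power4_diff:
  fixes m :: nat
  assumes "2 \<le> m"
  shows "m ^ 3 \<le> m ^ 4 - m"
proof -
  have "m \<le> m ^ 3" using assms by (intro self_le_power) auto
  moreover have "2 * m ^ 3 \<le> m * m ^ 3" using assms by (intro mult_right_mono) auto
  moreover have "m * m ^ 3 = m ^ 4" by (simp add: power_Suc[symmetric] del: power_Suc)
  ultimately show ?thesis by linarith
qed

definition valid_channel :: "nat \<Rightarrow> ('x \<Rightarrow> 'y::finite \<Rightarrow> nat \<Rightarrow> real) \<Rightarrow> bool" where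
  "valid_channel k q \<longleftrightarrow> (\<forall>x y j. 0 \<le> q x y j) \<and> (\<forall>x. (\<Sum>y\<in>UNIV. \<Sum>j<k. q x y j) = 1)"

text \<open>A functional representation: the third description \<open>B\<close> becomes a function of \<open>Y\<close> and of a
  refinement \<open>(A, \<Phi>)\<close> of the second one, where \<open>\<Phi>\<close> is a random function with \<open>B = \<Phi> Y\<close>. Given
  \<open>(Y, A, B)\<close>, \<open>\<Phi>\<close> carries no information about \<open>X\<close>.\<close>

lemma functional_representation:
  fixes P :: "'x::finite \<times> 'y::finite \<times> 'y \<times> 'y \<Rightarrow> real" and p :: "'x \<Rightarrow> real"
    and d :: "'x \<Rightarrow> 'y \<Rightarrow> real"
  defines "X \<equiv> \<lambda>(x, y, a, b). x" and "Y \<equiv> \<lambda>(x, y, a, b). y" and "A \<equiv> \<lambda>(x, y, a, b). a"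
    and "B \<equiv> \<lambda>(x, y, a, b). b"
  assumes fp: "fin_prob UNIV P" and pX: "\<And>x. fin_prob.prb UNIV P X x = p x"
    and indep: "\<And>y a. fin_prob.prb UNIV P (\<lambda>w. (Y w, A w)) (y, a) =
      fin_prob.prb UNIV P Y y * fin_prob.prb UNIV P A a"
    and card: "2 \<le> CARD('y)"
  shows "\<exists>k q g1 g2. k \<le> CARD('y) ^ 4 - CARD('y) \<and> valid_channel k q \<and>
    mutual_info (\<lambda>y j. \<Sum>x\<in>UNIV. p x * q x y j) UNIV {..<k} = 0 \<and>
    mutual_info (\<lambda>x y. \<Sum>j<k. p x * q x y j) UNIV UNIV = fin_prob.mi UNIV P X Y \<and>
    mutual_info (\<lambda>x (y, j). p x * q x y j) UNIV (UNIV \<times> {..<k}) =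
      fin_prob.mi UNIV P X (\<lambda>w. (Y w, A w, B w)) \<and>
    (\<Sum>x\<in>UNIV. \<Sum>y\<in>UNIV. \<Sum>j<k. p x * q x y j * d x y) = (\<Sum>w\<in>UNIV. P w * d (X w) (Y w)) \<and>
    (\<Sum>x\<in>UNIV. \<Sum>y\<in>UNIV. \<Sum>j<k. p x * q x y j * d x (g1 j)) = (\<Sum>w\<in>UNIV. P w * d (X w) (A w)) \<and>
    (\<Sum>x\<in>UNIV. \<Sum>y\<in>UNIV. \<Sum>j<k. p x * q x y j * d x (g2 y j)) = (\<Sum>w\<in>UNIV. P w * d (X w) (B w))"
proof -
  interpret fin_prob UNIV P by fact
  let ?YA = "\<lambda>y a. prb (\<lambda>w. (Y w, A w)) (y, a)" and ?YAB = "\<lambda>y a b. prb (\<lambda>w. (Y w, A w, B w)) (y, a, b)"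
  have YAB_sum: "(\<Sum>b\<in>UNIV. ?YAB y a b) = ?YA y a" for y a
  proof -
    have "?YAB y a b = prb (\<lambda>w. ((Y w, A w), B w)) ((y, a), b)" for b by (rule prb_cong) auto
    then show ?thesis using prb_marginal[of UNIV B "\<lambda>w. (Y w, A w)" "(y, a)"] by simp
  qed
  have YAB_le: "?YAB y a b \<le> ?YA y a" for y a b by (rule prb_mono) auto
  have single: "prb (\<lambda>w. (X w, Y w, A w, B w)) (x, y, a, b) = P (x, y, a, b)" for x y a b
  proof -
    have "{w \<in> UNIV. (X w, Y w, A w, B w) = (x, y, a, b)} = {(x, y, a, b)}"
      by (auto simp: X_def Y_def A_def B_def)
    then show ?thesis by (simp add: prb_def)
  qed
  have P_sum: "(\<Sum>x\<in>UNIV. P (x, y, a, b)) = ?YAB y a b" for y a b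
    using prb_marginal'[of UNIV X "\<lambda>w. (Y w, A w, B w)" "(y, a, b)"] by (simp add: single)
  have P_le: "P (x, y, a, b) \<le> ?YAB y a b" for x y a b
    unfolding P_sum[symmetric] using nonneg by (intro member_le_sum[of x UNIV "\<lambda>x. P (x, y, a, b)"]) auto
  \<comment> \<open>The conditional law of B given Y = y and A = a. On null pairs a point mass at an
    arbitrary letter keeps the rows normalized, as \<open>function_coupling\<close>
    requires.\<close>
  define r where "r a y b = (if ?YA y a > 0 then ?YAB y a b / ?YA y a else if b = undefined then 1 else 0)" for a y b
  have r0: "0 \<le> r a y b" for a y b by (auto simp: r_def prb_nonneg)
  have r1: "(\<Sum>b\<in>UNIV. r a y b) = 1" for a y
    by (cases "?YA y a > 0") (simp_all add: r_def sum_divide_distrib[symmetric] YAB_sum)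
  have rYA: "?YA y a * r a y b = ?YAB y a b" for a y b
    using prb_nonneg[of "\<lambda>w. (Y w, A w)" "(y, a)"] prb_nonneg[of "\<lambda>w. (Y w, A w, B w)" "(y, a, b)"] YAB_le[of y a b]
    by (auto simp: r_def)
  have "\<exists>l. (\<forall>\<phi>. 0 \<le> l \<phi>) \<and> (\<forall>y b. (\<Sum>\<phi> | \<phi> y = b. l \<phi>) = r a y b) \<and>
      card {\<phi>. l \<phi> \<noteq> 0} \<le> card {(y, b). r a y b \<noteq> 0}" for a
    by (rule function_coupling) (rule r0, rule r1)
  then obtain l where l: "\<And>a \<phi>. 0 \<le> l a \<phi>" "\<And>a y b. (\<Sum>\<phi> | \<phi> y = b. l a \<phi>) = r a y b"
    "\<And>a. card {\<phi>. l a \<phi> \<noteq> 0} \<le> card {(y, b). r a y b \<noteq> 0}"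
    by metis
  have l_le: "l a \<phi> \<le> r a y (\<phi> y)" for a \<phi> y
    unfolding l(2)[symmetric] using l(1) by (intro member_le_sum) auto
  \<comment> \<open>The conditional probability of the function \<phi> given Y = y, A = a and B =
    \<phi> y. It does not involve x, which is why \<phi> adds no information about the
    source.\<close>
  define \<kappa> where "\<kappa> y a \<phi> = l a \<phi> / r a y (\<phi> y)" for y a \<phi>
  have \<kappa>0: "0 \<le> \<kappa> y a \<phi>" for y a \<phi> using l(1) r0 by (simp add: \<kappa>_def)
  define Q where "Q = (\<lambda>(x, y, a, \<phi>). P (x, y, a, \<phi> y) * \<kappa> y a \<phi>)"
  have Q0: "0 \<le> Q w" for w using nonneg \<kappa>0 by (auto simp: Q_def case_prod_beta)
  have Qb: "(\<Sum>\<phi> | \<phi> y = b. Q (x, y, a, \<phi>)) = P (x, y, a, b)" for x y a b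
  proof -
    have "(\<Sum>\<phi> | \<phi> y = b. Q (x, y, a, \<phi>)) = (\<Sum>\<phi> | \<phi> y = b. P (x, y, a, b) / r a y b * l a \<phi>)"
      by (intro sum.cong) (auto simp: Q_def \<kappa>_def)
    also have "\<dots> = P (x, y, a, b) / r a y b * r a y b"
      unfolding sum_distrib_left[symmetric] l(2) ..
    also have "\<dots> = P (x, y, a, b)"
      using P_le[of x y a b] rYA[of y a b] nonneg[of "(x, y, a, b)"] by (cases "r a y b = 0") auto
    finally show ?thesis .
  qed
  have QX: "(\<Sum>x\<in>UNIV. Q (x, y, a, \<phi>)) = ?YA y a * l a \<phi>" for y a \<phi>
  proof -
    have "(\<Sum>x\<in>UNIV. Q (x, y, a, \<phi>)) = ?YAB y a (\<phi> y) * \<kappa> y a \<phi>"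
      by (simp add: Q_def sum_distrib_right[symmetric] P_sum)
    also have "\<dots> = ?YA y a * (r a y (\<phi> y) * \<kappa> y a \<phi>)" by (simp add: rYA[symmetric])
    also have "r a y (\<phi> y) * \<kappa> y a \<phi> = l a \<phi>"
      using l_le[of a \<phi> y] l(1)[of a \<phi>] by (auto simp: \<kappa>_def)
    finally show ?thesis .
  qed
  \<comment> \<open>Evaluates the random function at y. The image of \<open>Q\<close> under
    \<open>Z\<close> is the original law, so all quantities in X, Y, A, B carry over.\<close>
  define Z where "Z = (\<lambda>(x :: 'x, y :: 'y, a :: 'y, \<phi> :: 'y \<Rightarrow> 'y). (x, y, a, \<phi> y))"
  have Zfib: "{w \<in> UNIV. Z w = (x, y, a, b)} = (\<lambda>\<phi>. (x, y, a, \<phi>)) ` {\<phi>. \<phi> y = b}" for x y a b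
    by (auto simp: Z_def)
  have QZ: "(\<Sum>w | w \<in> UNIV \<and> Z w = v. Q w) = P v" for v
  proof -
    obtain x y a b where v: "v = (x, y, a, b)" by (cases v)
    show ?thesis unfolding v Zfib by (subst sum.reindex) (auto simp: inj_on_def Qb)
  qed
  have Qs: "sum Q UNIV = 1"
  proof -
    have "(\<Sum>v\<in>UNIV. \<Sum>w | w \<in> UNIV \<and> Z w = v. Q w) = sum Q UNIV" by (rule sum.group) auto
    then show ?thesis using sum1 by (simp only: QZ)
  qed
  interpret Q: fin_prob UNIV Q
    by unfold_locales (use Q0 Qs in auto)
  have PQ: "Q.prb Z = P" unfolding Q.prb_def using QZ by auto
  define X' where "X' = (\<lambda>(x :: 'x, y :: 'y, a :: 'y, \<phi> :: 'y \<Rightarrow> 'y). x)"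
  define Y' where "Y' = (\<lambda>(x :: 'x, y :: 'y, a :: 'y, \<phi> :: 'y \<Rightarrow> 'y). y)"
  define A' where "A' = (\<lambda>(x :: 'x, y :: 'y, a :: 'y, \<phi> :: 'y \<Rightarrow> 'y). (a, \<phi>))"
  define B' where "B' = (\<lambda>(x :: 'x, y :: 'y, a :: 'y, \<phi> :: 'y \<Rightarrow> 'y). (y, a, \<phi> y))"
  have comp: "X (Z w) = X' w" "Y (Z w) = Y' w" for w
    by (auto simp: X_def Y_def Z_def X'_def Y'_def split: prod.splits)
  have comp3: "(\<lambda>w. (Y (Z w), A (Z w), B (Z w))) = B'"
    "(\<lambda>w. (X (Z w), Y (Z w), A (Z w), B (Z w))) = (\<lambda>w. (X' w, B' w))"
    by (auto simp: X_def Y_def A_def B_def Z_def X'_def Y'_def B'_def)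
  have mi1: "Q.mi X' Y' = mi X Y"
    using mi_image[OF Q.fin_prob_axioms, of UNIV Z X Y] by (simp add: PQ comp)
  have mi2: "Q.mi X' B' = mi X (\<lambda>w. (Y w, A w, B w))"
    using mi_image[OF Q.fin_prob_axioms, of UNIV Z X "\<lambda>w. (Y w, A w, B w)"]
    unfolding PQ comp3 by (simp add: comp)
  have "Q.cmi X' A' B' = 0"
  proof (rule Q.cmi_zero_if)
    fix w :: "'x \<times> 'y \<times> 'y \<times> ('y \<Rightarrow> 'y)"
    obtain x y a \<phi> where w: "w = (x, y, a, \<phi>)" by (cases w)
    have f: "X' w = x" "A' w = (a, \<phi>)" "B' w = (y, a, \<phi> y)" by (auto simp: w X'_def A'_def B'_def)
    have s1: "{w \<in> UNIV. (X' w, A' w, B' w) = (x, (a, \<phi>), y, a, \<phi> y)} = {(x, y, a, \<phi>)}"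
      by (auto simp: X'_def A'_def B'_def)
    have s2: "{w \<in> UNIV. (A' w, B' w) = ((a, \<phi>), y, a, \<phi> y)} = range (\<lambda>x. (x, y, a, \<phi>))"
      by (auto simp: A'_def B'_def)
    have 1: "Q.prb (\<lambda>w. (X' w, A' w, B' w)) (x, (a, \<phi>), y, a, \<phi> y) = Q (x, y, a, \<phi>)"
      unfolding Q.prb_def s1 by simp
    have 2: "Q.prb (\<lambda>w. (A' w, B' w)) ((a, \<phi>), y, a, \<phi> y) = ?YA y a * l a \<phi>"
      unfolding Q.prb_def s2 by (subst sum.reindex) (auto simp: inj_on_def QX)
    have 3: "Q.prb B' (y, a, \<phi> y) = ?YAB y a (\<phi> y)"
      using prb_image[OF Q.fin_prob_axioms, of UNIV Z "\<lambda>w. (Y w, A w, B w)" "(y, a, \<phi> y)"]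
      unfolding PQ comp3 by simp
    have 4: "Q.prb (\<lambda>w. (X' w, B' w)) (x, y, a, \<phi> y) = P (x, y, a, \<phi> y)"
      using prb_image[OF Q.fin_prob_axioms, of UNIV Z "\<lambda>w. (X w, Y w, A w, B w)" "(x, y, a, \<phi> y)"]
      unfolding PQ comp3 single by simp
    have "Q (x, y, a, \<phi>) * ?YAB y a (\<phi> y) = P (x, y, a, \<phi> y) * (?YA y a * (r a y (\<phi> y) * \<kappa> y a \<phi>))"
      by (simp add: Q_def rYA[symmetric])
    also have "r a y (\<phi> y) * \<kappa> y a \<phi> = l a \<phi>"
      using l_le[of a \<phi> y] l(1)[of a \<phi>] by (auto simp: \<kappa>_def)
    finally show "Q.prb (\<lambda>w. (X' w, A' w, B' w)) (X' w, A' w, B' w) * Q.prb B' (B' w) =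
       Q.prb (\<lambda>w. (X' w, B' w)) (X' w, B' w) * Q.prb (\<lambda>w. (A' w, B' w)) (A' w, B' w)"
      unfolding f 1 2 3 4 .
  qed
  then have "Q.mi X' (\<lambda>w. (A' w, B' w)) = Q.mi X' B'" by (simp add: Q.mi_chain)
  moreover have "Q.mi X' (\<lambda>w. (A' w, B' w)) = Q.mi X' (\<lambda>w. (Y' w, A' w))"
    by (rule Q.mi_cong) (auto simp: A'_def B'_def Y'_def split: prod.splits)
  ultimately have mi3: "Q.mi X' (\<lambda>w. (Y' w, A' w)) = mi X (\<lambda>w. (Y w, A w, B w))"
    using mi2 by simp
  \<comment> \<open>Given a, the function is drawn by \<open>l a\<close> independently of y; hence
    independence of Y and A extends to Y and the refined pair (a, \<phi>).\<close>
  have prYA: "Q.prb (\<lambda>w. (Y' w, A' w)) (y, a, \<phi>) = ?YA y a * l a \<phi>" for y a \<phi>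
  proof -
    have s: "{w \<in> UNIV. (Y' w, A' w) = (y, a, \<phi>)} = range (\<lambda>x. (x, y, a, \<phi>))"
      by (auto simp: A'_def Y'_def)
    show ?thesis unfolding Q.prb_def s by (subst sum.reindex) (auto simp: inj_on_def QX)
  qed
  have prA: "Q.prb A' (a, \<phi>) = prb A a * l a \<phi>" for a \<phi>
  proof -
    have "Q.prb A' (a, \<phi>) = (\<Sum>y\<in>UNIV. ?YA y a * l a \<phi>)"
      using Q.prb_marginal'[of UNIV Y' A' "(a, \<phi>)"] by (simp add: prYA)
    also have "\<dots> = prb A a * l a \<phi>"
      unfolding sum_distrib_right[symmetric] using prb_marginal'[of UNIV Y A a] by simp
    finally show ?thesis .
  qed
  have prY: "Q.prb Y' y = prb Y y" for y
    using prb_image[OF Q.fin_prob_axioms, of UNIV Z Y y] by (simp add: PQ comp)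
  have mi0: "Q.mi Y' A' = 0"
  proof (rule Q.mi_prod_zero)
    fix w
    obtain a \<phi> where "A' w = (a, \<phi>)" by (cases "A' w")
    then show "Q.prb (\<lambda>w. (Y' w, A' w)) (Y' w, A' w) = Q.prb Y' (Y' w) * Q.prb A' (A' w)"
      by (simp add: prYA prA prY indep)
  qed
  \<comment> \<open>Each of the m letters a uses at most m^2 functions, one for each nonzero entry
    of \<open>r a\<close>, which gives m^3 pairs with m = \<open>CARD('y)\<close>.\<close>
  define J where "J = {(a, \<phi>). l a \<phi> \<noteq> 0}"
  define k where "k = card J"
  have Jfin: "finite J" by simp
  have k: "k \<le> CARD('y) ^ 3"
  proof -
    have "J = (\<Union>a. Pair a ` {\<phi>. l a \<phi> \<noteq> 0})" by (auto simp: J_def)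
    then have "k = card (\<Union>a. Pair a ` {\<phi>. l a \<phi> \<noteq> 0})" by (simp only: k_def)
    also have "\<dots> \<le> (\<Sum>a\<in>UNIV. card (Pair a ` {\<phi>. l a \<phi> \<noteq> 0}))"
      by (rule card_UN_le) simp
    also have "\<dots> \<le> (\<Sum>a\<in>(UNIV :: 'y set). CARD('y) * CARD('y))"
    proof (intro sum_mono)
      fix a
      have "card (Pair a ` {\<phi>. l a \<phi> \<noteq> 0}) \<le> card {\<phi>. l a \<phi> \<noteq> 0}" by (rule card_image_le) simp
      also have "\<dots> \<le> card {(y, b). r a y b \<noteq> 0}" by (rule l(3))
      also have "\<dots> \<le> card (UNIV :: ('y \<times> 'y) set)" by (intro card_mono) auto
      finally show "card (Pair a ` {\<phi>. l a \<phi> \<noteq> 0}) \<le> CARD('y) * CARD('y)" by simp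
    qed
    finally show ?thesis by (simp add: power3_eq_cube)
  qed
  obtain e where e: "bij_betw e J {..<k}"
    using ex_bij_betw_finite_nat[OF Jfin] by (auto simp: k_def atLeast0LessThan)
  define e' where "e' = the_inv_into J e"
  have e': "e' (e z) = z" if "z \<in> J" for z
    using that e by (simp add: e'_def the_inv_into_f_f bij_betw_def)
  \<comment> \<open>The numbering \<open>e\<close> is injective only on \<open>J\<close>; outside
    this set \<open>Q\<close> vanishes, so restricting the space makes \<open>C\<close> as
    informative as \<open>A'\<close>.\<close>
  define \<Omega>' where "\<Omega>' = {w. A' w \<in> J}"
  have zero: "\<forall>w\<in>UNIV - \<Omega>'. Q w = 0"
    by (auto simp: \<Omega>'_def A'_def J_def Q_def \<kappa>_def)
  note restr = Q.fin_prob_axioms subset_UNIV zero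
  interpret R: fin_prob \<Omega>' Q by (rule fin_prob_restrict[OF restr])
  define C where "C w = e (A' w)" for w
  have C: "C ` \<Omega>' \<subseteq> {..<k}" using e by (auto simp: C_def \<Omega>'_def bij_betw_def)
  have Cinj: "C w = C w' \<longleftrightarrow> A' w = A' w'" if "w \<in> \<Omega>'" "w' \<in> \<Omega>'" for w w'
    using that e unfolding C_def \<Omega>'_def bij_betw_def by (auto dest: inj_onD)
  let ?L = "\<lambda>x y j. R.prb (\<lambda>w. (X' w, Y' w, C w)) (x, y, j)"
  have px: "R.prb X' x = p x" for x
    using prb_restrict[OF restr, of X' x] prb_image[OF Q.fin_prob_axioms, of UNIV Z X x] pX[of x] by (simp add: PQ comp)
  \<comment> \<open>For a source letter of probability zero any law serves as the conditional one;
    the marginal of (Y', C) keeps the row normalized.\<close>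
  define q where "q x y j = (if p x > 0 then ?L x y j / p x else R.prb (\<lambda>w. (Y' w, C w)) (y, j))" for x y j
  have pq: "p x * q x y j = ?L x y j" for x y j
  proof (cases "p x > 0")
    case False
    then have "p x = 0" using px[of x] R.prb_nonneg[of X' x] by simp
    moreover have "?L x y j \<le> R.prb X' x" by (rule R.prb_mono) auto
    ultimately show ?thesis using px[of x] R.prb_nonneg[of "\<lambda>w. (X' w, Y' w, C w)" "(x, y, j)"] by simp
  qed (simp add: q_def)
  have tot: "(\<Sum>y\<in>UNIV. \<Sum>j<k. ?L x y j) = p x" for x
  proof -
    have "(\<Sum>y\<in>UNIV. \<Sum>j<k. ?L x y j) = (\<Sum>v\<in>UNIV \<times> {..<k}. R.prb (\<lambda>w. (X' w, (Y' w, C w))) (x, v))"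
      by (simp add: sum.cartesian_product')
    also have "\<dots> = p x" using C px by (subst R.prb_marginal) auto
    finally show ?thesis .
  qed
  have tot': "(\<Sum>y\<in>UNIV. \<Sum>j<k. R.prb (\<lambda>w. (Y' w, C w)) (y, j)) = 1"
    using R.sum_prb_1[of "UNIV \<times> {..<k}" "\<lambda>w. (Y' w, C w)"] C by (auto simp: sum.cartesian_product')
  have valid: "valid_channel k q"
    unfolding valid_channel_def
  proof (intro conjI allI)
    show "0 \<le> q x y j" for x y j by (auto simp: q_def R.prb_nonneg)
    show "(\<Sum>y\<in>UNIV. \<Sum>j<k. q x y j) = 1" for x
      by (cases "p x > 0") (simp_all add: q_def sum_divide_distrib[symmetric] tot tot')
  qed
  have i0: "mutual_info (\<lambda>y j. \<Sum>x\<in>UNIV. p x * q x y j) UNIV {..<k} = R.mi Y' C"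
    unfolding pq by (rule R.mutual_info_eq_mi) (use C in \<open>auto simp: R.prb_marginal'\<close>)
  have i1: "mutual_info (\<lambda>x y. \<Sum>j<k. p x * q x y j) UNIV UNIV = R.mi X' Y'"
  proof -
    have "(\<Sum>j<k. ?L x y j) = R.prb (\<lambda>w. (X' w, Y' w)) (x, y)" for x y
    proof -
      have "?L x y j = R.prb (\<lambda>w. ((X' w, Y' w), C w)) ((x, y), j)" for j by (rule R.prb_cong) auto
      then show ?thesis using C by (simp add: R.prb_marginal)
    qed
    then show ?thesis unfolding pq by (intro R.mutual_info_eq_mi) auto
  qed
  have i12: "mutual_info (\<lambda>x (y, j). p x * q x y j) UNIV (UNIV \<times> {..<k}) = R.mi X' (\<lambda>w. (Y' w, C w))"
    unfolding pq by (rule R.mutual_info_eq_mi) (use C in auto)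
  have "R.mi Y' C = R.mi Y' A'" "R.mi X' (\<lambda>w. (Y' w, C w)) = R.mi X' (\<lambda>w. (Y' w, A' w))"
    by (rule R.mi_cong; simp add: Cinj)+
  then have i0': "R.mi Y' C = 0" and i12': "R.mi X' (\<lambda>w. (Y' w, C w)) = mi X (\<lambda>w. (Y w, A w, B w))"
    using mi_restrict[OF restr, of Y' A'] mi_restrict[OF restr, of X' "\<lambda>w. (Y' w, A' w)"] mi0 mi3 by simp_all
  have i1': "R.mi X' Y' = mi X Y" using mi_restrict[OF restr, of X' Y'] mi1 by simp
  have E: "(\<Sum>x\<in>UNIV. \<Sum>y\<in>UNIV. \<Sum>j<k. p x * q x y j * F x y (e' j)) =
     (\<Sum>w\<in>UNIV. Q w * F (X' w) (Y' w) (A' w))" for F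
  proof -
    have "(\<Sum>x\<in>UNIV. \<Sum>y\<in>UNIV. \<Sum>j<k. p x * q x y j * F x y (e' j)) =
      (\<Sum>v\<in>UNIV \<times> UNIV \<times> {..<k}. R.prb (\<lambda>w. (X' w, Y' w, C w)) v * (\<lambda>(x, y, j). F x y (e' j)) v)"
      by (simp add: sum.cartesian_product' pq)
    also have "\<dots> = (\<Sum>w\<in>\<Omega>'. Q w * F (X' w) (Y' w) (e' (C w)))"
      using C by (subst R.sum_prb) auto
    also have "\<dots> = (\<Sum>w\<in>\<Omega>'. Q w * F (X' w) (Y' w) (A' w))"
      by (intro sum.cong refl) (simp add: C_def \<Omega>'_def e')
    also have "\<dots> = (\<Sum>w\<in>UNIV. Q w * F (X' w) (Y' w) (A' w))" by (rule sum_restrict[OF restr])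
    finally show ?thesis .
  qed
  have compAB: "A (Z w) = fst (A' w)" "B (Z w) = snd (A' w) (Y' w)" for w
    by (auto simp: A_def B_def Z_def A'_def Y'_def split: prod.splits)
  have E': "(\<Sum>w\<in>UNIV. P w * F w) = (\<Sum>w\<in>UNIV. Q w * F (Z w))" for F
    using Q.sum_prb[of UNIV Z F] by (simp add: PQ)
  show ?thesis
  proof (intro exI conjI)
    show "k \<le> CARD('y) ^ 4 - CARD('y)" using k le_power4_diff[OF card] by linarith
    show "valid_channel k q" by (rule valid)
    show "mutual_info (\<lambda>y j. \<Sum>x\<in>UNIV. p x * q x y j) UNIV {..<k} = 0" by (simp only: i0 i0')
    show "mutual_info (\<lambda>x y. \<Sum>j<k. p x * q x y j) UNIV UNIV = mi X Y" by (simp only: i1 i1')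
    show "mutual_info (\<lambda>x (y, j). p x * q x y j) UNIV (UNIV \<times> {..<k}) = mi X (\<lambda>w. (Y w, A w, B w))"
      by (simp only: i12 i12')
    show "(\<Sum>x\<in>UNIV. \<Sum>y\<in>UNIV. \<Sum>j<k. p x * q x y j * d x y) = (\<Sum>w\<in>UNIV. P w * d (X w) (Y w))"
      unfolding E' using E[of "\<lambda>x y z. d x y"] by (simp add: comp)
    show "(\<Sum>x\<in>UNIV. \<Sum>y\<in>UNIV. \<Sum>j<k. p x * q x y j * d x (fst (e' j))) = (\<Sum>w\<in>UNIV. P w * d (X w) (A w))"
      unfolding E' using E[of "\<lambda>x y z. d x (fst z)"]
      by (simp only: comp compAB)
    show "(\<Sum>x\<in>UNIV. \<Sum>y\<in>UNIV. \<Sum>j<k. p x * q x y j * d x (snd (e' j) y)) = (\<Sum>w\<in>UNIV. P w * d (X w) (B w))"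
      unfolding E' using E[of "\<lambda>x y z. d x (snd z y)"]
      by (simp only: comp compAB)
  qed
qed

text \<open>In entropies, I(XY; J) = I(X; YJ) - I(X; Y) + I(Y; J). Independence of the two
  descriptions removes the last term, and the rate of the second random codebook becomes
  \<open>I12 - I1\<close>.\<close>

lemma achievable_MD_single_letter:
  fixes p :: "'x::finite \<Rightarrow> real" and d :: "'x \<Rightarrow> 'y::finite \<Rightarrow> real"
  assumes p: "is_pmf p" and d: "\<And>x y. 0 \<le> d x y" and q: "valid_channel k q"
    and indep: "mutual_info (\<lambda>y j. \<Sum>x\<in>UNIV. p x * q x y j) UNIV {..<k} = 0"
    and I1: "I1 = mutual_info (\<lambda>x y. \<Sum>j<k. p x * q x y j) UNIV UNIV"
    and I12: "I12 = mutual_info (\<lambda>x (y, j). p x * q x y j) UNIV (UNIV \<times> {..<k})"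
    and E1: "E1 = (\<Sum>x\<in>UNIV. \<Sum>y\<in>UNIV. \<Sum>j<k. p x * q x y j * d x y)"
    and E2: "E2 = (\<Sum>x\<in>UNIV. \<Sum>y\<in>UNIV. \<Sum>j<k. p x * q x y j * d x (g1 j))"
    and E12: "E12 = (\<Sum>x\<in>UNIV. \<Sum>y\<in>UNIV. \<Sum>j<k. p x * q x y j * d x (g2 y j))"
  shows "achievable_MD p d I1 (I12 - I1) (ereal E1) (ereal E2) (ereal E12)"
proof -
  define P where "P = (\<lambda>(x, y, j). p x * q x y j)"
  define \<Omega> where "\<Omega> = (UNIV :: ('x \<times> 'y) set) \<times> {..<k}"
  define W where "W = (\<lambda>((x, y), j). p x * q x y j)"
  have q0: "0 \<le> q x y j" and q1: "(\<Sum>y\<in>UNIV. \<Sum>j<k. q x y j) = 1" for x y j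
    using q by (auto simp: valid_channel_def)
  have p0: "0 \<le> p x" and p1: "(\<Sum>x\<in>UNIV. p x) = 1" for x using p by (auto simp: is_pmf_def)
  have "sum W \<Omega> = (\<Sum>x\<in>UNIV. \<Sum>y\<in>UNIV. \<Sum>j<k. p x * q x y j)"
    unfolding \<Omega>_def UNIV_Times_UNIV[symmetric] sum.cartesian_product' by (simp add: W_def)
  also have "\<dots> = 1" by (simp add: sum_distrib_left[symmetric] q1 p1)
  finally have "sum W \<Omega> = 1" .
  then interpret fin_prob \<Omega> W
    using p0 q0 by unfold_locales (auto simp: \<Omega>_def W_def)
  define X where "X = (\<lambda>((x :: 'x, y :: 'y), j :: nat). x)"
  define Y where "Y = (\<lambda>((x :: 'x, y :: 'y), j :: nat). y)"
  define J where "J = (\<lambda>((x :: 'x, y :: 'y), j :: nat). j)"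
  have J: "J ` \<Omega> \<subseteq> {..<k}" by (auto simp: J_def \<Omega>_def)
  have XYJ: "prb (\<lambda>w. (X w, Y w, J w)) (x, y, j) = p x * q x y j" if "j < k" for x y j
  proof -
    have "{w \<in> \<Omega>. (X w, Y w, J w) = (x, y, j)} = {((x, y), j)}"
      using that by (auto simp: X_def Y_def J_def \<Omega>_def)
    then show ?thesis unfolding prb_def by (simp add: W_def)
  qed
  have XYJ': "prb (\<lambda>w. ((X w, Y w), J w)) ((x, y), j) = p x * q x y j" if "j < k" for x y j
    unfolding XYJ[OF that, symmetric] by (rule prb_cong) auto
  have "mutual_info (\<lambda>y j. \<Sum>x\<in>UNIV. p x * q x y j) UNIV {..<k} = mi Y J"
  proof (rule mutual_info_eq_mi)
    fix y j assume "j \<in> {..<k}"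
    then show "(\<Sum>x\<in>UNIV. p x * q x y j) = prb (\<lambda>w. (Y w, J w)) (y, j)"
      using prb_marginal'[of UNIV X "\<lambda>w. (Y w, J w)" "(y, j)"] by (simp add: XYJ)
  qed (use J in auto)
  moreover have "I1 = mi X Y" unfolding I1
  proof (rule mutual_info_eq_mi)
    fix x y
    show "(\<Sum>j<k. p x * q x y j) = prb (\<lambda>w. (X w, Y w)) (x, y)"
      using prb_marginal[of "{..<k}" J "\<lambda>w. (X w, Y w)" "(x, y)"] J by (simp add: XYJ')
  qed auto
  moreover have "I12 = mi X (\<lambda>w. (Y w, J w))" unfolding I12
    by (rule mutual_info_eq_mi) (use J in \<open>auto simp: XYJ\<close>)
  moreover have "mutual_info (\<lambda>(x, y) j. p x * q x y j) (UNIV \<times> UNIV) {..<k} = mi (\<lambda>w. (X w, Y w)) J"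
    by (rule mutual_info_eq_mi) (use J in \<open>auto simp: XYJ'\<close>)
  moreover have "mi (\<lambda>w. (X w, Y w)) J = mi X (\<lambda>w. (Y w, J w)) - mi X Y + mi Y J"
  proof -
    have "ent (\<lambda>w. ((X w, Y w), J w)) = ent (\<lambda>w. (X w, Y w, J w))" by (rule ent_cong) auto
    then show ?thesis by (simp add: mi_def)
  qed
  ultimately have I2: "I12 - I1 = mutual_info (\<lambda>(x, y) j. p x * q x y j) (UNIV \<times> UNIV) {..<k}"
    and nn: "0 \<le> I1" "0 \<le> I12 - I1"
    using indep mi_nonneg[of X Y] mi_nonneg[of "\<lambda>w. (X w, Y w)" J] by simp_all
  show ?thesis
    by (rule achievable_MD_random_coding[OF p d q0 q1 I1 nn(1) I2 nn(2) E1 E2 E12])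
qed

section \<open>Laws induced by block codes\<close>

locale block_code =
  fixes p :: "'x::finite \<Rightarrow> real" and n :: nat and f1 f2 :: "'x list \<Rightarrow> nat"
  assumes pmf: "is_pmf p" and n: "0 < n"
begin

lemma p_nonneg: "0 \<le> p x" and p_sum: "(\<Sum>x\<in>UNIV. p x) = 1"
  using pmf by (auto simp: is_pmf_def)

abbreviation blk :: "'x list set" where "blk \<equiv> nlists n UNIV"

lemma fin_blk: "finite blk" by (intro finite_nlists) auto

sublocale B: fin_prob blk "wprod p"
  using fin_blk by unfold_locales (auto intro: wprod_nonneg p_nonneg simp: sum_wprod p_sum)

text \<open>Besides the source block \<open>u\<close> we use a second block \<open>v\<close>, drawn afresh given the first
  description \<open>f1 u\<close>. It is again i.i.d., but depends on \<open>f2 u\<close> only through \<open>f1 u\<close>.\<close>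

definition PP :: "'x list \<times> 'x list \<Rightarrow> real" where
  "PP = (\<lambda>(u, v). if f1 u = f1 v then wprod p u * wprod p v / B.prb f1 (f1 u) else 0)"

lemma wprod_le_prb: "u \<in> blk \<Longrightarrow> wprod p u \<le> B.prb f1 (f1 u)" by (rule B.prb_ge)

lemma wprod_p_nonneg: "0 \<le> wprod p u" by (intro wprod_nonneg p_nonneg)

lemma PP_nonneg: "0 \<le> PP w"
  by (auto simp: PP_def case_prod_beta wprod_p_nonneg B.prb_nonneg)

lemma sum_PP: assumes "u \<in> blk" shows "(\<Sum>v\<in>blk. PP (u, v)) = wprod p u"
proof -
  have "(\<Sum>v\<in>blk. PP (u, v)) = (\<Sum>v\<in>blk. wprod p u / B.prb f1 (f1 u) * (if f1 v = f1 u then wprod p v else 0))"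
    by (intro sum.cong) (auto simp: PP_def)
  also have "\<dots> = wprod p u / B.prb f1 (f1 u) * B.prb f1 (f1 u)"
    unfolding sum_distrib_left[symmetric] B.prb_alt ..
  also have "\<dots> = wprod p u"
    using wprod_le_prb[OF assms] wprod_p_nonneg[of u] by (cases "B.prb f1 (f1 u) = 0") auto
  finally show ?thesis .
qed

sublocale C: fin_prob "blk \<times> blk" PP
proof
  show "sum PP (blk \<times> blk) = 1"
    unfolding sum.cartesian_product' using B.sum1 by (simp add: sum_PP)
qed (auto simp: PP_nonneg fin_blk)

lemma sum_fst: "(\<Sum>w\<in>blk \<times> blk. PP w * F (fst w)) = (\<Sum>u\<in>blk. wprod p u * F u)"
  unfolding sum.cartesian_product' by (simp add: sum_distrib_right[symmetric] sum_PP)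

text \<open>\<open>PP\<close> is symmetric and lives on pairs with f1 u = f1 v. The two blocks
  therefore have the same joint law with the first description, so each can replace the other next
  to it.\<close>

lemma swap: "(\<Sum>w\<in>blk \<times> blk. PP w * F (snd w) (f1 (fst w))) = (\<Sum>w\<in>blk \<times> blk. PP w * F (fst w) (f1 (fst w)))"
proof -
  have "(\<Sum>w\<in>blk \<times> blk. PP w * F (snd w) (f1 (fst w))) = (\<Sum>u\<in>blk. \<Sum>v\<in>blk. PP (u, v) * F v (f1 u))"
    unfolding sum.cartesian_product' by simp
  also have "\<dots> = (\<Sum>v\<in>blk. \<Sum>u\<in>blk. PP (u, v) * F v (f1 u))" by (rule sum.swap)
  also have "\<dots> = (\<Sum>v\<in>blk. \<Sum>u\<in>blk. PP (v, u) * F v (f1 v))"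
    by (intro sum.cong refl) (auto simp: PP_def)
  also have "\<dots> = (\<Sum>w\<in>blk \<times> blk. PP w * F (fst w) (f1 (fst w)))"
    unfolding sum.cartesian_product' by simp
  finally show ?thesis .
qed

lemma prb_swap: "C.prb (\<lambda>w. F (snd w) (f1 (fst w))) s = C.prb (\<lambda>w. F (fst w) (f1 (fst w))) s"
proof -
  have "C.prb (\<lambda>w. G w) s = (\<Sum>w\<in>blk \<times> blk. PP w * (if G w = s then 1 else 0))" for G
    unfolding C.prb_alt by (intro sum.cong) auto
  then show ?thesis using swap[of "\<lambda>v i. if F v i = s then 1 else 0"] by simp
qed

lemma prb_fst: "C.prb (\<lambda>w. F (fst w)) s = B.prb F s"
proof -
  have "C.prb (\<lambda>w. F (fst w)) s = (\<Sum>w\<in>blk \<times> blk. PP w * (if F (fst w) = s then 1 else 0))"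
    unfolding C.prb_alt by (intro sum.cong) auto
  also have "\<dots> = (\<Sum>u\<in>blk. wprod p u * (if F u = s then 1 else 0))" by (rule sum_fst)
  also have "\<dots> = B.prb F s" unfolding B.prb_alt by (intro sum.cong) auto
  finally show ?thesis .
qed

lemma ent_fst: "C.ent (\<lambda>w. F (fst w)) = B.ent F"
  unfolding C.ent_def B.ent_def prb_fst using sum_fst[of "\<lambda>u. log 2 (B.prb F (F u))"] by simp

lemma ent_snd: "C.ent (\<lambda>w. F (snd w)) = B.ent F"
proof -
  have p: "C.prb (\<lambda>w. F (snd w)) s = B.prb F s" for s
    using prb_swap[of "\<lambda>v i. F v" s] prb_fst by simp
  show ?thesis unfolding C.ent_def B.ent_def p
    using swap[of "\<lambda>v i. log 2 (B.prb F (F v))"] sum_fst[of "\<lambda>u. log 2 (B.prb F (F u))"] by simp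
qed

lemma prb_nth: "t < n \<Longrightarrow> B.prb (\<lambda>u. u ! t) x = p x"
proof -
  assume t: "t < n"
  have "B.prb (\<lambda>u. u ! t) x = (\<Sum>u\<in>blk. wprod p u * (if u ! t = x then 1 else 0))"
    unfolding B.prb_alt by (intro sum.cong) auto
  also have "\<dots> = (\<Sum>z\<in>UNIV. p z * (if z = x then 1 else 0))"
    by (rule sum_wprod_nth[OF p_sum t])
  also have "\<dots> = p x" by (simp add: if_distrib cong: if_cong)
  finally show ?thesis .
qed

lemma ent_nth: "t < n \<Longrightarrow> B.ent (\<lambda>u. u ! t) = - (\<Sum>x\<in>UNIV. p x * log 2 (p x))"
  by (simp add: B.ent_def prb_nth sum_wprod_nth[OF p_sum, of t n "\<lambda>x. log 2 (p x)"])

text \<open>The logarithm of a product weight is a sum over the letters, each with the same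
  mean.\<close>

lemma ent_block: "B.ent (\<lambda>u. u) = (\<Sum>t<n. B.ent (\<lambda>u. u ! t))"
proof -
  have "B.prb (\<lambda>u. u) u = wprod p u" if "u \<in> blk" for u
  proof -
    have "{w \<in> blk. w = u} = {u}" using that by auto
    then show ?thesis by (simp add: B.prb_def)
  qed
  then have "B.ent (\<lambda>u. u) = - (\<Sum>u\<in>blk. wprod p u * log 2 (wprod p u))" by (simp add: B.ent_def)
  also have "(\<Sum>u\<in>blk. wprod p u * log 2 (wprod p u)) =
     (\<Sum>u\<in>blk. wprod p u * sum_list (map (\<lambda>x. log 2 (p x)) u))"
  proof (intro sum.cong refl)
    fix u :: "'x list"
    have "wprod p u \<noteq> 0 \<Longrightarrow> log 2 (wprod p u) = sum_list (map (\<lambda>x. log 2 (p x)) u)"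
    proof (induction u)
      case (Cons x u)
      then have "0 < p x" "0 < wprod p u"
        using p_nonneg[of x] wprod_p_nonneg[of u] by (auto simp: less_le)
      then show ?case using Cons.IH by (simp add: log_mult_pos)
    qed simp
    then show "wprod p u * log 2 (wprod p u) = wprod p u * sum_list (map (\<lambda>x. log 2 (p x)) u)"
      by (cases "wprod p u = 0") auto
  qed
  also have "\<dots> = real n * (\<Sum>x\<in>UNIV. p x * log 2 (p x))" by (rule sum_wprod_sum_list[OF p_sum])
  finally show ?thesis by (simp add: ent_nth)
qed

lemma sum_mi_fst_le: "(\<Sum>t<n. C.mi (\<lambda>w. fst w ! t) g) \<le> C.mi fst g"
proof (rule C.sum_mi_le_mi_block)
  show "C.ent fst = (\<Sum>t<n. C.ent (\<lambda>w. fst w ! t))"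
    using ent_block ent_fst[of "\<lambda>u. u"] ent_fst[of "\<lambda>u. u ! t" for t] by simp
qed (auto simp: nlists_def)

lemma sum_mi_snd_le: "(\<Sum>t<n. C.mi (\<lambda>w. snd w ! t) g) \<le> C.mi snd g"
proof (rule C.sum_mi_le_mi_block)
  show "C.ent snd = (\<Sum>t<n. C.ent (\<lambda>w. snd w ! t))"
    using ent_block ent_snd[of "\<lambda>u. u"] ent_snd[of "\<lambda>u. u ! t" for t] by simp
qed (auto simp: nlists_def)

text \<open>The Markov chain v - f1 u - u is built into \<open>PP\<close>: multiplied by the
  probability of f1 u, the joint weight is a product of a factor in u and a factor in v.\<close>

lemma cmi_fst_snd: "C.cmi snd fst (\<lambda>w. f1 (fst w)) = 0"
proof (rule C.cmi_zero_if)
  fix w assume "w \<in> blk \<times> blk"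
  then obtain u v where w: "w = (u, v)" "u \<in> blk" "v \<in> blk" by auto
  have s: "{w \<in> blk \<times> blk. (snd w, fst w, f1 (fst w)) = (v, u, f1 u)} = {(u, v)}" using w by auto
  have 1: "C.prb (\<lambda>w. (snd w, fst w, f1 (fst w))) (v, u, f1 u) = PP (u, v)"
    unfolding C.prb_def s by simp
  have 2: "C.prb (\<lambda>w. f1 (fst w)) (f1 u) = B.prb f1 (f1 u)" by (rule prb_fst)
  have b: "B.prb (\<lambda>u. (u, f1 u)) (u, i) = (if f1 u = i then wprod p u else 0)" if "u \<in> blk" for u i
  proof -
    have "{w \<in> blk. (w, f1 w) = (u, i)} = (if f1 u = i then {u} else {})" using that by auto
    then show ?thesis by (simp add: B.prb_def)
  qed
  have 3: "C.prb (\<lambda>w. (fst w, f1 (fst w))) (u, f1 u) = wprod p u"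
    using prb_fst[of "\<lambda>u. (u, f1 u)"] b w by simp
  have 4: "C.prb (\<lambda>w. (snd w, f1 (fst w))) (v, f1 u) = (if f1 v = f1 u then wprod p v else 0)"
    using prb_swap[of "\<lambda>v i. (v, i)"] prb_fst[of "\<lambda>u. (u, f1 u)"] b w by simp
  have "PP (u, v) * B.prb f1 (f1 u) = wprod p u * (if f1 v = f1 u then wprod p v else 0)"
    using wprod_le_prb[OF w(2)] wprod_p_nonneg[of u] by (auto simp: PP_def)
  then show "C.prb (\<lambda>w. (snd w, fst w, f1 (fst w))) (snd w, fst w, f1 (fst w)) * C.prb (\<lambda>w. f1 (fst w)) (f1 (fst w)) =
     C.prb (\<lambda>w. (snd w, f1 (fst w))) (snd w, f1 (fst w)) * C.prb (\<lambda>w. (fst w, f1 (fst w))) (fst w, f1 (fst w))"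
    unfolding w fst_conv snd_conv 1 2 3 4 by (simp add: mult.commute)
qed

text \<open>Data processing on both sides of that Markov chain: \<open>f2\<close> is a function of
  the original block, F of the resampled one.\<close>

lemma cmi_resampled:
  assumes F: "\<And>w w'. snd w = snd w' \<Longrightarrow> F w = F w'"
  shows "C.cmi F (\<lambda>w. f2 (fst w)) (\<lambda>w. f1 (fst w)) = 0"
proof -
  have "C.cmi F (\<lambda>w. f2 (fst w)) (\<lambda>w. f1 (fst w)) \<le> C.cmi F fst (\<lambda>w. f1 (fst w))"
    by (rule C.cmi_mono) simp
  also have "\<dots> = C.cmi fst F (\<lambda>w. f1 (fst w))" by (rule C.cmi_commute)
  also have "\<dots> \<le> C.cmi fst snd (\<lambda>w. f1 (fst w))" by (rule C.cmi_mono) (rule F)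
  also have "\<dots> = 0" using cmi_fst_snd C.cmi_commute[of fst snd "\<lambda>w. f1 (fst w)"] by simp
  finally show ?thesis using C.cmi_nonneg[of F "\<lambda>w. f2 (fst w)" "\<lambda>w. f1 (fst w)"] by linarith
qed

section \<open>Passage to single letters by a random time index\<close>

text \<open>The time t is uniform on {..<n} and independent of the two blocks; reading every
  sequence at time t turns averages over positions into single-letter quantities.\<close>

definition PT :: "('x list \<times> 'x list) \<times> nat \<Rightarrow> real" where
  "PT = (\<lambda>(w, t). PP w / real n)"

lemma sum_PT: "(\<Sum>z\<in>(blk \<times> blk) \<times> {..<n}. PT z * F z) = (\<Sum>t<n. (\<Sum>w\<in>blk \<times> blk. PP w * F (w, t))) / real n"
proof -
  have "(\<Sum>z\<in>(blk \<times> blk) \<times> {..<n}. PT z * F z) = (\<Sum>w\<in>blk \<times> blk. \<Sum>t<n. PP w * F (w, t) / real n)"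
    unfolding sum.cartesian_product' by (simp add: PT_def)
  also have "\<dots> = (\<Sum>t<n. \<Sum>w\<in>blk \<times> blk. PP w * F (w, t) / real n)" by (rule sum.swap)
  finally show ?thesis by (simp add: sum_divide_distrib)
qed

sublocale T: fin_prob "(blk \<times> blk) \<times> {..<n}" PT
proof
  show "sum PT ((blk \<times> blk) \<times> {..<n}) = 1"
    using sum_PT[of "\<lambda>_. 1"] n C.sum1 by simp
qed (auto simp: PT_def PP_nonneg fin_blk)

lemma prb_time: "T.prb (\<lambda>z. F (snd z) (fst z)) v = (\<Sum>t<n. C.prb (F t) v) / real n"
proof -
  have "T.prb (\<lambda>z. F (snd z) (fst z)) v = (\<Sum>z\<in>(blk \<times> blk) \<times> {..<n}. PT z * (if F (snd z) (fst z) = v then 1 else 0))"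
    unfolding T.prb_alt by (intro sum.cong) auto
  also have "\<dots> = (\<Sum>t<n. (\<Sum>w\<in>blk \<times> blk. PP w * (if F t w = v then 1 else 0))) / real n"
    unfolding sum_PT by simp
  also have "\<dots> = (\<Sum>t<n. C.prb (F t) v) / real n"
    unfolding C.prb_alt by (intro arg_cong2[where f = "(/)"] sum.cong refl) auto
  finally show ?thesis .
qed

text \<open>The chain rule for H(T) + H(F_T | T): the index contributes log n, and given T = t the
  variable is \<open>F t\<close>.\<close>

lemma ent_time:
  "T.ent (\<lambda>z. (F (snd z) (fst z), snd z)) = log 2 (real n) + (\<Sum>t<n. C.ent (F t)) / real n"
proof -
  have prb: "T.prb (\<lambda>z. (F (snd z) (fst z), snd z)) (v, t) = C.prb (F t) v / real n" if "t < n" for v t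
  proof -
    have "C.prb (\<lambda>w. (F s w, s)) (v, t) = (if s = t then C.prb (F t) v else 0)" for s
      by (cases "s = t") (auto simp: C.prb_def)
    then show ?thesis using prb_time[of "\<lambda>t w. (F t w, t)" "(v, t)"] that by simp
  qed
  have "T.ent (\<lambda>z. (F (snd z) (fst z), snd z)) =
    - (\<Sum>z\<in>(blk \<times> blk) \<times> {..<n}. PT z * log 2 (C.prb (F (snd z)) (F (snd z) (fst z)) / real n))"
    unfolding T.ent_def by (intro arg_cong[where f = uminus] sum.cong refl) (auto simp: prb)
  also have "\<dots> = - ((\<Sum>t<n. (\<Sum>w\<in>blk \<times> blk. PP w * log 2 (C.prb (F t) (F t w) / real n))) / real n)"
    unfolding sum_PT by simp
  also have "(\<Sum>t<n. (\<Sum>w\<in>blk \<times> blk. PP w * log 2 (C.prb (F t) (F t w) / real n))) =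
    (\<Sum>t<n. - C.ent (F t) - log 2 (real n))"
  proof (intro sum.cong refl)
    fix t
    have "(\<Sum>w\<in>blk \<times> blk. PP w * log 2 (C.prb (F t) (F t w) / real n)) =
      (\<Sum>w\<in>blk \<times> blk. PP w * log 2 (C.prb (F t) (F t w)) - PP w * log 2 (real n))"
    proof (intro sum.cong refl)
      fix w assume w: "w \<in> blk \<times> blk"
      show "PP w * log 2 (C.prb (F t) (F t w) / real n) = PP w * log 2 (C.prb (F t) (F t w)) - PP w * log 2 (real n)"
      proof (cases "PP w = 0")
        case False
        then have "0 < C.prb (F t) (F t w)" using C.prb_ge[OF w, of "F t"] PP_nonneg[of w] by linarith
        then show ?thesis using n by (simp add: log_divide_pos algebra_simps)
      qed simp
    qed
    then show "(\<Sum>w\<in>blk \<times> blk. PP w * log 2 (C.prb (F t) (F t w) / real n)) = - C.ent (F t) - log 2 (real n)"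
      by (simp add: sum_subtractf sum_distrib_right[symmetric] C.sum1 C.ent_def)
  qed
  also have "- ((\<Sum>t<n. - C.ent (F t) - log 2 (real n)) / real n) = log 2 (real n) + (\<Sum>t<n. C.ent (F t)) / real n"
    using n by (simp add: sum_subtractf sum_negf field_simps)
  finally show ?thesis .
qed

text \<open>All \<open>X t\<close> have the law p, so the letter at the random time is independent
  of the time. Joining the index to \<open>G\<close> then gives no further information beyond the
  average over positions.\<close>

lemma mi_time:
  assumes law: "\<And>t x. t < n \<Longrightarrow> C.prb (X t) x = p x"
  shows "T.mi (\<lambda>z. X (snd z) (fst z)) (\<lambda>z. (G (fst z), snd z)) = (\<Sum>t<n. C.mi (X t) G) / real n"
proof -
  have prb: "T.prb (\<lambda>z. X (snd z) (fst z)) x = p x" for x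
    unfolding prb_time using law n by simp
  have "T.ent (\<lambda>z. X (snd z) (fst z)) = - (\<Sum>x\<in>UNIV. p x * log 2 (p x))"
    using T.ent_sum[of UNIV "\<lambda>z. X (snd z) (fst z)"] by (simp add: prb)
  moreover have "C.ent (X t) = - (\<Sum>x\<in>UNIV. p x * log 2 (p x))" if "t < n" for t
    using C.ent_sum[of UNIV "X t"] law that by simp
  moreover have "T.ent (\<lambda>z. (X (snd z) (fst z), G (fst z), snd z)) =
      T.ent (\<lambda>z. ((X (snd z) (fst z), G (fst z)), snd z))"
    by (rule T.ent_cong) auto
  ultimately show ?thesis
    using ent_time[of "\<lambda>t. G"] ent_time[of "\<lambda>t w. (X t w, G w)"] n
    by (simp add: T.mi_def C.mi_def sum.distrib sum_subtractf field_simps)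
qed

text \<open>In the law of \<open>(V, V', Y1, Y2, Y12)\<close> below, \<open>V'\<close> comes from the resampled block.\<close>

lemma block_law:
  fixes c1 c2 :: "nat \<Rightarrow> 'y::finite list" and c12 :: "nat \<Rightarrow> nat \<Rightarrow> 'y list"
    and d :: "'x \<Rightarrow> 'y \<Rightarrow> real"
  defines "V \<equiv> \<lambda>(x :: 'x, x' :: 'x, y1 :: 'y, y2 :: 'y, y12 :: 'y). x"
    and "V' \<equiv> \<lambda>(x :: 'x, x' :: 'x, y1 :: 'y, y2 :: 'y, y12 :: 'y). x'"
    and "Y1 \<equiv> \<lambda>(x :: 'x, x' :: 'x, y1 :: 'y, y2 :: 'y, y12 :: 'y). y1"
    and "Y2 \<equiv> \<lambda>(x :: 'x, x' :: 'x, y1 :: 'y, y2 :: 'y, y12 :: 'y). y2"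
    and "Y12 \<equiv> \<lambda>(x :: 'x, x' :: 'x, y1 :: 'y, y2 :: 'y, y12 :: 'y). y12"
  assumes M: "\<And>u. length u = n \<Longrightarrow> f1 u < M1" "\<And>u. length u = n \<Longrightarrow> f2 u < M2"
  shows "\<exists>L. fin_prob UNIV L \<and>
    (\<forall>x. fin_prob.prb UNIV L V x = p x) \<and>
    (\<forall>s. fin_prob.prb UNIV L (\<lambda>w. (V' w, Y1 w)) s = fin_prob.prb UNIV L (\<lambda>w. (V w, Y1 w)) s) \<and>
    fin_prob.mi UNIV L V' Y1 + fin_prob.cmi UNIV L V' Y2 Y1 \<le> log 2 (real M1) / real n \<and>
    fin_prob.mi UNIV L V (\<lambda>w. (Y1 w, Y2 w, Y12 w)) + fin_prob.mi UNIV L V' Y2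
      \<le> log 2 (real M1) / real n + log 2 (real M2) / real n \<and>
    (\<Sum>w\<in>UNIV. L w * d (V w) (Y1 w)) = avg_dist p d n (\<lambda>u. c1 (f1 u)) \<and>
    (\<Sum>w\<in>UNIV. L w * d (V w) (Y2 w)) = avg_dist p d n (\<lambda>u. c2 (f2 u)) \<and>
    (\<Sum>w\<in>UNIV. L w * d (V w) (Y12 w)) = avg_dist p d n (\<lambda>u. c12 (f1 u) (f2 u))"
proof -
  define W1 where "W1 = (\<lambda>w :: 'x list \<times> 'x list. f1 (fst w))"
  define W2 where "W2 = (\<lambda>w :: 'x list \<times> 'x list. f2 (fst w))"
  define Z where "Z = (\<lambda>(w :: 'x list \<times> 'x list, t).
    (fst w ! t, snd w ! t, c1 (W1 w) ! t, c2 (W2 w) ! t, c12 (W1 w) (W2 w) ! t))"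
  let ?T = "(blk \<times> blk) \<times> {..<n}"
  define L where "L = T.prb Z"
  note im = T.fin_prob_axioms finite subset_UNIV
  interpret L: fin_prob UNIV L unfolding L_def by (rule fin_prob_image[OF im])
  have ZV: "V (Z z) = fst (fst z) ! snd z" "V' (Z z) = snd (fst z) ! snd z"
    "Y1 (Z z) = c1 (W1 (fst z)) ! snd z" "Y2 (Z z) = c2 (W2 (fst z)) ! snd z"
    "Y12 (Z z) = c12 (W1 (fst z)) (W2 (fst z)) ! snd z" for z
    by (auto simp: Z_def V_def V'_def Y1_def Y2_def Y12_def case_prod_beta)
  have lawU: "C.prb (\<lambda>w. fst w ! t) x = p x" and lawV: "C.prb (\<lambda>w. snd w ! t) x = p x" if "t < n" for t x
    using prb_fst[of "\<lambda>u. u ! t" x] prb_swap[of "\<lambda>u i. u ! t" x] prb_nth[OF that, of x] by simp_all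
  have prbX: "L.prb V x = p x" for x
  proof -
    have "L.prb V x = T.prb (\<lambda>z. fst (fst z) ! snd z) x"
      unfolding L_def prb_image[OF im] ZV ..
    also have "\<dots> = p x" using prb_time[of "\<lambda>t w. fst w ! t" x] lawU n by simp
    finally show ?thesis .
  qed
  have same: "L.prb (\<lambda>w. (V' w, Y1 w)) s = L.prb (\<lambda>w. (V w, Y1 w)) s" for s
  proof -
    have "L.prb (\<lambda>w. (V' w, Y1 w)) s = T.prb (\<lambda>z. (snd (fst z) ! snd z, c1 (W1 (fst z)) ! snd z)) s"
      unfolding L_def prb_image[OF im] ZV ..
    also have "\<dots> = (\<Sum>t<n. C.prb (\<lambda>w. (snd w ! t, c1 (W1 w) ! t)) s) / real n" by (rule prb_time)
    also have "\<dots> = (\<Sum>t<n. C.prb (\<lambda>w. (fst w ! t, c1 (W1 w) ! t)) s) / real n"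
      unfolding W1_def using prb_swap[of "\<lambda>v i. (v ! t, c1 i ! t)" s for t] by simp
    also have "\<dots> = T.prb (\<lambda>z. (fst (fst z) ! snd z, c1 (W1 (fst z)) ! snd z)) s"
      by (rule prb_time[symmetric])
    also have "\<dots> = L.prb (\<lambda>w. (V w, Y1 w)) s"
      unfolding L_def prb_image[OF im] ZV ..
    finally show ?thesis .
  qed
  have cm0: "C.cmi (\<lambda>w. snd w ! t) W2 W1 = 0" "C.cmi snd W2 W1 = 0" for t
    unfolding W1_def W2_def by (rule cmi_resampled; simp)+
  have H1: "C.ent W1 \<le> log 2 (real M1)" "C.ent W2 \<le> log 2 (real M2)"
  proof -
    have "W1 ` (blk \<times> blk) \<subseteq> {..<M1}" "W2 ` (blk \<times> blk) \<subseteq> {..<M2}"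
      using M by (auto simp: W1_def W2_def nlists_def)
    then show "C.ent W1 \<le> log 2 (real M1)" "C.ent W2 \<le> log 2 (real M2)"
      by (auto intro: C.ent_le_log_card)
  qed
  \<comment> \<open>The resampled letters depend on W2 only through W1, so even the pair (Y1, Y2)
    tells about V' no more per letter than the entropy of W1, that is, the first rate alone.\<close>
  have "L.mi V' Y1 + L.cmi V' Y2 Y1 = L.mi V' (\<lambda>w. (Y2 w, Y1 w))" by (rule L.mi_chain[symmetric])
  also have "\<dots> = T.mi (\<lambda>z. snd (fst z) ! snd z) (\<lambda>z. (c2 (W2 (fst z)) ! snd z, c1 (W1 (fst z)) ! snd z))"
    unfolding L_def mi_image[OF im] ZV ..
  also have "\<dots> \<le> T.mi (\<lambda>z. snd (fst z) ! snd z) (\<lambda>z. ((W2 (fst z), W1 (fst z)), snd z))"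
    by (rule T.mi_mono) auto
  also have "\<dots> = (\<Sum>t<n. C.mi (\<lambda>w. snd w ! t) (\<lambda>w. (W2 w, W1 w))) / real n"
    using lawV by (rule mi_time)
  also have "\<dots> = (\<Sum>t<n. C.mi (\<lambda>w. snd w ! t) W1) / real n"
    unfolding C.mi_chain by (simp add: cm0)
  also have "\<dots> \<le> log 2 (real M1) / real n"
    using sum_mi_snd_le[of W1] C.mi_le_ent[of snd W1] H1(1) by (intro divide_right_mono) linarith+
  finally have R1: "L.mi V' Y1 + L.cmi V' Y2 Y1 \<le> log 2 (real M1) / real n" .
  \<comment> \<open>The bound by the joint entropy H(W1, W2), instead of the sum of the two, leaves
    a gap of exactly I(W1; W2).\<close>
  have "L.mi V (\<lambda>w. (Y1 w, Y2 w, Y12 w)) =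
     T.mi (\<lambda>z. fst (fst z) ! snd z) (\<lambda>z. (c1 (W1 (fst z)) ! snd z, c2 (W2 (fst z)) ! snd z, c12 (W1 (fst z)) (W2 (fst z)) ! snd z))"
    unfolding L_def mi_image[OF im] ZV ..
  also have "\<dots> \<le> T.mi (\<lambda>z. fst (fst z) ! snd z) (\<lambda>z. ((W1 (fst z), W2 (fst z)), snd z))"
    by (rule T.mi_mono) auto
  also have "\<dots> = (\<Sum>t<n. C.mi (\<lambda>w. fst w ! t) (\<lambda>w. (W1 w, W2 w))) / real n"
    using lawU by (rule mi_time)
  also have "\<dots> \<le> C.ent (\<lambda>w. (W1 w, W2 w)) / real n"
    using sum_mi_fst_le[of "\<lambda>w. (W1 w, W2 w)"] C.mi_le_ent[of fst "\<lambda>w. (W1 w, W2 w)"]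
    by (intro divide_right_mono) linarith+
  finally have S1: "L.mi V (\<lambda>w. (Y1 w, Y2 w, Y12 w)) \<le> C.ent (\<lambda>w. (W1 w, W2 w)) / real n" .
  \<comment> \<open>This information fits into that gap: the resampled block is i.i.d., so its
    letterwise informations about W2 add up to at most I(block; W2), and the Markov chain bounds
    this by I(W1; W2).\<close>
  have "L.mi V' Y2 = T.mi (\<lambda>z. snd (fst z) ! snd z) (\<lambda>z. c2 (W2 (fst z)) ! snd z)"
    unfolding L_def mi_image[OF im] ZV ..
  also have "\<dots> \<le> T.mi (\<lambda>z. snd (fst z) ! snd z) (\<lambda>z. (W2 (fst z), snd z))"
    by (rule T.mi_mono) auto
  also have "\<dots> = (\<Sum>t<n. C.mi (\<lambda>w. snd w ! t) W2) / real n"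
    using lawV by (rule mi_time)
  also have "\<dots> \<le> C.mi W1 W2 / real n"
  proof -
    have "C.mi snd W2 = C.mi W2 snd" by (rule C.mi_commute)
    also have "\<dots> \<le> C.mi W2 (\<lambda>w. (snd w, W1 w))" by (rule C.mi_mono) auto
    also have "\<dots> = C.mi W2 W1 + C.cmi W2 snd W1" by (rule C.mi_chain)
    also have "\<dots> = C.mi W1 W2" using cm0(2) C.mi_commute[of W2 W1] C.cmi_commute[of W2 snd W1] by simp
    finally show ?thesis using sum_mi_snd_le[of W2] by (intro divide_right_mono) linarith+
  qed
  finally have "L.mi V (\<lambda>w. (Y1 w, Y2 w, Y12 w)) + L.mi V' Y2 \<le>
      C.ent (\<lambda>w. (W1 w, W2 w)) / real n + C.mi W1 W2 / real n" using S1 by linarith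
  also have "\<dots> = (C.ent W1 + C.ent W2) / real n" by (simp add: C.mi_def add_divide_distrib diff_divide_distrib)
  also have "\<dots> \<le> (log 2 (real M1) + log 2 (real M2)) / real n"
    using H1 by (intro divide_right_mono) linarith+
  finally have R2: "L.mi V (\<lambda>w. (Y1 w, Y2 w, Y12 w)) + L.mi V' Y2 \<le> log 2 (real M1) / real n + log 2 (real M2) / real n"
    by (simp add: add_divide_distrib)
  have E: "(\<Sum>w\<in>UNIV. L w * G w) = avg_dist p d n F"
    if G: "\<And>w t. G (Z (w, t)) = d (fst w ! t) (F (fst w) ! t)" for G F
  proof -
    have "(\<Sum>w\<in>UNIV. L w * G w) = (\<Sum>z\<in>?T. PT z * G (Z z))"
      unfolding L_def by (rule T.sum_prb) auto
    also have "\<dots> = (\<Sum>t<n. (\<Sum>u\<in>blk. wprod p u * d (u ! t) (F u ! t))) / real n"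
      unfolding sum_PT G using sum_fst[of "\<lambda>u. d (u ! t) (F u ! t)" for t] by simp
    also have "\<dots> = (\<Sum>u\<in>blk. \<Sum>t<n. wprod p u * d (u ! t) (F u ! t)) / real n"
      by (subst sum.swap) simp
    also have "\<dots> = avg_dist p d n F"
      unfolding avg_dist_def block_prob_def nlists_UNIV by (simp add: sum_divide_distrib sum_distrib_left)
    finally show ?thesis .
  qed
  show ?thesis
    using L.fin_prob_axioms prbX same R1 R2
      E[of "\<lambda>w. d (V w) (Y1 w)" "\<lambda>u. c1 (f1 u)"] E[of "\<lambda>w. d (V w) (Y2 w)" "\<lambda>u. c2 (f2 u)"]
      E[of "\<lambda>w. d (V w) (Y12 w)" "\<lambda>u. c12 (f1 u) (f2 u)"]
    by (intro exI[of _ L]) (simp add: ZV W1_def W2_def)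
qed

end

section \<open>Limits of laws\<close>

text \<open>Compactness of the probability simplex, by viewing laws on a finite type as bounded
  vectors.\<close>

lemma sequence_of_laws_convergent:
  fixes L :: "nat \<Rightarrow> 'k::finite \<Rightarrow> real"
  assumes "\<And>n. fin_prob UNIV (L n)"
  shows "\<exists>L' r. strict_mono r \<and> fin_prob UNIV L' \<and> (\<forall>z. (\<lambda>n. L (r n) z) \<longlonglongrightarrow> L' z)"
proof -
  have nn: "0 \<le> L n z" "L n z \<le> 1" "(\<Sum>z\<in>UNIV. L n z) = 1" for n z
  proof -
    interpret fin_prob UNIV "L n" by fact
    show "0 \<le> L n z" by (rule nonneg) simp
    show "(\<Sum>z\<in>UNIV. L n z) = 1" by (rule sum1)
    show "L n z \<le> 1" unfolding sum1[symmetric] using nonneg by (intro member_le_sum) auto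
  qed
  define x where "x n = (\<chi> z. L n z)" for n
  have "norm (x n) \<le> real CARD('k)" for n
  proof -
    have "norm (x n) \<le> (\<Sum>z\<in>UNIV. \<bar>x n $ z\<bar>)" by (rule norm_le_l1_cart)
    also have "\<dots> \<le> (\<Sum>z\<in>(UNIV :: 'k set). 1)" using nn by (intro sum_mono) (simp add: x_def)
    finally show ?thesis by simp
  qed
  then have "bounded (range x)" by (auto simp: bounded_iff)
  then obtain l r where r: "strict_mono r" and l: "(x \<circ> r) \<longlonglongrightarrow> l"
    using bounded_imp_convergent_subsequence by blast
  have conv: "(\<lambda>n. L (r n) z) \<longlonglongrightarrow> l $ z" for z
    using tendsto_vec_nth[OF l, of z] by (simp add: x_def o_def)
  have "0 \<le> l $ z" for z by (rule LIMSEQ_le_const[OF conv]) (use nn(1) in auto)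
  moreover have "(\<Sum>z\<in>UNIV. l $ z) = 1"
  proof (rule LIMSEQ_unique)
    show "(\<lambda>n. \<Sum>z\<in>UNIV. L (r n) z) \<longlonglongrightarrow> (\<Sum>z\<in>UNIV. l $ z)" by (intro tendsto_sum conv)
    show "(\<lambda>n. \<Sum>z\<in>UNIV. L (r n) z) \<longlonglongrightarrow> 1" by (simp add: nn)
  qed
  ultimately have "fin_prob UNIV (\<lambda>z. l $ z)" by unfold_locales auto
  then show ?thesis using r conv by blast
qed

text \<open>From ln z \<le> z - 1 at z = 1 / sqrt u. It supplies continuity of u ln u at 0, needed
  because probabilities may tend to zero in the limit.\<close>

lemma mult_log_bound:
  fixes u :: real
  assumes "0 \<le> u" "u \<le> 1"
  shows "\<bar>u * ln u\<bar> \<le> 2 * sqrt u"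
proof (cases "u = 0")
  case False
  then have u: "0 < u" using assms by simp
  have "ln (1 / sqrt u) \<le> 1 / sqrt u - 1" using u by (intro ln_le_minus_one) auto
  moreover have "ln (1 / sqrt u) = - ln u / 2" using u by (simp add: ln_div ln_sqrt)
  ultimately have "- ln u \<le> 2 / sqrt u" by simp
  then have "u * (- ln u) \<le> u * (2 / sqrt u)" using u by (intro mult_left_mono) auto
  also have "\<dots> = 2 * sqrt u" using u by (simp add: real_div_sqrt field_simps)
  finally have "u * (- ln u) \<le> 2 * sqrt u" .
  moreover have "u * ln u \<le> 0" using u assms by (intro mult_nonneg_nonpos) auto
  ultimately show ?thesis by simp
qed simp

lemma tendsto_mult_log:
  assumes "u \<longlonglongrightarrow> l" "\<And>n. 0 \<le> u n"
  shows "(\<lambda>n. u n * log 2 (u n)) \<longlonglongrightarrow> l * log 2 l"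
proof (cases "l = 0")
  case True
  have "(\<lambda>n. 2 * sqrt (u n)) \<longlonglongrightarrow> 2 * sqrt 0"
    using assms(1) True by (intro tendsto_intros) auto
  then have lim: "(\<lambda>n. 2 * sqrt (u n)) \<longlonglongrightarrow> 0" by simp
  have "\<forall>\<^sub>F n in sequentially. u n < 1" using assms(1) True by (auto intro: order_tendstoD)
  then have "\<forall>\<^sub>F n in sequentially. norm (u n * ln (u n)) \<le> 2 * sqrt (u n)"
    by eventually_elim (use assms(2) mult_log_bound in auto)
  then have "(\<lambda>n. u n * ln (u n)) \<longlonglongrightarrow> 0" by (rule Lim_null_comparison) (rule lim)
  then have "(\<lambda>n. u n * ln (u n) / ln 2) \<longlonglongrightarrow> 0 / ln 2" by (intro tendsto_divide tendsto_const) auto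
  then show ?thesis using True by (simp add: log_def)
next
  case False
  moreover have "0 \<le> l" by (rule LIMSEQ_le_const[OF assms(1)]) (use assms(2) in auto)
  ultimately have "0 < l" by simp
  then show ?thesis unfolding log_def using assms(1) by (intro tendsto_intros) auto
qed

lemma tendsto_prb:
  assumes "\<And>n. fin_prob UNIV (L n)" "fin_prob UNIV L'" "\<And>z :: 'k::finite. (\<lambda>n. L n z) \<longlonglongrightarrow> L' z"
  shows "(\<lambda>n. fin_prob.prb UNIV (L n) f v) \<longlonglongrightarrow> fin_prob.prb UNIV L' f v"
  unfolding fin_prob.prb_def[OF assms(1)] fin_prob.prb_def[OF assms(2)]
  by (intro tendsto_sum assms)

lemma tendsto_ent:
  assumes "\<And>n. fin_prob UNIV (L n)" "fin_prob UNIV L'" "\<And>z :: 'k::finite. (\<lambda>n. L n z) \<longlonglongrightarrow> L' z"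
  shows "(\<lambda>n. fin_prob.ent UNIV (L n) f) \<longlonglongrightarrow> fin_prob.ent UNIV L' f"
proof -
  have e: "fin_prob.ent UNIV L f = - (\<Sum>v\<in>range f. fin_prob.prb UNIV L f v * log 2 (fin_prob.prb UNIV L f v))"
    if "fin_prob UNIV L" for L
    using fin_prob.ent_sum[OF that, of "range f" f] by simp
  show ?thesis unfolding e[OF assms(1)] e[OF assms(2)]
    by (intro tendsto_minus tendsto_sum tendsto_mult_log tendsto_prb assms fin_prob.prb_nonneg)
qed

lemma tendsto_mi:
  assumes "\<And>n. fin_prob UNIV (L n)" "fin_prob UNIV L'" "\<And>z :: 'k::finite. (\<lambda>n. L n z) \<longlonglongrightarrow> L' z"
  shows "(\<lambda>n. fin_prob.mi UNIV (L n) f g) \<longlonglongrightarrow> fin_prob.mi UNIV L' f g"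
  unfolding fin_prob.mi_def[OF assms(1)] fin_prob.mi_def[OF assms(2)]
  by (intro tendsto_intros tendsto_ent assms)

lemma tendsto_cmi:
  assumes "\<And>n. fin_prob UNIV (L n)" "fin_prob UNIV L'" "\<And>z :: 'k::finite. (\<lambda>n. L n z) \<longlonglongrightarrow> L' z"
  shows "(\<lambda>n. fin_prob.cmi UNIV (L n) f g h) \<longlonglongrightarrow> fin_prob.cmi UNIV L' f g h"
  unfolding fin_prob.cmi_def[OF assms(1)] fin_prob.cmi_def[OF assms(2)]
  by (intro tendsto_intros tendsto_ent assms)

section \<open>Elementary properties of the rate regions\<close>

lemma achievable_MD_code:
  assumes "achievable_MD p d R1 R2 D1 D2 D12" "0 < \<epsilon>"
  shows "\<exists>n>0. md_code p d n (R1 + \<epsilon>) (R2 + \<epsilon>) (D1 + ereal \<epsilon>) (D2 + ereal \<epsilon>) (D12 + ereal \<epsilon>)"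
proof -
  obtain N where "\<forall>n\<ge>N. md_code p d n (R1 + \<epsilon>) (R2 + \<epsilon>) (D1 + ereal \<epsilon>) (D2 + ereal \<epsilon>) (D12 + ereal \<epsilon>)"
    using assms unfolding achievable_MD_eq by blast
  then show ?thesis by (intro exI[of _ "Suc N"]) auto
qed

lemma md_code_mono:
  assumes "md_code p d n R1 R2 D1 D2 D12" "R1 \<le> R1'" "R2 \<le> R2'" "D1 \<le> D1'" "D2 \<le> D2'" "D12 \<le> D12'"
  shows "md_code p d n R1' R2' D1' D2' D12'"
  using assms(1)
proof (rule md_codeE)
  fix M1 M2 :: nat and f1 f2 g1 g2 g12
  assume "\<And>xs. length xs = n \<Longrightarrow> f1 xs < M1" "\<And>xs. length xs = n \<Longrightarrow> f2 xs < M2"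
    "\<And>i. length (g1 i) = n" "\<And>j. length (g2 j) = n" "\<And>i j. length (g12 i j) = n"
    "log 2 (real M1) / real n \<le> R1" "log 2 (real M2) / real n \<le> R2"
    "ereal (avg_dist p d n (\<lambda>xs. g1 (f1 xs))) \<le> D1"
    "ereal (avg_dist p d n (\<lambda>xs. g2 (f2 xs))) \<le> D2"
    "ereal (avg_dist p d n (\<lambda>xs. g12 (f1 xs) (f2 xs))) \<le> D12"
  then show ?thesis
    by (intro md_codeI[where ?f1.0 = f1 and ?f2.0 = f2 and ?g1.0 = g1 and ?g2.0 = g2 and ?g12.0 = g12 and ?M1.0 = M1 and ?M2.0 = M2])
      (use assms(2-) in \<open>auto intro: order_trans\<close>)
qed

text \<open>Achievability is closed in R2 and D2: half of \<epsilon> pays for the approximating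
  point, the other half for its code. This turns the infima over R2 and over D2 into minima.\<close>

lemma achievable_MD_limit:
  assumes "\<And>\<delta>. 0 < \<delta> \<Longrightarrow> \<exists>R2' D2'. R2' \<le> R2 + \<delta> \<and> D2' \<le> D2 + ereal \<delta> \<and>
    achievable_MD p d R1 R2' D1 D2' D12"
  shows "achievable_MD p d R1 R2 D1 D2 D12"
  unfolding achievable_MD_eq
proof (intro allI impI)
  fix \<epsilon> :: real assume "0 < \<epsilon>"
  then have h: "0 < \<epsilon> / 2" by simp
  obtain R2' D2' where R: "R2' \<le> R2 + \<epsilon> / 2" and D: "D2' \<le> D2 + ereal (\<epsilon> / 2)"
    and a: "achievable_MD p d R1 R2' D1 D2' D12"
    using assms[OF h] by blast
  have "D2' + ereal (\<epsilon> / 2) \<le> D2 + ereal (\<epsilon> / 2) + ereal (\<epsilon> / 2)" using D by (rule add_right_mono)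
  also have "\<dots> = D2 + ereal \<epsilon>" by (simp add: add.assoc)
  finally have D': "D2' + ereal (\<epsilon> / 2) \<le> D2 + ereal \<epsilon>" .
  obtain N where "\<And>n. n \<ge> N \<Longrightarrow> md_code p d n (R1 + \<epsilon> / 2) (R2' + \<epsilon> / 2) (D1 + ereal (\<epsilon> / 2)) (D2' + ereal (\<epsilon> / 2)) (D12 + ereal (\<epsilon> / 2))"
    using a h unfolding achievable_MD_eq by blast
  then have "md_code p d n (R1 + \<epsilon>) (R2 + \<epsilon>) (D1 + ereal \<epsilon>) (D2 + ereal \<epsilon>) (D12 + ereal \<epsilon>)" if "n \<ge> N" for n
    by (rule md_code_mono) (use that R D' \<open>0 < \<epsilon>\<close> in \<open>auto intro: add_left_mono\<close>)
  then show "\<exists>N. \<forall>n\<ge>N. md_code p d n (R1 + \<epsilon>) (R2 + \<epsilon>) (D1 + ereal \<epsilon>) (D2 + ereal \<epsilon>) (D12 + ereal \<epsilon>)"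
    by blast
qed

lemma achievable_MD_mono:
  assumes "achievable_MD p d R1 R2 D1 D2 D12" "D1 \<le> D1'" "D2 \<le> D2'" "D12 \<le> D12'"
  shows "achievable_MD p d R1 R2 D1' D2' D12'"
  unfolding achievable_MD_eq
proof (intro allI impI)
  fix \<epsilon> :: real assume "0 < \<epsilon>"
  then obtain N where "\<And>n. n \<ge> N \<Longrightarrow> md_code p d n (R1 + \<epsilon>) (R2 + \<epsilon>) (D1 + ereal \<epsilon>) (D2 + ereal \<epsilon>) (D12 + ereal \<epsilon>)"
    using assms(1) unfolding achievable_MD_eq by blast
  then have "md_code p d n (R1 + \<epsilon>) (R2 + \<epsilon>) (D1' + ereal \<epsilon>) (D2' + ereal \<epsilon>) (D12' + ereal \<epsilon>)" if "n \<ge> N" for n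
    by (rule md_code_mono) (use that assms in \<open>auto intro: add_right_mono\<close>)
  then show "\<exists>N. \<forall>n\<ge>N. md_code p d n (R1 + \<epsilon>) (R2 + \<epsilon>) (D1' + ereal \<epsilon>) (D2' + ereal \<epsilon>) (D12' + ereal \<epsilon>)"
    by blast
qed

lemma avg_dist_nonneg:
  assumes "is_pmf p" "\<And>x y. 0 \<le> d x y"
  shows "0 \<le> avg_dist p d n F"
  unfolding avg_dist_def block_prob_def using assms
  by (intro sum_nonneg mult_nonneg_nonneg divide_nonneg_nonneg wprod_nonneg) (auto simp: is_pmf_def)

lemma achievable_MD_D2_nonneg:
  assumes "achievable_MD p d R1 R2 D1 (ereal D2) D12" "is_pmf p" "\<And>x y. 0 \<le> d x y"
  shows "0 \<le> D2"
proof (rule field_le_epsilon)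
  fix \<epsilon> :: real assume "0 < \<epsilon>"
  then obtain n where "md_code p d n (R1 + \<epsilon>) (R2 + \<epsilon>) (D1 + ereal \<epsilon>) (ereal D2 + ereal \<epsilon>) (D12 + ereal \<epsilon>)"
    using achievable_MD_code[OF assms(1)] by blast
  then obtain F where "ereal (avg_dist p d n F) \<le> ereal D2 + ereal \<epsilon>"
    by (rule md_codeE)
  moreover have "0 \<le> avg_dist p d n F" by (rule avg_dist_nonneg) (rule assms)+
  ultimately show "0 \<le> D2 + \<epsilon>" by simp
qed

text \<open>A description takes at least one value, so M2 \<ge> 1. This bounds the set in
  \<open>rate_SC\<close> from below.\<close>

lemma achievable_MD_R2_nonneg:
  assumes "achievable_MD p d R1 R2 D1 D2 D12"
  shows "0 \<le> R2"
proof (rule field_le_epsilon)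
  fix \<epsilon> :: real assume "0 < \<epsilon>"
  then obtain n where "md_code p d n (R1 + \<epsilon>) (R2 + \<epsilon>) (D1 + ereal \<epsilon>) (D2 + ereal \<epsilon>) (D12 + ereal \<epsilon>)"
    using achievable_MD_code[OF assms] by blast
  then obtain M2 and f2 :: "'a list \<Rightarrow> nat" where *: "\<And>xs. length xs = n \<Longrightarrow> f2 xs < M2"
    "log 2 (real M2) / real n \<le> R2 + \<epsilon>"
    unfolding md_code_def by blast
  have "f2 (replicate n undefined) < M2" using *(1) by simp
  then have "1 \<le> M2" by simp
  then have "0 \<le> log 2 (real M2) / real n" by (intro divide_nonneg_nonneg) auto
  then show "0 \<le> R2 + \<epsilon>" using *(2) by linarith
qed

lemma rate_SC_bdd: "bdd_below {R1 + R2 | R2. achievable_SC p d R1 R2 D1 D12}"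
  by (rule bdd_belowI[of _ R1]) (auto simp: achievable_SC_def dest: achievable_MD_R2_nonneg)

lemma rate_SC_le:
  assumes "achievable_MD p d R1 R2 (ereal D1) D2 (ereal D12)"
  shows "rate_SC p d R1 D1 D12 \<le> R1 + R2"
proof -
  have "achievable_SC p d R1 R2 D1 D12"
    unfolding achievable_SC_def using assms by (rule achievable_MD_mono) auto
  then show ?thesis unfolding rate_SC_def by (intro cInf_lower rate_SC_bdd) blast
qed

text \<open>The hypothesis makes the set of sum rates nonempty, so that \<open>Inf\<close> is a
  genuine infimum; closedness in R2 makes it a minimum.\<close>

lemma rate_SC_attained:
  assumes "achievable_MD p d R1 R2 (ereal D1) D2 (ereal D12)"
  shows "achievable_SC p d R1 (rate_SC p d R1 D1 D12 - R1) D1 D12"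
  unfolding achievable_SC_def
proof (rule achievable_MD_limit)
  let ?S = "{R1 + R2 | R2. achievable_SC p d R1 R2 D1 D12}"
  fix \<delta> :: real assume "0 < \<delta>"
  have "achievable_SC p d R1 R2 D1 D12"
    unfolding achievable_SC_def using assms by (rule achievable_MD_mono) auto
  then have ne: "?S \<noteq> {}" by blast
  have lt: "Inf ?S < rate_SC p d R1 D1 D12 + \<delta>" using \<open>0 < \<delta>\<close> by (simp add: rate_SC_def)
  obtain s where "s \<in> ?S" "s < rate_SC p d R1 D1 D12 + \<delta>"
    using cInf_lessD[OF ne lt] by blast
  then show "\<exists>R2' D2'. R2' \<le> rate_SC p d R1 D1 D12 - R1 + \<delta> \<and> D2' \<le> \<infinity> + ereal \<delta> \<and>
    achievable_MD p d R1 R2' (ereal D1) D2' (ereal D12)"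
    by (intro exI[of _ "s - R1"] exI[of _ \<infinity>]) (auto simp: achievable_SC_def)
qed

text \<open>No decoder exceeds the maximal distortion, so the absence of a constraint can be
  replaced by a finite one. This brings scalable codes into the range of real D2.\<close>

lemma achievable_MD_bounded_distortion:
  fixes p :: "'x::finite \<Rightarrow> real"
  assumes "achievable_MD p d R1 R2 D1 \<infinity> D12" and p: "is_pmf p"
    and d: "\<And>x y. 0 \<le> d x y" "\<And>x y. d x y \<le> dm"
  shows "achievable_MD p d R1 R2 D1 (ereal dm) D12"
proof -
  have dm: "0 \<le> dm" using d order_trans by blast
  have "avg_dist p d n F \<le> dm" for n F
  proof (cases "n = 0")
    case True
    then show ?thesis using dm by (simp add: avg_dist_def)
  next
    case False
    then have "avg_dist p d n F \<le> 0 + dm * 1"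
      by (intro avg_dist_le[where C = "\<lambda>_. False"] p d) (use p in \<open>auto simp: sum_wprod is_pmf_def\<close>)
    then show ?thesis by simp
  qed
  then have e: "ereal (avg_dist p d n F) \<le> ereal dm + ereal \<epsilon>" if "0 < \<epsilon>" for n F \<epsilon>
    using that by (simp add: add_increasing2)
  show ?thesis
    unfolding achievable_MD_eq
  proof (intro allI impI)
    fix \<epsilon> :: real assume \<epsilon>: "0 < \<epsilon>"
    then obtain N where N: "\<And>n. n \<ge> N \<Longrightarrow> md_code p d n (R1 + \<epsilon>) (R2 + \<epsilon>) (D1 + ereal \<epsilon>) (\<infinity> + ereal \<epsilon>) (D12 + ereal \<epsilon>)"
      using assms(1) unfolding achievable_MD_eq by blast
    have "md_code p d n (R1 + \<epsilon>) (R2 + \<epsilon>) (D1 + ereal \<epsilon>) (ereal dm + ereal \<epsilon>) (D12 + ereal \<epsilon>)" if "n \<ge> N" for n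
      using N[OF that] by (rule md_codeE) (rule md_codeI, assumption+, rule e[OF \<epsilon>])
    then show "\<exists>N. \<forall>n\<ge>N. md_code p d n (R1 + \<epsilon>) (R2 + \<epsilon>) (D1 + ereal \<epsilon>) (ereal dm + ereal \<epsilon>) (D12 + ereal \<epsilon>)"
      by blast
  qed
qed

section \<open>Test channels, their joint laws and the rate-distortion minimum\<close>

lemma channel_of_law:
  fixes L :: "'k::finite \<Rightarrow> real" and V :: "'k \<Rightarrow> 'x::finite" and Y :: "'k \<Rightarrow> 'y::finite"
  assumes fp: "fin_prob UNIV L" and V: "\<And>x. fin_prob.prb UNIV L V x = p x"
  shows "\<exists>c. test_channel c \<and> (\<forall>x y. p x * c x y = fin_prob.prb UNIV L (\<lambda>w. (V w, Y w)) (x, y)) \<and>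
    exp_dist p d c = (\<Sum>w\<in>UNIV. L w * d (V w) (Y w)) \<and>
    mutual_info (\<lambda>x y. p x * c x y) UNIV UNIV = fin_prob.mi UNIV L V Y"
proof -
  interpret fin_prob UNIV L by fact
  let ?J = "\<lambda>x y. prb (\<lambda>w. (V w, Y w)) (x, y)"
  \<comment> \<open>Source letters of probability zero receive the output marginal, which keeps
    every row a probability vector.\<close>
  define c where "c x y = (if p x > 0 then ?J x y / p x else prb Y y)" for x y
  have m: "(\<Sum>y\<in>UNIV. ?J x y) = p x" for x using prb_marginal[of UNIV Y V x] V by simp
  have pc: "p x * c x y = ?J x y" for x y
  proof (cases "p x > 0")
    case False
    then have "p x = 0" using V[of x] prb_nonneg[of V x] by simp
    moreover have "?J x y \<le> prb V x" by (rule prb_mono) auto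
    ultimately show ?thesis using V[of x] prb_nonneg[of "\<lambda>w. (V w, Y w)" "(x, y)"] by simp
  qed (simp add: c_def)
  have "test_channel c" unfolding test_channel_def
  proof (intro conjI allI)
    show "0 \<le> c x y" for x y by (auto simp: c_def prb_nonneg)
    show "(\<Sum>y\<in>UNIV. c x y) = 1" for x
      using sum_prb_1[of UNIV Y] by (cases "p x > 0") (simp_all add: c_def sum_divide_distrib[symmetric] m)
  qed
  moreover have "exp_dist p d c = (\<Sum>w\<in>UNIV. L w * d (V w) (Y w))"
  proof -
    have "exp_dist p d c = (\<Sum>v\<in>UNIV. prb (\<lambda>w. (V w, Y w)) v * (\<lambda>(x, y). d x y) v)"
      unfolding exp_dist_def pc UNIV_Times_UNIV[symmetric] sum.cartesian_product' by simp
    also have "\<dots> = (\<Sum>w\<in>UNIV. L w * d (V w) (Y w))" by (subst sum_prb) auto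
    finally show ?thesis .
  qed
  moreover have "mutual_info (\<lambda>x y. p x * c x y) UNIV UNIV = mi V Y"
    unfolding pc by (rule mutual_info_eq_mi) auto
  ultimately show ?thesis using pc by blast
qed

lemma law_of_channel:
  fixes p :: "'x::finite \<Rightarrow> real" and c :: "'x \<Rightarrow> 'y::finite \<Rightarrow> real"
  assumes p: "is_pmf p" and c: "test_channel c"
  defines "L \<equiv> \<lambda>(x, y). p x * c x y"
  shows "fin_prob UNIV L" "fin_prob.prb UNIV L fst x = p x"
    "mutual_info (\<lambda>x y. p x * c x y) UNIV UNIV = fin_prob.mi UNIV L fst snd"
    "exp_dist p d c = (\<Sum>w\<in>UNIV. L w * d (fst w) (snd w))"
proof -
  have "sum L UNIV = 1"
    unfolding UNIV_Times_UNIV[symmetric] sum.cartesian_product' L_def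
    using p c by (simp add: sum_distrib_left[symmetric] test_channel_def is_pmf_def)
  then show fp: "fin_prob UNIV L"
    using p c by unfold_locales (auto simp: L_def test_channel_def is_pmf_def)
  interpret fin_prob UNIV L by fact
  have s: "prb (\<lambda>w. (fst w, snd w)) (x, y) = p x * c x y" for x y
    by (simp add: prb_def) (simp add: L_def)
  show "prb fst x = p x"
    using prb_marginal[of UNIV snd fst x] c unfolding s
    by (simp add: sum_distrib_left[symmetric] test_channel_def)
  show "mutual_info (\<lambda>x y. p x * c x y) UNIV UNIV = mi fst snd"
    by (rule mutual_info_eq_mi) (auto simp: s simp del: prod.collapse)
  show "exp_dist p d c = (\<Sum>w\<in>UNIV. L w * d (fst w) (snd w))"
    unfolding UNIV_Times_UNIV[symmetric] sum.cartesian_product' exp_dist_def by (simp add: L_def)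
qed

lemma rate_dist_bdd:
  assumes "is_pmf p"
  shows "bdd_below {mutual_info (\<lambda>x y. p x * c x y) UNIV UNIV | c. test_channel c \<and> exp_dist p d c \<le> D}"
proof (rule bdd_belowI[of _ 0])
  fix s assume "s \<in> {mutual_info (\<lambda>x y. p x * c x y) UNIV UNIV | c. test_channel c \<and> exp_dist p d c \<le> D}"
  then obtain c :: "'a \<Rightarrow> 'b \<Rightarrow> real" where c: "test_channel c" "s = mutual_info (\<lambda>x y. p x * c x y) UNIV UNIV"
    by blast
  show "0 \<le> s"
    unfolding c(2) law_of_channel(3)[OF assms c(1)]
    by (rule fin_prob.mi_nonneg) (rule law_of_channel(1)[OF assms c(1)])
qed

lemma rate_dist_le:
  assumes "is_pmf p" "test_channel c" "exp_dist p d c \<le> D"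
  shows "rate_dist p d D \<le> mutual_info (\<lambda>x y. p x * c x y) UNIV UNIV"
  unfolding rate_dist_def by (rule cInf_lower[OF _ rate_dist_bdd[OF assms(1)]]) (use assms in blast)

text \<open>A limit point of a minimizing sequence. The limit is taken for the joint laws, where all
  functionals involved are continuous and the source marginal persists; a channel is extracted
  afterwards.\<close>

lemma rate_dist_attained:
  fixes p :: "'x::finite \<Rightarrow> real" and d :: "'x \<Rightarrow> 'y::finite \<Rightarrow> real"
  assumes p: "is_pmf p" and ex: "\<exists>c :: 'x \<Rightarrow> 'y \<Rightarrow> real. test_channel c \<and> exp_dist p d c \<le> D"
  shows "\<exists>c. test_channel c \<and> exp_dist p d c \<le> D \<and>
    mutual_info (\<lambda>x y. p x * c x y) UNIV UNIV = rate_dist p d D"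
proof -
  let ?S = "{mutual_info (\<lambda>x y. p x * c x y) UNIV UNIV | c. test_channel c \<and> exp_dist p d c \<le> D}"
  have "?S \<noteq> {}" using ex by blast
  have "\<exists>c. test_channel c \<and> exp_dist p d c \<le> D \<and>
    mutual_info (\<lambda>x y. p x * c x y) UNIV UNIV < rate_dist p d D + inverse (real (Suc m))" for m
  proof -
    have "Inf ?S < rate_dist p d D + inverse (real (Suc m))"
      unfolding rate_dist_def by (simp add: inverse_positive_iff_positive)
    then show ?thesis using cInf_lessD[OF \<open>?S \<noteq> {}\<close>] by blast
  qed
  then obtain c where c: "\<And>m. test_channel (c m)" "\<And>m. exp_dist p d (c m) \<le> D"
    "\<And>m. mutual_info (\<lambda>x y. p x * c m x y) UNIV UNIV < rate_dist p d D + inverse (real (Suc m))"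
    by metis
  define L where "L m = (\<lambda>(x, y). p x * c m x y)" for m
  note L = law_of_channel[OF p c(1), folded L_def]
  obtain L' r where r: "strict_mono r" and L': "fin_prob UNIV L'" and conv: "\<And>z. (\<lambda>m. L (r m) z) \<longlonglongrightarrow> L' z"
    using sequence_of_laws_convergent[of L] L(1) by blast
  have V: "fin_prob.prb UNIV L' fst x = p x" for x
  proof (rule LIMSEQ_unique)
    show "(\<lambda>m. fin_prob.prb UNIV (L (r m)) fst x) \<longlonglongrightarrow> fin_prob.prb UNIV L' fst x"
      by (rule tendsto_prb) (use L L' conv in auto)
    show "(\<lambda>m. fin_prob.prb UNIV (L (r m)) fst x) \<longlonglongrightarrow> p x" by (simp add: L)
  qed
  obtain c' where c': "test_channel c'" "exp_dist p d c' = (\<Sum>w\<in>UNIV. L' w * d (fst w) (snd w))"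
    "mutual_info (\<lambda>x y. p x * c' x y) UNIV UNIV = fin_prob.mi UNIV L' fst snd"
    using channel_of_law[OF L' V] by blast
  have "(\<Sum>w\<in>UNIV. L' w * d (fst w) (snd w)) \<le> D"
  proof (rule LIMSEQ_le_const2)
    show "(\<lambda>m. \<Sum>w\<in>UNIV. L (r m) w * d (fst w) (snd w)) \<longlonglongrightarrow> (\<Sum>w\<in>UNIV. L' w * d (fst w) (snd w))"
      by (intro tendsto_intros conv)
    show "\<exists>N. \<forall>m\<ge>N. (\<Sum>w\<in>UNIV. L (r m) w * d (fst w) (snd w)) \<le> D"
      unfolding L(4)[symmetric] using c(2) by blast
  qed
  moreover have "fin_prob.mi UNIV L' fst snd \<le> rate_dist p d D + 0"
  proof (rule LIMSEQ_le)
    show "(\<lambda>m. fin_prob.mi UNIV (L (r m)) fst snd) \<longlonglongrightarrow> fin_prob.mi UNIV L' fst snd"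
      by (rule tendsto_mi) (use L L' conv in auto)
    show "(\<lambda>m. rate_dist p d D + inverse (real (Suc (r m)))) \<longlonglongrightarrow> rate_dist p d D + 0"
      using LIMSEQ_subseq_LIMSEQ[OF LIMSEQ_inverse_real_of_nat r]
      by (intro tendsto_add tendsto_const) (simp add: o_def)
    show "\<exists>N. \<forall>m\<ge>N. fin_prob.mi UNIV (L (r m)) fst snd \<le> rate_dist p d D + inverse (real (Suc (r m)))"
      unfolding L(3)[symmetric] using c(3) less_imp_le by blast
  qed
  ultimately show ?thesis using c' rate_dist_le[OF p c'(1), of d D] by (intro exI[of _ c']) auto
qed

section \<open>Converse and conclusion\<close>

text \<open>For slack 1/(m+1) a code of some block length gives a law on quintuples of letters, a
  set independent of that length. Along a convergent subsequence the slack disappears from all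
  bounds, while the two identities between laws are preserved. The factor 2 in the sum-rate bound
  collects the slack of both rates.\<close>

lemma converse_law:
  fixes p :: "'x::finite \<Rightarrow> real" and d :: "'x \<Rightarrow> 'y::finite \<Rightarrow> real"
  defines "V \<equiv> \<lambda>(x :: 'x, x' :: 'x, y1 :: 'y, y2 :: 'y, y12 :: 'y). x"
    and "V' \<equiv> \<lambda>(x :: 'x, x' :: 'x, y1 :: 'y, y2 :: 'y, y12 :: 'y). x'"
    and "Y1 \<equiv> \<lambda>(x :: 'x, x' :: 'x, y1 :: 'y, y2 :: 'y, y12 :: 'y). y1"
    and "Y2 \<equiv> \<lambda>(x :: 'x, x' :: 'x, y1 :: 'y, y2 :: 'y, y12 :: 'y). y2"
    and "Y12 \<equiv> \<lambda>(x :: 'x, x' :: 'x, y1 :: 'y, y2 :: 'y, y12 :: 'y). y12"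
  assumes p: "is_pmf p" and ach: "achievable_MD p d R1 R2 (ereal D1) (ereal D2) (ereal D12)"
  shows "\<exists>L. fin_prob UNIV L \<and>
    (\<forall>x. fin_prob.prb UNIV L V x = p x) \<and>
    (\<forall>s. fin_prob.prb UNIV L (\<lambda>w. (V' w, Y1 w)) s = fin_prob.prb UNIV L (\<lambda>w. (V w, Y1 w)) s) \<and>
    fin_prob.mi UNIV L V' Y1 + fin_prob.cmi UNIV L V' Y2 Y1 \<le> R1 \<and>
    fin_prob.mi UNIV L V (\<lambda>w. (Y1 w, Y2 w, Y12 w)) + fin_prob.mi UNIV L V' Y2 \<le> R1 + R2 \<and>
    (\<Sum>w\<in>UNIV. L w * d (V w) (Y1 w)) \<le> D1 \<and>
    (\<Sum>w\<in>UNIV. L w * d (V w) (Y2 w)) \<le> D2 \<and>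
    (\<Sum>w\<in>UNIV. L w * d (V w) (Y12 w)) \<le> D12"
proof -
  define \<epsilon> where "\<epsilon> m = inverse (real (Suc m))" for m
  define good where "good m L \<longleftrightarrow> fin_prob UNIV L \<and>
    (\<forall>x. fin_prob.prb UNIV L V x = p x) \<and>
    (\<forall>s. fin_prob.prb UNIV L (\<lambda>w. (V' w, Y1 w)) s = fin_prob.prb UNIV L (\<lambda>w. (V w, Y1 w)) s) \<and>
    fin_prob.mi UNIV L V' Y1 + fin_prob.cmi UNIV L V' Y2 Y1 \<le> R1 + \<epsilon> m \<and>
    fin_prob.mi UNIV L V (\<lambda>w. (Y1 w, Y2 w, Y12 w)) + fin_prob.mi UNIV L V' Y2 \<le> R1 + R2 + 2 * \<epsilon> m \<and>
    (\<Sum>w\<in>UNIV. L w * d (V w) (Y1 w)) \<le> D1 + \<epsilon> m \<and>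
    (\<Sum>w\<in>UNIV. L w * d (V w) (Y2 w)) \<le> D2 + \<epsilon> m \<and>
    (\<Sum>w\<in>UNIV. L w * d (V w) (Y12 w)) \<le> D12 + \<epsilon> m" for m L
  have "\<exists>L. good m L" for m
  proof -
    have "0 < \<epsilon> m" by (simp add: \<epsilon>_def)
    then obtain n where n: "0 < n" and code: "md_code p d n (R1 + \<epsilon> m) (R2 + \<epsilon> m)
        (ereal D1 + ereal (\<epsilon> m)) (ereal D2 + ereal (\<epsilon> m)) (ereal D12 + ereal (\<epsilon> m))"
      using achievable_MD_code[OF ach] by blast
    show ?thesis using code
    proof (rule md_codeE)
      fix M1 M2 :: nat and f1 f2 c1 c2 c12
      assume f: "\<And>xs. length xs = n \<Longrightarrow> f1 xs < M1" "\<And>xs. length xs = n \<Longrightarrow> f2 xs < M2"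
        and r: "log 2 (real M1) / real n \<le> R1 + \<epsilon> m" "log 2 (real M2) / real n \<le> R2 + \<epsilon> m"
        and D: "ereal (avg_dist p d n (\<lambda>xs. c1 (f1 xs))) \<le> ereal D1 + ereal (\<epsilon> m)"
          "ereal (avg_dist p d n (\<lambda>xs. c2 (f2 xs))) \<le> ereal D2 + ereal (\<epsilon> m)"
          "ereal (avg_dist p d n (\<lambda>xs. c12 (f1 xs) (f2 xs))) \<le> ereal D12 + ereal (\<epsilon> m)"
      interpret block_code p n f1 f2 using p n by unfold_locales
      from block_law[where ?c1.0 = c1 and ?c2.0 = c2 and ?c12.0 = c12 and d = d and ?M1.0 = M1 and ?M2.0 = M2,
          folded V_def V'_def Y1_def Y2_def Y12_def, OF f]
      obtain L where L: "fin_prob UNIV L" "\<forall>x. fin_prob.prb UNIV L V x = p x"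
        "\<forall>s. fin_prob.prb UNIV L (\<lambda>w. (V' w, Y1 w)) s = fin_prob.prb UNIV L (\<lambda>w. (V w, Y1 w)) s"
        "fin_prob.mi UNIV L V' Y1 + fin_prob.cmi UNIV L V' Y2 Y1 \<le> log 2 (real M1) / real n"
        "fin_prob.mi UNIV L V (\<lambda>w. (Y1 w, Y2 w, Y12 w)) + fin_prob.mi UNIV L V' Y2
          \<le> log 2 (real M1) / real n + log 2 (real M2) / real n"
        "(\<Sum>w\<in>UNIV. L w * d (V w) (Y1 w)) = avg_dist p d n (\<lambda>u. c1 (f1 u))"
        "(\<Sum>w\<in>UNIV. L w * d (V w) (Y2 w)) = avg_dist p d n (\<lambda>u. c2 (f2 u))"
        "(\<Sum>w\<in>UNIV. L w * d (V w) (Y12 w)) = avg_dist p d n (\<lambda>u. c12 (f1 u) (f2 u))"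
        by blast
      show ?thesis unfolding good_def
      proof (intro exI[of _ L] conjI)
        show "fin_prob.mi UNIV L V' Y1 + fin_prob.cmi UNIV L V' Y2 Y1 \<le> R1 + \<epsilon> m" using L(4) r by linarith
        show "fin_prob.mi UNIV L V (\<lambda>w. (Y1 w, Y2 w, Y12 w)) + fin_prob.mi UNIV L V' Y2 \<le> R1 + R2 + 2 * \<epsilon> m"
          using L(5) r by linarith
      qed (use L D in simp_all)
    qed
  qed
  then obtain L where "\<And>m. good m (L m)" by metis
  then have L: "\<And>m. fin_prob UNIV (L m)" "\<And>m x. fin_prob.prb UNIV (L m) V x = p x"
    "\<And>m s. fin_prob.prb UNIV (L m) (\<lambda>w. (V' w, Y1 w)) s = fin_prob.prb UNIV (L m) (\<lambda>w. (V w, Y1 w)) s"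
    "\<And>m. fin_prob.mi UNIV (L m) V' Y1 + fin_prob.cmi UNIV (L m) V' Y2 Y1 \<le> R1 + \<epsilon> m"
    "\<And>m. fin_prob.mi UNIV (L m) V (\<lambda>w. (Y1 w, Y2 w, Y12 w)) + fin_prob.mi UNIV (L m) V' Y2 \<le> R1 + R2 + 2 * \<epsilon> m"
    "\<And>m. (\<Sum>w\<in>UNIV. L m w * d (V w) (Y1 w)) \<le> D1 + \<epsilon> m"
    "\<And>m. (\<Sum>w\<in>UNIV. L m w * d (V w) (Y2 w)) \<le> D2 + \<epsilon> m"
    "\<And>m. (\<Sum>w\<in>UNIV. L m w * d (V w) (Y12 w)) \<le> D12 + \<epsilon> m"
    unfolding good_def by blast+
  obtain L' r where r: "strict_mono r" and L': "fin_prob UNIV L'" and conv: "\<And>z. (\<lambda>m. L (r m) z) \<longlonglongrightarrow> L' z"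
    using sequence_of_laws_convergent[of L, OF L(1)] by blast
  have \<epsilon>: "(\<lambda>m. \<epsilon> (r m)) \<longlonglongrightarrow> 0"
    using LIMSEQ_subseq_LIMSEQ[OF LIMSEQ_inverse_real_of_nat r] by (simp add: \<epsilon>_def o_def)
  have lim: "l \<le> c" if "u \<longlonglongrightarrow> l" "\<And>m. u m \<le> c + b * \<epsilon> (r m)" for u l c b
  proof -
    have "(\<lambda>m. c + b * \<epsilon> (r m)) \<longlonglongrightarrow> c + b * 0" by (intro tendsto_intros \<epsilon>)
    then show ?thesis using LIMSEQ_le[OF that(1)] that(2) by simp
  qed
  show ?thesis
  proof (intro exI[of _ L'] conjI allI)
    show "fin_prob.prb UNIV L' V x = p x" for x
      using tendsto_prb[OF L(1) L' conv, of V x] by (simp add: L(2) LIMSEQ_const_iff)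
    show "fin_prob.prb UNIV L' (\<lambda>w. (V' w, Y1 w)) s = fin_prob.prb UNIV L' (\<lambda>w. (V w, Y1 w)) s" for s
      using tendsto_prb[OF L(1) L' conv, of "\<lambda>w. (V' w, Y1 w)" s] tendsto_prb[OF L(1) L' conv, of "\<lambda>w. (V w, Y1 w)" s]
      unfolding L(3) by (rule LIMSEQ_unique)
    show "fin_prob.mi UNIV L' V' Y1 + fin_prob.cmi UNIV L' V' Y2 Y1 \<le> R1"
      by (rule lim[where b = 1, OF tendsto_add[OF tendsto_mi[OF L(1) L' conv] tendsto_cmi[OF L(1) L' conv]]])
        (use L(4) in simp)
    show "fin_prob.mi UNIV L' V (\<lambda>w. (Y1 w, Y2 w, Y12 w)) + fin_prob.mi UNIV L' V' Y2 \<le> R1 + R2"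
      by (rule lim[where b = 2, OF tendsto_add[OF tendsto_mi[OF L(1) L' conv] tendsto_mi[OF L(1) L' conv]]])
        (use L(5) in simp)
    have E: "(\<lambda>m. \<Sum>w\<in>UNIV. L (r m) w * F w) \<longlonglongrightarrow> (\<Sum>w\<in>UNIV. L' w * F w)" for F
      by (intro tendsto_intros conv)
    show "(\<Sum>w\<in>UNIV. L' w * d (V w) (Y1 w)) \<le> D1" by (rule lim[where b = 1, OF E]) (use L(6) in simp)
    show "(\<Sum>w\<in>UNIV. L' w * d (V w) (Y2 w)) \<le> D2" by (rule lim[where b = 1, OF E]) (use L(7) in simp)
    show "(\<Sum>w\<in>UNIV. L' w * d (V w) (Y12 w)) \<le> D12" by (rule lim[where b = 1, OF E]) (use L(8) in simp)
  qed (rule L')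
qed

text \<open>Taking the second description constant turns scalable codes into a special case of the
  random coding theorem.\<close>

lemma achievable_MD_scalable:
  fixes L :: "'k::finite \<Rightarrow> real" and V :: "'k \<Rightarrow> 'x::finite" and Y B :: "'k \<Rightarrow> 'y::finite"
  assumes p: "is_pmf p" and d: "\<And>x y. 0 \<le> d x y" and card: "2 \<le> CARD('y)"
    and L: "fin_prob UNIV L" and V: "\<And>x. fin_prob.prb UNIV L V x = p x"
    and E1: "(\<Sum>w\<in>UNIV. L w * d (V w) (Y w)) \<le> D1" and E12: "(\<Sum>w\<in>UNIV. L w * d (V w) (B w)) \<le> D12"
  shows "\<exists>D2. achievable_MD p d (fin_prob.mi UNIV L V Y)
    (fin_prob.mi UNIV L V (\<lambda>w. (Y w, B w)) - fin_prob.mi UNIV L V Y) (ereal D1) (ereal D2) (ereal D12)"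
proof -
  define X' where "X' = (\<lambda>(x :: 'x, y :: 'y, a :: 'y, b :: 'y). x)"
  define Y' where "Y' = (\<lambda>(x :: 'x, y :: 'y, a :: 'y, b :: 'y). y)"
  define A' where "A' = (\<lambda>(x :: 'x, y :: 'y, a :: 'y, b :: 'y). a)"
  define B' where "B' = (\<lambda>(x :: 'x, y :: 'y, a :: 'y, b :: 'y). b)"
  define Z where "Z w = (V w, Y w, undefined :: 'y, B w)" for w
  have Z: "X' (Z w) = V w" "Y' (Z w) = Y w" "A' (Z w) = undefined" "B' (Z w) = B w" for w
    by (auto simp: Z_def X'_def Y'_def A'_def B'_def)
  interpret fin_prob UNIV L by fact
  define P where "P = prb Z"
  note im = L finite subset_UNIV[of "range Z"]
  interpret P: fin_prob UNIV P unfolding P_def by (rule fin_prob_image[OF im])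
  have prbP: "P.prb f v = prb (\<lambda>w. f (Z w)) v" for f :: "'x \<times> 'y \<times> 'y \<times> 'y \<Rightarrow> 'z" and v
    unfolding P_def by (rule prb_image[OF im])
  have EP: "(\<Sum>w\<in>UNIV. P w * F w) = (\<Sum>w\<in>UNIV. L w * F (Z w))" for F
    unfolding P_def by (rule sum_prb) auto
  have indep: "P.prb (\<lambda>w. (Y' w, A' w)) (y, a) = P.prb Y' y * P.prb A' a" for y a
  proof -
    have "P.prb A' a = (if a = undefined then 1 else 0)"
      unfolding P_def prb_image[OF im] Z by (auto simp: prb_def sum1)
    moreover have "P.prb (\<lambda>w. (Y' w, A' w)) (y, a) = (if a = undefined then P.prb Y' y else 0)"
      unfolding P_def prb_image[OF im] Z by (auto simp: prb_def)
    ultimately show ?thesis by simp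
  qed
  have pX: "P.prb X' x = p x" for x unfolding P_def prb_image[OF im] Z by (simp add: V)
  obtain k q g1 g2 where q: "valid_channel k q"
    "mutual_info (\<lambda>y j. \<Sum>x\<in>UNIV. p x * q x y j) UNIV {..<k} = 0"
    "mutual_info (\<lambda>x y. \<Sum>j<k. p x * q x y j) UNIV UNIV = P.mi X' Y'"
    "mutual_info (\<lambda>x (y, j). p x * q x y j) UNIV (UNIV \<times> {..<k}) = P.mi X' (\<lambda>w. (Y' w, A' w, B' w))"
    "(\<Sum>x\<in>UNIV. \<Sum>y\<in>UNIV. \<Sum>j<k. p x * q x y j * d x y) = (\<Sum>w\<in>UNIV. P w * d (X' w) (Y' w))"
    "(\<Sum>x\<in>UNIV. \<Sum>y\<in>UNIV. \<Sum>j<k. p x * q x y j * d x (g1 j)) = (\<Sum>w\<in>UNIV. P w * d (X' w) (A' w))"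
    "(\<Sum>x\<in>UNIV. \<Sum>y\<in>UNIV. \<Sum>j<k. p x * q x y j * d x (g2 y j)) = (\<Sum>w\<in>UNIV. P w * d (X' w) (B' w))"
    using functional_representation[of P p d, folded X'_def Y'_def A'_def B'_def,
        OF P.fin_prob_axioms pX indep card] by blast
  have mi: "P.mi X' Y' = mi V Y" "P.mi X' (\<lambda>w. (Y' w, A' w, B' w)) = mi V (\<lambda>w. (Y w, B w))"
  proof -
    show "P.mi X' Y' = mi V Y" unfolding P_def mi_image[OF im] Z ..
    have "P.mi X' (\<lambda>w. (Y' w, A' w, B' w)) = mi V (\<lambda>w. (Y w, undefined :: 'y, B w))"
      unfolding P_def mi_image[OF im] Z ..
    also have "\<dots> = mi V (\<lambda>w. (Y w, B w))" by (rule mi_cong) auto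
    finally show "P.mi X' (\<lambda>w. (Y' w, A' w, B' w)) = mi V (\<lambda>w. (Y w, B w))" .
  qed
  have "achievable_MD p d (P.mi X' Y') (P.mi X' (\<lambda>w. (Y' w, A' w, B' w)) - P.mi X' Y')
    (ereal (\<Sum>w\<in>UNIV. P w * d (X' w) (Y' w))) (ereal (\<Sum>w\<in>UNIV. P w * d (X' w) (A' w)))
    (ereal (\<Sum>w\<in>UNIV. P w * d (X' w) (B' w)))"
    by (rule achievable_MD_single_letter[OF p d q(1,2) q(3,4)[symmetric] q(5,6,7)[symmetric]])
  then have "achievable_MD p d (mi V Y) (mi V (\<lambda>w. (Y w, B w)) - mi V Y)
    (ereal D1) (ereal (\<Sum>w\<in>UNIV. P w * d (X' w) (A' w))) (ereal D12)"
    unfolding mi by (rule achievable_MD_mono) (use E1 E12 in \<open>simp_all add: EP Z\<close>)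
  then show ?thesis by blast
qed

text \<open>Mixing the rows \<open>p(v' | y1)\<close> with the weights of \<open>Y1\<close> given a value of \<open>Y2\<close> returns the law of
  \<open>V'\<close>, whatever that value is.\<close>

lemma indep_of_not_weakly_indep:
  fixes V' :: "'k::finite \<Rightarrow> 'x::finite" and Y1 :: "'k \<Rightarrow> 'y::finite" and Y2 :: "'k \<Rightarrow> 'z::finite"
  assumes L: "fin_prob UNIV L"
    and c0: "fin_prob.cmi UNIV L V' Y2 Y1 \<le> 0" and m0: "fin_prob.mi UNIV L V' Y2 \<le> 0"
    and nw: "\<not> weakly_indep (\<lambda>x y. fin_prob.prb UNIV L (\<lambda>w. (V' w, Y1 w)) (x, y)) UNIV UNIV"
  shows "fin_prob.prb UNIV L (\<lambda>w. (Y1 w, Y2 w)) (y, b) = fin_prob.prb UNIV L Y1 y * fin_prob.prb UNIV L Y2 b"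
proof -
  interpret fin_prob UNIV L by fact
  let ?W = "\<lambda>x y. prb (\<lambda>w. (V' w, Y1 w)) (x, y)"
  define S where "S = {y \<in> UNIV. prb Y1 y > 0}"
  \<comment> \<open>Coefficients of a linear relation among the rows p(v' | y): the deviation of the
    pair law from the product at the fixed value b. By conditional independence the combination sums
    to p(x, b) - p(b) p(x), which is zero since V' and Y2 are independent.\<close>
  define c where "c y = prb (\<lambda>w. (Y2 w, Y1 w)) (b, y) - prb Y2 b * prb Y1 y" for y
  have PV: "(\<lambda>y. \<Sum>x\<in>UNIV. ?W x y) = prb Y1" using prb_marginal'[of UNIV V' Y1] by auto
  have out: "prb Y1 y = 0" if "y \<notin> S" for y
    using that prb_nonneg[of Y1 y] by (auto simp: S_def)
  have out2: "prb (\<lambda>w. (Y2 w, Y1 w)) (b, y) \<le> prb Y1 y" for y by (rule prb_mono) auto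
  have W_le: "?W x y \<le> prb Y1 y" for x y by (rule prb_mono) auto
  have "(\<Sum>y\<in>S. c y * (?W x y / prb Y1 y)) = 0" for x
  proof -
    have "(\<Sum>y\<in>S. c y * (?W x y / prb Y1 y)) =
       (\<Sum>y\<in>S. prb (\<lambda>w. (V' w, Y2 w, Y1 w)) (x, b, y) - prb Y2 b * ?W x y)"
      by (intro sum.cong refl) (simp add: cmi_zero_imp[OF c0] c_def S_def field_simps)
    also have "\<dots> = (\<Sum>y\<in>UNIV. prb (\<lambda>w. (V' w, Y2 w, Y1 w)) (x, b, y) - prb Y2 b * ?W x y)"
    proof (rule sum.mono_neutral_left)
      show "\<forall>y\<in>UNIV - S. prb (\<lambda>w. (V' w, Y2 w, Y1 w)) (x, b, y) - prb Y2 b * ?W x y = 0"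
      proof
        fix y assume "y \<in> UNIV - S"
        then have "prb Y1 y = 0" using out by simp
        then have "?W x y = 0" using W_le[of x y] prb_nonneg[of "\<lambda>w. (V' w, Y1 w)" "(x, y)"] by simp
        then show "prb (\<lambda>w. (V' w, Y2 w, Y1 w)) (x, b, y) - prb Y2 b * ?W x y = 0"
          by (simp add: cmi_zero_imp[OF c0])
      qed
    qed auto
    also have "\<dots> = prb (\<lambda>w. (V' w, Y2 w)) (x, b) - prb Y2 b * prb V' x"
    proof -
      have "prb (\<lambda>w. (V' w, Y2 w, Y1 w)) (x, b, y) = prb (\<lambda>w. ((V' w, Y2 w), Y1 w)) ((x, b), y)" for y
        by (rule prb_cong) auto
      then show ?thesis
        using prb_marginal[of UNIV Y1 "\<lambda>w. (V' w, Y2 w)" "(x, b)"] prb_marginal[of UNIV Y1 V' x]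
        by (simp add: sum_subtractf sum_distrib_left[symmetric])
    qed
    also have "\<dots> = 0" using mi_zero_imp[OF m0, of x b] by simp
    finally show ?thesis .
  qed
  then have cS: "c y = 0" if "y \<in> S" for y
    using nw that unfolding weakly_indep_def Let_def PV S_def by blast
  have "c y = 0"
  proof (cases "y \<in> S")
    case False
    then show ?thesis using out[OF False] out2[of y] prb_nonneg[of "\<lambda>w. (Y2 w, Y1 w)" "(b, y)"]
      by (simp add: c_def)
  qed (rule cS)
  moreover have "prb (\<lambda>w. (Y1 w, Y2 w)) (y, b) = prb (\<lambda>w. (Y2 w, Y1 w)) (b, y)" by (rule prb_cong) auto
  ultimately show ?thesis by (simp add: c_def)
qed

lemma D2star_set_eq:
  "D2star_set p d D1 D12 = {D2. achievable_MD p d (rate_dist p d D1)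
    (rate_SC p d (rate_dist p d D1) D1 D12 - rate_dist p d D1) (ereal D1) (ereal D2) (ereal D12)}"
proof -
  have "R1 + R2 = R \<longleftrightarrow> R2 = R - R1" for R1 R2 R :: real by linarith
  then show ?thesis unfolding D2star_set_def by simp
qed

text \<open>Two squeezes on the limit law. First, R(D1) \<le> I(V; Y1) = I(V'; Y1), so the first
  rate leaves nothing for I(V'; Y2 | Y1). Second, I(V; Y1 Y2 Y12) is at least the scalable sum rate,
  so the sum rate leaves nothing for I(V'; Y2).\<close>

lemma single_letter_le_achievable:
  fixes p :: "'x::finite \<Rightarrow> real" and d :: "'x \<Rightarrow> 'y::finite \<Rightarrow> real"
  assumes p: "is_pmf p" and d: "\<And>x y. 0 \<le> d x y" and card: "2 \<le> CARD('y)"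
    and nw: "\<And>c. test_channel c \<Longrightarrow> exp_dist p d c \<le> D1 \<Longrightarrow>
       mutual_info (\<lambda>x y. p x * c x y) UNIV UNIV = rate_dist p d D1
       \<Longrightarrow> \<not> weakly_indep (\<lambda>x y. p x * c x y) UNIV UNIV"
    and D2: "D2 \<in> D2star_set p d D1 D12"
  shows "\<exists>v\<in>single_letter_set p d D1 D12 (\<lambda>k. k \<le> CARD('y) ^ 4 - CARD('y)). v \<le> D2"
proof -
  define R1 where "R1 = rate_dist p d D1"
  define R where "R = rate_SC p d R1 D1 D12"
  have ach: "achievable_MD p d R1 (R - R1) (ereal D1) (ereal D2) (ereal D12)"
    using D2 unfolding D2star_set_eq R1_def R_def by simp
  define V where "V = (\<lambda>(x :: 'x, x' :: 'x, y1 :: 'y, y2 :: 'y, y12 :: 'y). x)"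
  define V' where "V' = (\<lambda>(x :: 'x, x' :: 'x, y1 :: 'y, y2 :: 'y, y12 :: 'y). x')"
  define Y1 where "Y1 = (\<lambda>(x :: 'x, x' :: 'x, y1 :: 'y, y2 :: 'y, y12 :: 'y). y1)"
  define Y2 where "Y2 = (\<lambda>(x :: 'x, x' :: 'x, y1 :: 'y, y2 :: 'y, y12 :: 'y). y2)"
  define Y12 where "Y12 = (\<lambda>(x :: 'x, x' :: 'x, y1 :: 'y, y2 :: 'y, y12 :: 'y). y12)"
  from converse_law[OF p ach, folded V_def V'_def Y1_def Y2_def Y12_def]
  obtain L where L: "fin_prob UNIV L" and V: "\<And>x. fin_prob.prb UNIV L V x = p x"
    and same: "\<And>s. fin_prob.prb UNIV L (\<lambda>w. (V' w, Y1 w)) s = fin_prob.prb UNIV L (\<lambda>w. (V w, Y1 w)) s"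
    and I1: "fin_prob.mi UNIV L V' Y1 + fin_prob.cmi UNIV L V' Y2 Y1 \<le> R1"
    and I12: "fin_prob.mi UNIV L V (\<lambda>w. (Y1 w, Y2 w, Y12 w)) + fin_prob.mi UNIV L V' Y2 \<le> R"
    and E: "(\<Sum>w\<in>UNIV. L w * d (V w) (Y1 w)) \<le> D1" "(\<Sum>w\<in>UNIV. L w * d (V w) (Y2 w)) \<le> D2"
      "(\<Sum>w\<in>UNIV. L w * d (V w) (Y12 w)) \<le> D12"
    by auto
  interpret fin_prob UNIV L by fact
  obtain c where c: "test_channel c" "\<And>x y. p x * c x y = prb (\<lambda>w. (V w, Y1 w)) (x, y)"
    "exp_dist p d c = (\<Sum>w\<in>UNIV. L w * d (V w) (Y1 w))"
    "mutual_info (\<lambda>x y. p x * c x y) UNIV UNIV = mi V Y1"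
    using channel_of_law[OF L V, of Y1 d] by blast
  have R1_le: "R1 \<le> mi V Y1"
    using rate_dist_le[OF p c(1), of d D1] c(3,4) E(1) by (simp add: R1_def)
  have "mutual_info (\<lambda>x y. p x * c x y) UNIV UNIV = mi V' Y1"
    by (rule mutual_info_eq_mi) (auto simp: c(2) same)
  then have mV': "mi V' Y1 = mi V Y1" using c(4) by simp
  have mV: "mi V Y1 = R1" using R1_le I1 mV' cmi_nonneg[of V' Y2 Y1] by linarith
  have c0: "cmi V' Y2 Y1 \<le> 0" using I1 mV' mV by linarith
  \<comment> \<open>A scalable code built from (Y1, Y12) has first rate R(D1), since I(V; Y1) has
    just been identified; its sum rate therefore cannot be below \<open>R\<close>.\<close>
  obtain D2' where "achievable_MD p d (mi V Y1) (mi V (\<lambda>w. (Y1 w, Y12 w)) - mi V Y1) (ereal D1) (ereal D2') (ereal D12)"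
    using achievable_MD_scalable[OF p d card L V E(1,3)] by blast
  from rate_SC_le[OF this] have "R \<le> mi V (\<lambda>w. (Y1 w, Y12 w))" by (simp add: mV R_def)
  also have "\<dots> \<le> mi V (\<lambda>w. (Y1 w, Y2 w, Y12 w))" by (rule mi_mono) auto
  finally have R_le: "R \<le> mi V (\<lambda>w. (Y1 w, Y2 w, Y12 w))" .
  have m0: "mi V' Y2 \<le> 0" using R_le I12 by linarith
  have mR: "mi V (\<lambda>w. (Y1 w, Y2 w, Y12 w)) = R" using R_le I12 mi_nonneg[of V' Y2] by linarith
  have "\<not> weakly_indep (\<lambda>x y. prb (\<lambda>w. (V' w, Y1 w)) (x, y)) UNIV UNIV"
    using nw[OF c(1)] c(3,4) E(1) mV unfolding c(2) same by (simp add: R1_def)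
  note indep = indep_of_not_weakly_indep[OF L c0 m0 this]
  define X' where "X' = (\<lambda>(x :: 'x, y :: 'y, a :: 'y, b :: 'y). x)"
  define Y' where "Y' = (\<lambda>(x :: 'x, y :: 'y, a :: 'y, b :: 'y). y)"
  define A' where "A' = (\<lambda>(x :: 'x, y :: 'y, a :: 'y, b :: 'y). a)"
  define B' where "B' = (\<lambda>(x :: 'x, y :: 'y, a :: 'y, b :: 'y). b)"
  \<comment> \<open>The resampled letter has served its purpose once Y1 and Y2 are known to be
    independent; it is dropped before the functional representation.\<close>
  define Z where "Z w = (V w, Y1 w, Y2 w, Y12 w)" for w
  have Z: "X' (Z w) = V w" "Y' (Z w) = Y1 w" "A' (Z w) = Y2 w" "B' (Z w) = Y12 w" for w
    by (auto simp: Z_def X'_def Y'_def A'_def B'_def)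
  define P where "P = prb Z"
  note im = L finite subset_UNIV[of "range Z"]
  have P: "fin_prob UNIV P" unfolding P_def by (rule fin_prob_image[OF im])
  have EP: "(\<Sum>w\<in>UNIV. P w * F w) = (\<Sum>w\<in>UNIV. L w * F (Z w))" for F
    unfolding P_def by (rule sum_prb) auto
  have i: "fin_prob.prb UNIV P (\<lambda>w. (Y' w, A' w)) (y, a) = fin_prob.prb UNIV P Y' y * fin_prob.prb UNIV P A' a" for y a
    unfolding P_def prb_image[OF im] Z by (rule indep)
  have pX: "fin_prob.prb UNIV P X' x = p x" for x unfolding P_def prb_image[OF im] Z by (rule V)
  have mi: "fin_prob.mi UNIV P X' Y' = R1" "fin_prob.mi UNIV P X' (\<lambda>w. (Y' w, A' w, B' w)) = R"
    unfolding P_def mi_image[OF im] Z by (rule mV mR)+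
  obtain k q g1 g2 where k: "k \<le> CARD('y) ^ 4 - CARD('y)" and q: "valid_channel k q"
    "mutual_info (\<lambda>y j. \<Sum>x\<in>UNIV. p x * q x y j) UNIV {..<k} = 0"
    "mutual_info (\<lambda>x y. \<Sum>j<k. p x * q x y j) UNIV UNIV = R1"
    "mutual_info (\<lambda>x (y, j). p x * q x y j) UNIV (UNIV \<times> {..<k}) = R"
    and E': "(\<Sum>x\<in>UNIV. \<Sum>y\<in>UNIV. \<Sum>j<k. p x * q x y j * d x y) = (\<Sum>w\<in>UNIV. P w * d (X' w) (Y' w))"
    "(\<Sum>x\<in>UNIV. \<Sum>y\<in>UNIV. \<Sum>j<k. p x * q x y j * d x (g1 j)) = (\<Sum>w\<in>UNIV. P w * d (X' w) (A' w))"
    "(\<Sum>x\<in>UNIV. \<Sum>y\<in>UNIV. \<Sum>j<k. p x * q x y j * d x (g2 y j)) = (\<Sum>w\<in>UNIV. P w * d (X' w) (B' w))"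
    using functional_representation[of P p d, folded X'_def Y'_def A'_def B'_def, OF P pX i card]
    unfolding mi by blast
  show ?thesis
  proof (rule bexI)
    show "(\<Sum>x\<in>UNIV. \<Sum>y\<in>UNIV. \<Sum>j<k. p x * q x y j * d x (g1 j)) \<le> D2"
      unfolding E'(2) EP Z by (rule E)
    have "(\<Sum>x\<in>UNIV. \<Sum>y\<in>UNIV. \<Sum>j<k. p x * q x y j * d x y) \<le> D1"
      "(\<Sum>x\<in>UNIV. \<Sum>y\<in>UNIV. \<Sum>j<k. p x * q x y j * d x (g2 y j)) \<le> D12"
      unfolding E' EP Z by (rule E)+
    then show "(\<Sum>x\<in>UNIV. \<Sum>y\<in>UNIV. \<Sum>j<k. p x * q x y j * d x (g1 j))
      \<in> single_letter_set p d D1 D12 (\<lambda>k. k \<le> CARD('y) ^ 4 - CARD('y))"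
      unfolding single_letter_set_def mem_Collect_eq R1_def[symmetric] R_def[symmetric]
      using k q unfolding valid_channel_def
      by (intro exI[of _ k] exI[of _ q] exI[of _ g1] conjI refl) (blast | simp)+
  qed
qed

lemma single_letter_achievable:
  assumes p: "is_pmf p" and d: "\<And>x y. 0 \<le> d x y"
  shows "single_letter_set p d D1 D12 K \<subseteq> D2star_set p d D1 D12"
proof
  fix v assume "v \<in> single_letter_set p d D1 D12 K"
  then obtain k q g1 g2 where v: "v = (\<Sum>x\<in>UNIV. \<Sum>y\<in>UNIV. \<Sum>j<k. p x * q x y j * d x (g1 j))"
    and q: "valid_channel k q"
    and i0: "mutual_info (\<lambda>y j. \<Sum>x\<in>UNIV. p x * q x y j) UNIV {..<k} = 0"
    and i1: "mutual_info (\<lambda>x y. \<Sum>j<k. p x * q x y j) UNIV UNIV = rate_dist p d D1"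
    and i12: "mutual_info (\<lambda>x (y, j). p x * q x y j) UNIV (UNIV \<times> {..<k})
          = rate_SC p d (rate_dist p d D1) D1 D12"
    and e1: "(\<Sum>x\<in>UNIV. \<Sum>y\<in>UNIV. \<Sum>j<k. p x * q x y j * d x y) \<le> D1"
    and e12: "(\<Sum>x\<in>UNIV. \<Sum>y\<in>UNIV. \<Sum>j<k. p x * q x y j * d x (g2 y j)) \<le> D12"
    unfolding single_letter_set_def valid_channel_def by blast
  have "achievable_MD p d (rate_dist p d D1) (rate_SC p d (rate_dist p d D1) D1 D12 - rate_dist p d D1)
     (ereal D1) (ereal v) (ereal D12)"
    by (rule achievable_MD_mono[OF achievable_MD_single_letter[OF p d q i0 i1[symmetric] i12[symmetric] refl v refl]])
      (use e1 e12 in auto)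
  then show "v \<in> D2star_set p d D1 D12"
    unfolding D2star_set_eq by simp
qed

text \<open>Nonemptiness needs a scalable code whose first rate is exactly R(D1). Given one, the
  scalable sum rate is attained and the missing constraint on the second decoder is made finite;
  closedness and nonnegativity of distortions then give a minimum.\<close>

lemma D2star_min:
  fixes p :: "'x::finite \<Rightarrow> real" and d :: "'x \<Rightarrow> 'y::finite \<Rightarrow> real"
  assumes p: "is_pmf p" and d: "\<And>x y. 0 \<le> d x y" and card: "2 \<le> CARD('y)"
    and ex1: "\<exists>c. test_channel c \<and> exp_dist p d c \<le> D1"
    and ex12: "\<exists>c. test_channel c \<and> exp_dist p d c \<le> D12"
  shows "\<exists>v. is_min_of (D2star_set p d D1 D12) v"
proof -
  define R1 where "R1 = rate_dist p d D1"
  define R where "R = rate_SC p d R1 D1 D12"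
  have S: "D2star_set p d D1 D12 = {D2. achievable_MD p d R1 (R - R1) (ereal D1) (ereal D2) (ereal D12)}"
    unfolding D2star_set_eq R1_def R_def ..
  \<comment> \<open>\<open>c1\<close> must be optimal because the first rate is pinned to R(D1); for
    the joint decoder any feasible \<open>c2\<close> is enough, as the rate of the second
    description is only required to be finite here.\<close>
  obtain c1 where c1: "test_channel c1" "exp_dist p d c1 \<le> D1"
    "mutual_info (\<lambda>x y. p x * c1 x y) UNIV UNIV = R1"
    using rate_dist_attained[OF p ex1] unfolding R1_def by blast
  obtain c2 where c2: "test_channel c2" "exp_dist p d c2 \<le> D12" using ex12 by blast
  \<comment> \<open>The two reconstructions are drawn conditionally independently given the source
    letter, which preserves both expected distortions.\<close>
  define L where "L = (\<lambda>((x, y), b). p x * c1 x y * c2 x b)"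
  have s1: "(\<Sum>y\<in>UNIV. c1 x y) = 1" "(\<Sum>y\<in>UNIV. c2 x y) = 1" for x
    using c1 c2 by (auto simp: test_channel_def)
  have nn: "0 \<le> p x" "0 \<le> c1 x y" "0 \<le> c2 x y" and psum: "sum p UNIV = 1" for x y
    using p c1 c2 by (auto simp: is_pmf_def test_channel_def)
  have EL: "(\<Sum>w\<in>UNIV. L w * F w) = (\<Sum>x\<in>UNIV. \<Sum>y\<in>UNIV. \<Sum>b\<in>UNIV. p x * c1 x y * c2 x b * F ((x, y), b))" for F
    unfolding UNIV_Times_UNIV[symmetric] sum.cartesian_product' by (simp add: L_def)
  have "sum L UNIV = 1"
    using EL[of "\<lambda>_. 1"] by (simp add: sum_distrib_left[symmetric] s1 psum)
  then interpret fin_prob UNIV L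
    using nn by unfold_locales (auto simp: L_def)
  have prb1: "prb (\<lambda>w. (fst (fst w), snd (fst w))) (x, y) = p x * c1 x y" for x y
  proof -
    have "{w :: ('x \<times> 'y) \<times> 'y. w \<in> UNIV \<and> (fst (fst w), snd (fst w)) = (x, y)} = range (Pair (x, y))" by auto
    then have "prb (\<lambda>w. (fst (fst w), snd (fst w))) (x, y) = (\<Sum>b\<in>UNIV. L ((x, y), b))"
      unfolding prb_def by (simp add: sum.reindex inj_on_def)
    then show ?thesis by (simp add: L_def sum_distrib_left[symmetric] s1)
  qed
  have V: "prb (\<lambda>w. fst (fst w)) x = p x" for x
    using prb_marginal[of UNIV "\<lambda>w. snd (fst w)" "\<lambda>w. fst (fst w)" x]
    unfolding prb1 by (simp add: sum_distrib_left[symmetric] s1)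
  have "mutual_info (\<lambda>x y. p x * c1 x y) UNIV UNIV = mi (\<lambda>w. fst (fst w)) (\<lambda>w. snd (fst w))"
    by (rule mutual_info_eq_mi) (use prb1 in auto)
  then have mR1: "mi (\<lambda>w. fst (fst w)) (\<lambda>w. snd (fst w)) = R1" using c1 by simp
  have "(\<Sum>w\<in>UNIV. L w * d (fst (fst w)) (snd (fst w))) = exp_dist p d c1"
    unfolding EL exp_dist_def
    by (intro sum.cong refl) (simp add: sum_distrib_left[symmetric] sum_distrib_right[symmetric] s1)
  moreover have "(\<Sum>w\<in>UNIV. L w * d (fst (fst w)) (snd w)) = exp_dist p d c2"
  proof -
    have "(\<Sum>y\<in>UNIV. \<Sum>b\<in>UNIV. p x * c1 x y * c2 x b * d x b) = (\<Sum>b\<in>UNIV. p x * c2 x b * d x b)" for x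
    proof -
      have "(\<Sum>y\<in>UNIV. \<Sum>b\<in>UNIV. p x * c1 x y * c2 x b * d x b) = (\<Sum>y\<in>UNIV. c1 x y * (\<Sum>b\<in>UNIV. p x * c2 x b * d x b))"
        by (simp add: sum_distrib_left ac_simps)
      then show ?thesis by (simp add: sum_distrib_right[symmetric] s1)
    qed
    then show ?thesis unfolding EL exp_dist_def by simp
  qed
  ultimately have "\<exists>D2. achievable_MD p d (mi (\<lambda>w. fst (fst w)) (\<lambda>w. snd (fst w)))
     (mi (\<lambda>w. fst (fst w)) (\<lambda>w. (snd (fst w), snd w)) - mi (\<lambda>w. fst (fst w)) (\<lambda>w. snd (fst w)))
     (ereal D1) (ereal D2) (ereal D12)"
    using c1 c2 by (intro achievable_MD_scalable p d card fin_prob_axioms V) simp_all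
  then obtain D2 where "achievable_MD p d R1 (mi (\<lambda>w. fst (fst w)) (\<lambda>w. (snd (fst w), snd w)) - R1)
     (ereal D1) (ereal D2) (ereal D12)"
    unfolding mR1 by blast
  from rate_SC_attained[OF this]
  have ach: "achievable_MD p d R1 (R - R1) (ereal D1) \<infinity> (ereal D12)"
    unfolding achievable_SC_def R_def .
  define dm where "dm = (\<Sum>x\<in>UNIV. \<Sum>y\<in>UNIV. d x y)"
  have dm: "d x y \<le> dm" for x y unfolding dm_def using d by (rule le_double_sum)
  let ?S = "{D2. achievable_MD p d R1 (R - R1) (ereal D1) (ereal D2) (ereal D12)}"
  have ne: "?S \<noteq> {}" using achievable_MD_bounded_distortion[OF ach p d dm] by blast
  have bdd: "bdd_below ?S"
  proof (rule bdd_belowI[of _ 0])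
    fix D2 assume "D2 \<in> ?S"
    then have "achievable_MD p d R1 (R - R1) (ereal D1) (ereal D2) (ereal D12)" by simp
    then show "0 \<le> D2" using p d by (rule achievable_MD_D2_nonneg)
  qed
  have "Inf ?S \<in> ?S" unfolding mem_Collect_eq
  proof (rule achievable_MD_limit)
    fix \<delta> :: real assume "0 < \<delta>"
    then have "Inf ?S < Inf ?S + \<delta>" by simp
    from cInf_lessD[OF ne this] obtain s where "s \<in> ?S" "s < Inf ?S + \<delta>" by blast
    then show "\<exists>R2' D2'. R2' \<le> R - R1 + \<delta> \<and> D2' \<le> ereal (Inf ?S) + ereal \<delta> \<and>
      achievable_MD p d R1 R2' (ereal D1) D2' (ereal D12)"
      using \<open>0 < \<delta>\<close> by (intro exI[of _ "R - R1"] exI[of _ "ereal s"]) auto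
  qed
  moreover have "\<forall>w\<in>?S. Inf ?S \<le> w" using bdd by (auto intro: cInf_lower)
  ultimately show ?thesis unfolding S is_min_of_def by blast
qed

theorem theorem4:
  fixes p :: "'x::finite \<Rightarrow> real" and d :: "'x \<Rightarrow> 'y::finite \<Rightarrow> real"
    and D1 D12 :: real
  assumes "is_pmf p"
    and "\<forall>x y. 0 \<le> d x y"
    and "CARD('y) \<ge> 2"
    and "\<exists>c. test_channel c \<and> exp_dist p d c \<le> D1"
    and "\<exists>c. test_channel c \<and> exp_dist p d c \<le> D12"
    and "\<forall>c. test_channel c \<and> exp_dist p d c \<le> D1 \<and>
             mutual_info (\<lambda>x y. p x * c x y) UNIV UNIV = rate_dist p d D1
           \<longrightarrow> \<not> weakly_indep (\<lambda>x y. p x * c x y) UNIV UNIV"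
  shows "\<exists>v. is_min_of (D2star_set p d D1 D12) v \<and>
             is_min_of (single_letter_set p d D1 D12 (\<lambda>k. True)) v \<and>
             is_min_of (single_letter_set p d D1 D12
                       (\<lambda>k. k \<le> CARD('y) ^ 4 - CARD('y))) v"
proof -
  let ?K = "\<lambda>k. k \<le> CARD('y) ^ 4 - CARD('y)"
  have d: "0 \<le> d x y" for x y using assms(2) by blast
  obtain v where v: "v \<in> D2star_set p d D1 D12" "\<forall>w\<in>D2star_set p d D1 D12. v \<le> w"
    using D2star_min[OF assms(1) d assms(3-5)] unfolding is_min_of_def by blast
  have sub: "single_letter_set p d D1 D12 K \<subseteq> D2star_set p d D1 D12" for K
    by (rule single_letter_achievable[OF assms(1)]) (rule d)
  \<comment> \<open>The converse places a single-letter value w below the operational minimum v, and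
    the inclusion places v below w; so v itself is a single-letter value within the cardinality
    bound, and larger alphabets cannot go below it.\<close>
  have "\<exists>w\<in>single_letter_set p d D1 D12 ?K. w \<le> v"
    by (rule single_letter_le_achievable) (use assms d v in auto)
  then obtain w where w: "w \<in> single_letter_set p d D1 D12 ?K" "w \<le> v" by blast
  have "v \<le> w" using v(2) sub[of ?K] w(1) by blast
  then have vK: "v \<in> single_letter_set p d D1 D12 ?K" using w by simp
  then have "v \<in> single_letter_set p d D1 D12 (\<lambda>k. True)"
    unfolding single_letter_set_def by blast
  then show ?thesis using vK v sub[of ?K] sub[of "\<lambda>k. True"] unfolding is_min_of_def by blast
qed

end
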